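(* Let $(u_0,\rho_0,\mu_0)\in\mathcal{D}$ and for $t\ge 0$ set $(u(t),\rho(t),\mu(t))=T_t(u_0,\rho_0,\mu_0)$, where $T_t=M\circ S_t\circ L:\mathcal{D}\to\mathcal{D}$. Then $(u,\rho,\mu)$ is a conservative weak solution of the two-component Hunter--Saxton system with initial data $(u_0,\rho_0,\mu_0)$; that is, for every test function $\phi\in C_0^\infty(\mathbb{R}\times[0,\infty))$, $$\int_0^\infty\!\!\int_{\mathbb{R}}\Big(u\phi_t+\tfrac12u^2\phi_x+\tfrac14\Big(\int_{-\infty}^x \mathrm{d}\mu(t)-\int_x^\infty \mathrm{d}\mu(t)\Big)\phi\Big)\,\mathrm{d}x\,\mathrm{d}t=-\int_{\mathbb{R}}u_0(x)\phi(x,0)\,\mathrm{d}x,$$ $$\int_0^\infty\!\!\int_{\mathbb{R}}(\rho\phi_t+\rho u\phi_x)\,\mathrm{d}x\,\mathrm{d}t=-\int_{\mathbb{R}}\rho_0(x)\phi(x,0)\,\mathrm{d}x,$$ $$\int_0^\infty\!\!\int_{\mathbb{R}}(\phi_t+u\phi_x)\,\mathrm{d}\mu(t)\,\mathrm{d}t=-\int_{\mathbb{R}}\phi(x,0)\,\mathrm{d}\mu_0(x),$$ and in addition $\mu(t)(\mathbb{R})=\mu_0(\mathbb{R})$ for all $t\ge0$.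
   Context: The two-component Hunter--Saxton system is $u_t+uu_x=\frac14\big(\int_{-\infty}^x(u_x^2+\rho^2)\,\mathrm{d}z-\int_x^\infty(u_x^2+\rho^2)\,\mathrm{d}z\big)$, $\rho_t+(u\rho)_x=0$ on $\mathbb{R}$; a conservative weak solution is a time-dependent triple $(u(t),\rho(t),\mu(t))\in\mathcal{D}$ satisfying the identities in the claim. Function spaces. $E_2=\{f\in L^\infty(\mathbb{R}): f'\in L^2(\mathbb{R})\}$ and $E_1=\{f\in E_2:\lim_{x\to-\infty}f(x)=0\}$, both with norm $\|f\|_\infty+\|f'\|_2$ (elements are identified with their continuous representatives). $B=E_2\times E_2\times E_1\times L^2(\mathbb{R})$ with the sum of the component norms. $\mathcal{D}$ (Eulerian coordinates) is the set of triples $(u,\rho,\mu)$ with $u\in E_2$, $\rho\in L^2(\mathbb{R})$, $\mu$ a positive finite Radon measure on $\mathbb{R}$ whose absolutely continuous part is $\mu_{ac}=(u_x^2+\rho^2)\,\mathrm{d}x$. $\mathcal{F}$ (Lagrangian coordinates) is the set of quadruples $X=(y,U,H,r)$ with $(y-\mathrm{id},U,H,r)\in B$ for which there is $c>0$ such that: (i) $y-\mathrm{id},U,H\in W^{1,\infty}(\mathbb{R})$, $r\in L^\infty(\mathbb{R})$; (ii) $y_\xi\ge0$, $H_\xi\ge0$, $y_\xi+H_\xi\ge c$ a.e.; (iii) $y_\xi H_\xi=U_\xi^2+r^2$ a.e. $\mathcal{F}_0=\{X\in\mathcal{F}: y+H=\mathrm{id}\}$. $H_\infty=\lim_{\xi\to\infty}H(\xi)$.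 $L:\mathcal{D}\to\mathcal{F}_0$, $L(u,\rho,\mu)=(y,U,H,r)$ with $y(\xi)=\sup\{x:\mu((-\infty,x))+x<\xi\}$, $H(\xi)=\xi-y(\xi)$, $U=u\circ y$, $r=(\rho\circ y)\,y_\xi$. $M:\mathcal{F}\to\mathcal{D}$, $M(y,U,H,r)=(u,\rho,\mu)$ with $u(x)=U(\xi)$ for any $\xi$ with $y(\xi)=x$, $\rho\,\mathrm{d}x=y_\#(r\,\mathrm{d}\xi)$, $\mu=y_\#(H_\xi\,\mathrm{d}\xi)$, where $y_\#$ denotes push-forward of measures by $y$. $S_t:\mathcal{F}\to\mathcal{F}$ ($t\ge0$) is the solution operator of $y_t=U$, $U_t=\frac12H-\frac14H_\infty$, $H_t=0$, $r_t=0$, i.e. $S_t(y_0,U_0,H_0,r_0)=\big(\frac14(H_0-\frac12H_\infty)t^2+U_0t+y_0,\ \frac12(H_0-\frac12H_\infty)t+U_0,\ H_0,\ r_0\big)$ with $H_\infty=\lim_{\xi\to\infty}H_0(\xi)$. *)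

theory Defs
  imports "HOL-Analysis.Analysis"
begin

section \<open>Test functions and weak derivatives\<close>

text \<open>
  Continuous differentiability up to the boundary: all derivatives are taken within the set
  \<open>S\<close>. It is only used for sets in which these derivatives are unique, namely the real line and
  the closed half plane.
\<close>

primrec Ck_on :: "nat \<Rightarrow> 'a::real_normed_vector set \<Rightarrow> ('a \<Rightarrow> real) \<Rightarrow> bool" where
  "Ck_on 0 S f \<longleftrightarrow> continuous_on S f"
| "Ck_on (Suc k) S f \<longleftrightarrow>
     (\<exists>f'. (\<forall>x\<in>S. (f has_derivative f' x) (at x within S)) \<and> (\<forall>v. Ck_on k S (\<lambda>x. f' x v)))"

definition Cinf_on :: "'a::real_normed_vector set \<Rightarrow> ('a \<Rightarrow> real) \<Rightarrow> bool" where
  "Cinf_on S f \<longleftrightarrow> (\<forall>k. Ck_on k S f)"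

definition test_functions :: "'a::real_normed_vector set \<Rightarrow> ('a \<Rightarrow> real) set" where
  "test_functions S = {\<phi>. Cinf_on S \<phi> \<and> (\<exists>K. compact K \<and> K \<subseteq> S \<and> (\<forall>x\<in>S - K. \<phi> x = 0))}"

definition locally_integrable :: "(real \<Rightarrow> real) \<Rightarrow> bool" where
  "locally_integrable f \<longleftrightarrow> (\<forall>a b. set_integrable lebesgue {a..b} f)"

definition has_weak_deriv :: "(real \<Rightarrow> real) \<Rightarrow> (real \<Rightarrow> real) \<Rightarrow> bool" where
  "has_weak_deriv f g \<longleftrightarrow> locally_integrable f \<and> locally_integrable g \<and>
     (\<forall>\<phi>\<in>test_functions UNIV. (LINT x|lebesgue. f x * deriv \<phi> x) = - (LINT x|lebesgue. g x * \<phi> x))"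

text \<open>A representative of the weak derivative, which is unique up to null sets.\<close>

definition wderiv :: "(real \<Rightarrow> real) \<Rightarrow> real \<Rightarrow> real" where
  "wderiv f = (SOME g. has_weak_deriv f g)"


section \<open>Function spaces\<close>

text \<open>
  Elements of Lebesgue spaces are represented by Lebesgue measurable functions, without passing to
  the quotient by almost everywhere equality.
\<close>

definition Linf :: "(real \<Rightarrow> real) set" where
  "Linf = {f \<in> borel_measurable lebesgue. \<exists>C. AE x in lebesgue. \<bar>f x\<bar> \<le> C}"

definition L2 :: "(real \<Rightarrow> real) set" where
  "L2 = {f \<in> borel_measurable lebesgue. integrable lebesgue (\<lambda>x. (f x)\<^sup>2)}"

definition W1inf :: "(real \<Rightarrow> real) set" where
  "W1inf = {f \<in> Linf. \<exists>g\<in>Linf. has_weak_deriv f g}"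

text \<open>Elements of the next two spaces are their continuous representatives.\<close>

definition E2 :: "(real \<Rightarrow> real) set" where
  "E2 = {f \<in> Linf. continuous_on UNIV f \<and> (\<exists>g\<in>L2. has_weak_deriv f g)}"

definition E1 :: "(real \<Rightarrow> real) set" where
  "E1 = {f \<in> E2. (f \<longlongrightarrow> 0) at_bot}"

type_synonym lagrangian = "(real \<Rightarrow> real) \<times> (real \<Rightarrow> real) \<times> (real \<Rightarrow> real) \<times> (real \<Rightarrow> real)"

type_synonym eulerian = "(real \<Rightarrow> real) \<times> (real \<Rightarrow> real) \<times> real measure"

definition B_space :: "lagrangian set" where
  "B_space = E2 \<times> E2 \<times> E1 \<times> L2"


section \<open>Eulerian and Lagrangian coordinates\<close>

text \<open>
  \<open>\<nu>\<close> is the absolutely continuous part in the Lebesgue decomposition of \<open>\<mu>\<close>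
  with respect to Lebesgue measure.
\<close>

definition is_ac_part :: "real measure \<Rightarrow> real measure \<Rightarrow> bool" where
  "is_ac_part \<mu> \<nu> \<longleftrightarrow> sets \<nu> = sets borel \<and> absolutely_continuous lborel \<nu> \<and>
     (\<exists>\<sigma> N. sets \<sigma> = sets borel \<and> N \<in> null_sets lborel \<and> emeasure \<sigma> (- N) = 0 \<and>
        (\<forall>A\<in>sets borel. emeasure \<mu> A = emeasure \<nu> A + emeasure \<sigma> A))"

text \<open>
  The push-forward \<open>y\<^sub># (f d\<xi>)\<close> as a Borel measure, for a nonnegative density \<open>f\<close>. For the identity
  map it is \<open>f dx\<close> itself, restricted from the Lebesgue to the Borel sets.
\<close>

definition pushforward :: "(real \<Rightarrow> real) \<Rightarrow> (real \<Rightarrow> real) \<Rightarrow> real measure" where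
  "pushforward y f = distr (density lebesgue (\<lambda>\<xi>. ennreal (f \<xi>))) borel y"

text \<open>On the real line, every finite Borel measure is a Radon measure.\<close>

definition D_set :: "eulerian set" where
  "D_set = {(u, \<rho>, \<mu>). u \<in> E2 \<and> \<rho> \<in> L2 \<and> sets \<mu> = sets borel \<and> finite_measure \<mu> \<and>
     is_ac_part \<mu> (pushforward (\<lambda>x. x) (\<lambda>x. (wderiv u x)\<^sup>2 + (\<rho> x)\<^sup>2))}"

text \<open>
  The maps below are total functions in HOL; the intended domains are \<open>D_set\<close> for
  \<open>L_map\<close> (with values in \<open>F0_set\<close>) and \<open>F_set\<close> for \<open>S_map t\<close> and
  \<open>M_map\<close>.
\<close>

definition F_set :: "lagrangian set" where
  "F_set = {(y, U, H, r). (\<lambda>\<xi>. y \<xi> - \<xi>, U, H, r) \<in> B_space \<and>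
     (\<exists>c>0.
        (\<lambda>\<xi>. y \<xi> - \<xi>) \<in> W1inf \<and> U \<in> W1inf \<and> H \<in> W1inf \<and> r \<in> Linf \<and>
        (AE \<xi> in lebesgue. wderiv y \<xi> \<ge> 0 \<and> wderiv H \<xi> \<ge> 0 \<and> wderiv y \<xi> + wderiv H \<xi> \<ge> c) \<and>
        (AE \<xi> in lebesgue. wderiv y \<xi> * wderiv H \<xi> = (wderiv U \<xi>)\<^sup>2 + (r \<xi>)\<^sup>2))}"

definition F0_set :: "lagrangian set" where
  "F0_set = {(y, U, H, r) \<in> F_set. \<forall>\<xi>. y \<xi> + H \<xi> = \<xi>}"

definition L_map :: "eulerian \<Rightarrow> lagrangian" where
  "L_map = (\<lambda>(u, \<rho>, \<mu>).
     let y = (\<lambda>\<xi>. Sup {x. measure \<mu> {..<x} + x < \<xi>})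
     in (y, \<lambda>\<xi>. u (y \<xi>), \<lambda>\<xi>. \<xi> - y \<xi>, \<lambda>\<xi>. \<rho> (y \<xi>) * wderiv y \<xi>))"

text \<open>
  The identity \<open>\<rho> dx = y\<^sub># (r d\<xi>)\<close>. Here \<open>r d\<xi>\<close> is in general only a signed Radon
  measure, so the two sides are compared on bounded Borel sets.
\<close>

definition is_pushforward_density :: "(real \<Rightarrow> real) \<Rightarrow> (real \<Rightarrow> real) \<Rightarrow> (real \<Rightarrow> real) \<Rightarrow> bool" where
  "is_pushforward_density y r \<rho> \<longleftrightarrow> locally_integrable \<rho> \<and>
     (\<forall>A\<in>sets borel. bounded A \<longrightarrow> (LINT x:A|lebesgue. \<rho> x) = (LINT \<xi>:y -` A|lebesgue. r \<xi>))"

text \<open>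
  The description \<open>u(x) = U(\<xi>)\<close> for any \<open>\<xi>\<close> with \<open>y(\<xi>) = x\<close> becomes
  a definite choice of the common value; \<open>\<rho>\<close> is determined up to null sets, so a representative
  is chosen.
\<close>

definition M_map :: "lagrangian \<Rightarrow> eulerian" where
  "M_map = (\<lambda>(y, U, H, r).
     (\<lambda>x. THE v. \<forall>\<xi>. y \<xi> = x \<longrightarrow> U \<xi> = v,
      SOME \<rho>. is_pushforward_density y r \<rho>,
      pushforward y (wderiv H)))"

definition S_map :: "real \<Rightarrow> lagrangian \<Rightarrow> lagrangian" where
  "S_map t = (\<lambda>(y, U, H, r).
     let Hinf = Lim at_top H
     in (\<lambda>\<xi>. 1/4 * (H \<xi> - 1/2 * Hinf) * t\<^sup>2 + U \<xi> * t + y \<xi>,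
         \<lambda>\<xi>. 1/2 * (H \<xi> - 1/2 * Hinf) * t + U \<xi>,
         H,
         r))"

definition T_map :: "real \<Rightarrow> eulerian \<Rightarrow> eulerian" where
  "T_map t = M_map \<circ> S_map t \<circ> L_map"


section \<open>Conservative weak solutions\<close>

definition dx :: "(real \<times> real \<Rightarrow> real) \<Rightarrow> real \<Rightarrow> real \<Rightarrow> real" where
  "dx \<phi> x t = deriv (\<lambda>z. \<phi> (z, t)) x"

text \<open>The time derivative is one-sided at \<open>t = 0\<close>.\<close>

definition dt :: "(real \<times> real \<Rightarrow> real) \<Rightarrow> real \<Rightarrow> real \<Rightarrow> real" where
  "dt \<phi> x t = vector_derivative (\<lambda>s. \<phi> (x, s)) (at t within {0..})"

text \<open>
  \<open>\<integral>\<^sub>0\<^sup>\<infinity> \<integral> f(t,x) d\<nu>(t) dt = I\<close>, including the existence of the inner integrals and of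
  the outer one (the Bochner integral of a non-integrable function is 0).
\<close>

definition has_iterated_integral ::
    "(real \<Rightarrow> real measure) \<Rightarrow> (real \<Rightarrow> real \<Rightarrow> real) \<Rightarrow> real \<Rightarrow> bool" where
  "has_iterated_integral \<nu> f I \<longleftrightarrow>
     (\<forall>t\<ge>0. integrable (\<nu> t) (f t)) \<and>
     set_integrable lebesgue {0..} (\<lambda>t. LINT x|\<nu> t. f t x) \<and>
     (LINT t:{0..}|lebesgue. (LINT x|\<nu> t. f t x)) = I"

definition conservative_weak_solution ::
    "(real \<Rightarrow> real \<Rightarrow> real) \<Rightarrow> (real \<Rightarrow> real \<Rightarrow> real) \<Rightarrow> (real \<Rightarrow> real measure) \<Rightarrow>
     (real \<Rightarrow> real) \<Rightarrow> (real \<Rightarrow> real) \<Rightarrow> real measure \<Rightarrow> bool" where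
  "conservative_weak_solution u \<rho> \<mu> u0 \<rho>0 \<mu>0 \<longleftrightarrow>
     (\<forall>t\<ge>0. (u t, \<rho> t, \<mu> t) \<in> D_set) \<and>
     (\<forall>\<phi>\<in>test_functions (UNIV \<times> {0..}).
        has_iterated_integral (\<lambda>t. lebesgue)
          (\<lambda>t x. u t x * dt \<phi> x t + 1/2 * (u t x)\<^sup>2 * dx \<phi> x t
                  + 1/4 * (measure (\<mu> t) {..<x} - measure (\<mu> t) {x<..}) * \<phi> (x, t))
          (- (LINT x|lebesgue. u0 x * \<phi> (x, 0))) \<and>
        has_iterated_integral (\<lambda>t. lebesgue)
          (\<lambda>t x. \<rho> t x * dt \<phi> x t + \<rho> t x * u t x * dx \<phi> x t)
          (- (LINT x|lebesgue. \<rho>0 x * \<phi> (x, 0))) \<and>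
        has_iterated_integral \<mu>
          (\<lambda>t x. dt \<phi> x t + u t x * dx \<phi> x t)
          (- (LINT x|\<mu>0. \<phi> (x, 0))))"

end

theory Submission
  imports Defs "HOL-Probability.Distribution_Functions"
begin

text \<open>
  Let \<open>p, q, h\<close> be the derivatives of \<open>y, U, H\<close>. The conditions \<open>p, h \<ge> 0\<close> and
  \<open>p h = q\<^sup>2 + r\<^sup>2\<close> are preserved by the flow, under which \<open>p\<close> becomes
  \<open>p + t q + t\<^sup>2 h / 4\<close> and \<open>q\<close> becomes \<open>q + t h / 2\<close>.
  The map \<open>y\<close> transports \<open>p d\<xi>\<close> to \<open>dx\<close> and is injective almost everywhere on
  \<open>p > 0\<close>. Hence \<open>u\<^sub>x\<close> and \<open>\<rho>\<close> are \<open>q / p\<close> and \<open>r / p\<close> at the preimage,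
  the part of \<open>h d\<xi>\<close> on \<open>p > 0\<close> is pushed to \<open>(u\<^sub>x\<^sup>2 + \<rho>\<^sup>2) dx\<close>, and the
  part on \<open>p = 0\<close> to a singular measure.
  For the initial data, \<open>y\<close> transports \<open>d\<xi>\<close> to \<open>\<mu> + dx\<close>, so that
  \<open>p = 1 / (1 + u\<^sub>x\<^sup>2 + \<rho>\<^sup>2) \<circ> y\<close> off the preimage of a null set carrying the singular part
  of \<open>\<mu>\<close>, and \<open>p = 0\<close> on it.

  Changing variables \<open>x = y(t, \<xi>)\<close> in the weak equations turns the integrands into the time
  derivatives of \<open>h \<phi>(y, t)\<close>, \<open>r \<phi>(y, t)\<close> and \<open>p U \<phi>(y, t)\<close>, the last one up to
  the \<open>\<xi>\<close>-derivative of \<open>U\<^sup>2 \<phi>(y, t) / 2\<close>; Fubini's theorem then gives the claim.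
\<close>

section \<open>Indefinite Lebesgue integrals\<close>

text \<open>The obstacle is that \<open>y\<close> may flatten a set of positive measure to a null
  set, so composition with \<open>y\<close> does not respect equality almost everywhere. Lebesgue
  integrals of Eulerian expressions acquire the weight \<open>p\<close> under the change of
  variables, and this weight is exactly what repairs the defect: statements transported by
  \<open>y\<close> have the form "\<open>p \<xi> = 0\<close> or ...". For this to suffice, the
  derivatives are replaced by Borel representatives that satisfy the sign conditions and the energy
  relation at every point. Then \<open>p \<xi> = 0\<close> forces \<open>q \<xi> = 0\<close> and
  \<open>s \<xi> = 0\<close>, so nothing signed is lost where \<open>y\<close> is flat; only
  \<open>h\<close> may survive there, as singular energy. The same device handles the nonlocal term:
  the masses of the half lines to the left and right of \<open>y \<xi>\<close> are
  \<open>H \<xi>\<close> and \<open>m - H \<xi>\<close> only up to possible atoms, and atoms are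
  invisible under the weight \<open>p\<close>. It also makes \<open>\<rho>0 \<circ> y\<close>
  harmless, although \<open>\<rho>0\<close> is merely Lebesgue measurable.\<close>

lemma measure_eqI_Ioc:
  fixes M N :: "real measure"
  assumes sM: "sets M = sets borel" and sN: "sets N = sets borel"
    and fin: "\<And>a b. a \<le> b \<Longrightarrow> emeasure M {a<..b} \<noteq> \<infinity>"
    and eq: "\<And>a b. a \<le> b \<Longrightarrow> emeasure M {a<..b} = emeasure N {a<..b}"
  shows "M = N"
proof -
  have U: "(\<Union>n. {- real n<..real n}) = UNIV"
  proof -
    have "\<exists>n. - real n < x \<and> x \<le> real n" for x :: real
    proof -
      obtain n where "\<bar>x\<bar> < real n" using reals_Archimedean2 by blast
      then show ?thesis by (intro exI[of _ n]) linarith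
    qed
    then show ?thesis by auto
  qed
  have e: "emeasure M X = emeasure N X" if "X \<in> range (\<lambda>(a, b). {a<..b})" for X
  proof -
    from that obtain ab where "X = (case ab of (a, b) \<Rightarrow> {a<..b})" by (rule imageE)
    then obtain a b where X: "X = {a<..b}" by (cases ab) simp
    show ?thesis
    proof (cases "a \<le> b")
      case True
      then show ?thesis using eq X by auto
    next
      case False
      then show ?thesis by (simp add: X)
    qed
  qed
  show ?thesis
  proof (rule measure_eqI_generator_eq[where \<Omega> = UNIV
      and E = "range (\<lambda>(a, b). {a<..b})" and A = "\<lambda>n::nat. {- real n<..real n}"])
    show "Int_stable (range (\<lambda>(a, b). {a<..b::real}))"
      by (auto simp: Int_stable_def Int_greaterThanAtMost)
    show "sets M = sigma_sets UNIV (range (\<lambda>(a, b). {a<..b}))"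
      unfolding sM by (subst borel_sigma_sets_Ioc) auto
    show "sets N = sigma_sets UNIV (range (\<lambda>(a, b). {a<..b}))"
      unfolding sN by (subst borel_sigma_sets_Ioc) auto
  qed (use U fin e in auto)
qed

text \<open>The positive and negative parts of \<open>w\<close> are densities of two measures that
  agree on half-open intervals and hence coincide. So the two parts agree almost everywhere, and as
  they are never both nonzero, they vanish.\<close>

lemma AE_zero_if_Icc_integrals_zero:
  fixes w :: "real \<Rightarrow> real"
  assumes [measurable]: "w \<in> borel_measurable borel"
    and int: "\<And>a b. set_integrable lborel {a..b} w"
    and zero: "\<And>a b. a \<le> b \<Longrightarrow> (LINT x:{a..b}|lborel. w x) = 0"
  shows "AE x in lborel. w x = 0"
proof -
  have part: "\<exists>c. (\<integral>\<^sup>+x. ennreal (w x) * indicator {a<..b} x \<partial>lborel) = ennreal c \<and>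
     (\<integral>\<^sup>+x. ennreal (- w x) * indicator {a<..b} x \<partial>lborel) = ennreal c" if "a \<le> b" for a b
  proof -
    let ?v = "\<lambda>x. indicator {a..b} x *\<^sub>R w x"
    have vi: "integrable lborel ?v" using int[of a b] unfolding set_integrable_def .
    obtain r q where rq: "(\<integral>\<^sup>+x. ennreal (?v x) \<partial>lborel) = ennreal r"
      "(\<integral>\<^sup>+x. ennreal (- ?v x) \<partial>lborel) = ennreal q" "integral\<^sup>L lborel ?v = r - q"
      by (rule integrableE[OF vi])
    have "r = q" using zero[OF that] rq(3) unfolding set_lebesgue_integral_def by simp
    moreover have "(\<integral>\<^sup>+x. ennreal (w x) * indicator {a<..b} x \<partial>lborel) = (\<integral>\<^sup>+x. ennreal (?v x) \<partial>lborel)"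
      by (rule nn_integral_cong_AE, use AE_lborel_singleton[of a] in eventually_elim)
        (auto split: split_indicator)
    moreover have "(\<integral>\<^sup>+x. ennreal (- w x) * indicator {a<..b} x \<partial>lborel) = (\<integral>\<^sup>+x. ennreal (- ?v x) \<partial>lborel)"
      by (rule nn_integral_cong_AE, use AE_lborel_singleton[of a] in eventually_elim)
        (auto split: split_indicator)
    ultimately show ?thesis using rq by auto
  qed
  \<comment> \<open>\<open>ennreal\<close> sends negative reals to 0, so these densities are the
    positive and the negative part of \<open>w\<close>.\<close>
  have "density lborel (\<lambda>x. ennreal (w x)) = density lborel (\<lambda>x. ennreal (- w x))"
  proof (rule measure_eqI_Ioc)
    fix a b :: real assume "a \<le> b"
    from part[OF this] obtain c where c:
      "(\<integral>\<^sup>+x. ennreal (w x) * indicator {a<..b} x \<partial>lborel) = ennreal c"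
      "(\<integral>\<^sup>+x. ennreal (- w x) * indicator {a<..b} x \<partial>lborel) = ennreal c" by auto
    show "emeasure (density lborel (\<lambda>x. ennreal (w x))) {a<..b} \<noteq> \<infinity>"
      using c by (simp add: emeasure_density)
    show "emeasure (density lborel (\<lambda>x. ennreal (w x))) {a<..b} =
        emeasure (density lborel (\<lambda>x. ennreal (- w x))) {a<..b}"
      using c by (simp add: emeasure_density)
  qed auto
  then have "AE x in lborel. ennreal (w x) = ennreal (- w x)"
    by (subst (asm) sigma_finite_measure.density_unique_iff[OF sigma_finite_lborel]) auto
  then show ?thesis
  proof eventually_elim
    fix x assume *: "ennreal (w x) = ennreal (- w x)"
    show "w x = 0"
    proof (cases "w x \<ge> 0")
      case True
      then have "ennreal (w x) = 0" using * by (simp add: ennreal_neg)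
      then show ?thesis using True by simp
    next
      case False
      then have "ennreal (- w x) = 0" using * by (simp add: ennreal_neg)
      then show ?thesis using False by simp
    qed
  qed
qed

text \<open>\<open>f\<close> is locally absolutely continuous with the Borel representative \<open>g\<close> of its derivative.\<close>

definition ac_deriv :: "(real \<Rightarrow> real) \<Rightarrow> (real \<Rightarrow> real) \<Rightarrow> bool" where
  "ac_deriv f g \<longleftrightarrow> g \<in> borel_measurable borel \<and> (\<forall>a b. set_integrable lborel {a..b} g) \<and>
     (\<forall>a b. a \<le> b \<longrightarrow> f b - f a = (LINT x:{a..b}|lborel. g x))"

lemma ac_derivD:
  assumes "ac_deriv f g"
  shows "g \<in> borel_measurable borel" "set_integrable lborel {a..b} g"
    "a \<le> b \<Longrightarrow> (LINT x:{a..b}|lborel. g x) = f b - f a"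
  using assms unfolding ac_deriv_def by auto

lemma ac_deriv_continuous:
  assumes "ac_deriv f g"
  shows "continuous_on UNIV f"
proof -
  have "isCont f x" for x
  proof -
    have i: "g integrable_on {x-1..x+1}"
      using ac_derivD(2)[OF assms] set_borel_integral_eq_integral(1) by blast
    have "f z = f (x-1) + integral {x-1..z} g" if "z \<in> {x-1..x+1}" for z
      using ac_derivD(3)[OF assms, of "x-1" z]
        set_borel_integral_eq_integral(2)[OF ac_derivD(2)[OF assms, of "x-1" z]] that by auto
    moreover have "continuous_on {x-1..x+1} (\<lambda>z. f (x-1) + integral {x-1..z} g)"
      by (intro continuous_intros indefinite_integral_continuous_1 i)
    ultimately have "continuous_on {x-1..x+1} f"
      by (metis (no_types, lifting) continuous_on_cong)
    then have "continuous_on {x-1<..<x+1} f"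
      by (rule continuous_on_subset) auto
    then show ?thesis
      by (simp add: continuous_on_eq_continuous_at)
  qed
  then show ?thesis by (simp add: continuous_at_imp_continuous_on)
qed

lemma ac_deriv_measurable:
  assumes "ac_deriv f g"
  shows "f \<in> borel_measurable borel"
  using ac_deriv_continuous[OF assms] by (rule borel_measurable_continuous_onI)

lemma ac_deriv_add:
  assumes "ac_deriv f g" "ac_deriv F G"
  shows "ac_deriv (\<lambda>x. f x + F x) (\<lambda>x. g x + G x)"
  using assms unfolding ac_deriv_def by (auto simp: set_integral_add algebra_simps)

lemma ac_deriv_cmult:
  assumes "ac_deriv f g"
  shows "ac_deriv (\<lambda>x. c * f x) (\<lambda>x. c * g x)"
  using assms unfolding ac_deriv_def
  by (auto simp: right_diff_distrib[symmetric])

lemma ac_deriv_const: "ac_deriv (\<lambda>x. c) (\<lambda>x. 0)"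
  unfolding ac_deriv_def by (auto simp: set_integrable_def set_lebesgue_integral_def)

lemma ac_deriv_C1:
  assumes "\<And>x. (f has_real_derivative g x) (at x)" "continuous_on UNIV g"
  shows "ac_deriv f g"
proof -
  have c: "continuous_on {a..b} g" for a b using assms(2) continuous_on_subset by blast
  have i: "set_integrable lborel {a..b} g" for a b
    unfolding set_integrable_def using borel_integrable_atLeastAtMost'[OF c] 
    by (simp add: set_integrable_def)
  have "(LINT x:{a..b}|lborel. g x) = f b - f a" if "a \<le> b" for a b
  proof -
    have "(g has_integral (f b - f a)) {a..b}"
      using that assms(1) by (intro fundamental_theorem_of_calculus)
        (auto simp: has_real_derivative_iff_has_vector_derivative intro: has_vector_derivative_at_within)
    then show ?thesis using set_borel_integral_eq_integral(2)[OF i] by (metis integral_unique)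
  qed
  then show ?thesis using i borel_measurable_continuous_onI[OF assms(2)] unfolding ac_deriv_def by auto
qed

lemma set_integrable_continuous_mult:
  fixes f g :: "real \<Rightarrow> real"
  assumes "set_integrable lborel {a..b} g" "continuous_on UNIV f"
  shows "set_integrable lborel {a..b} (\<lambda>x. f x * g x)"
proof -
  have [measurable]: "f \<in> borel_measurable borel"
    by (rule borel_measurable_continuous_onI) fact
  have "bounded (f ` {a..b})"
    using assms(2) by (intro compact_imp_bounded compact_continuous_image) (auto intro: continuous_on_subset)
  then obtain C where C: "\<And>x. x \<in> {a..b} \<Longrightarrow> \<bar>f x\<bar> \<le> C"
    unfolding bounded_iff real_norm_def by blast
  have gi: "integrable lborel (\<lambda>x. indicator {a..b} x *\<^sub>R g x)"
    using assms(1) unfolding set_integrable_def .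
  then have "integrable lborel (\<lambda>x. C * (indicator {a..b} x *\<^sub>R g x))" by (rule integrable_mult_right)
  then show ?thesis unfolding set_integrable_def
  proof (rule Bochner_Integration.integrable_bound)
    have "(\<lambda>x. f x * (indicator {a..b} x *\<^sub>R g x)) \<in> borel_measurable lborel"
      using gi by (intro borel_measurable_times) auto
    then show "(\<lambda>x. indicator {a..b} x *\<^sub>R (f x * g x)) \<in> borel_measurable lborel"
      by (simp add: algebra_simps)
    show "AE x in lborel. norm (indicator {a..b} x *\<^sub>R (f x * g x)) \<le> norm (C * (indicator {a..b} x *\<^sub>R g x))"
    proof (rule AE_I2)
      fix x
      show "norm (indicator {a..b} x *\<^sub>R (f x * g x)) \<le> norm (C * (indicator {a..b} x *\<^sub>R g x))"
      proof (cases "x \<in> {a..b}")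
        case True
        have "\<bar>f x\<bar> \<le> \<bar>C\<bar>" using C[OF True] by linarith
        then show ?thesis using True by (simp add: abs_mult mult_right_mono)
      qed auto
    qed
  qed
qed

text \<open>Integration by parts without pointwise derivatives: Fubini is applied to
  \<open>G x * g z\<close> on the triangle \<open>a \<le> z \<le> x \<le> b\<close>. Integrating
  over \<open>z\<close> first gives \<open>G x * (f x - f a)\<close>, integrating over
  \<open>x\<close> first gives \<open>g z * (F b - F z)\<close>.\<close>

lemma ac_deriv_mult:
  assumes fg: "ac_deriv f g" and FG: "ac_deriv F G"
  shows "ac_deriv (\<lambda>x. f x * F x) (\<lambda>x. g x * F x + f x * G x)"
proof -
  note [measurable] = ac_derivD(1)[OF fg] ac_derivD(1)[OF FG] ac_deriv_measurable[OF fg] ac_deriv_measurable[OF FG]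
  have i1: "set_integrable lborel {a..b} (\<lambda>x. F x * g x)" for a b
    by (intro set_integrable_continuous_mult ac_derivD(2)[OF fg] ac_deriv_continuous[OF FG])
  have i2: "set_integrable lborel {a..b} (\<lambda>x. f x * G x)" for a b
    by (intro set_integrable_continuous_mult ac_derivD(2)[OF FG] ac_deriv_continuous[OF fg])
  have main: "f b * F b - f a * F a = (LINT x:{a..b}|lborel. F x * g x + f x * G x)" if ab: "a \<le> b" for a b
  proof -
    define k where "k = (\<lambda>x. indicator {a..b} x * g x)"
    define K where "K = (\<lambda>x. indicator {a..b} x * G x)"
    have [measurable]: "k \<in> borel_measurable borel" "K \<in> borel_measurable borel"
      unfolding k_def K_def by measurable
    have ki: "integrable lborel k" and Ki: "integrable lborel K"
      using ac_derivD(2)[OF fg, of a b] ac_derivD(2)[OF FG, of a b]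
      unfolding k_def K_def set_integrable_def by auto
    have kI: "integral\<^sup>L lborel k = f b - f a" and KI: "integral\<^sup>L lborel K = F b - F a"
      using ac_derivD(3)[OF fg ab] ac_derivD(3)[OF FG ab]
      unfolding k_def K_def set_lebesgue_integral_def by auto
    have FX: "(LINT z|lborel. K z * indicator {..x} z) = F x - F a" if "x \<in> {a..b}" for x
    proof -
      have "(\<lambda>z. K z * indicator {..x} z) = (\<lambda>z. indicator {a..x} z *\<^sub>R G z)"
        unfolding K_def using that by (auto split: split_indicator)
      then show ?thesis using ac_derivD(3)[OF FG, of a x] that
        unfolding set_lebesgue_integral_def by simp
    qed
    have fX: "(LINT z|lborel. k z * indicator {..x} z) = f x - f a" if "x \<in> {a..b}" for x
    proof -
      have "(\<lambda>z. k z * indicator {..x} z) = (\<lambda>z. indicator {a..x} z *\<^sub>R g z)"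
        unfolding k_def using that by (auto split: split_indicator)
      then show ?thesis using ac_derivD(3)[OF fg, of a x] that
        unfolding set_lebesgue_integral_def by simp
    qed
    have pair: "integrable (lborel \<Otimes>\<^sub>M lborel) (\<lambda>(x, z). K x * (k z * indicator {..x} z))"
    proof (rule lborel_pair.Fubini_integrable)
      show "(\<lambda>(x, z). K x * (k z * indicator {..x} z)) \<in> borel_measurable (lborel \<Otimes>\<^sub>M lborel)"
        unfolding indicator_def atMost_iff by measurable
      show "AE x in lborel. integrable lborel (\<lambda>z. case (x, z) of (x, z) \<Rightarrow> K x * (k z * indicator {..x} z))"
        by (intro AE_I2) (auto intro!: integrable_mult_right integrable_real_mult_indicator ki)
      have "integrable lborel (\<lambda>x. (LINT z|lborel. norm (k z)) * norm (K x))"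
        using Ki by (intro integrable_mult_right) auto
      then show "integrable lborel (\<lambda>x. LINT z|lborel. norm (case (x, z) of (x, z) \<Rightarrow> K x * (k z * indicator {..x} z)))"
      proof (rule Bochner_Integration.integrable_bound)
        show "(\<lambda>x. LINT z|lborel. norm (case (x, z) of (x, z) \<Rightarrow> K x * (k z * indicator {..x} z))) \<in> borel_measurable lborel"
          unfolding indicator_def atMost_iff by measurable
        show "AE x in lborel. norm (LINT z|lborel. norm (case (x, z) of (x, z) \<Rightarrow> K x * (k z * indicator {..x} z)))
           \<le> norm ((LINT z|lborel. norm (k z)) * norm (K x))"
        proof (rule AE_I2)
          fix x
          have "(LINT z|lborel. norm (K x * (k z * indicator {..x} z))) \<le> (LINT z|lborel. norm (K x) * norm (k z))"
            using ki by (intro integral_mono)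
              (auto intro!: integrable_mult_right integrable_real_mult_indicator integrable_norm simp: abs_mult split: split_indicator)
          then show "norm (LINT z|lborel. norm (case (x, z) of (x, z) \<Rightarrow> K x * (k z * indicator {..x} z)))
             \<le> norm ((LINT z|lborel. norm (k z)) * norm (K x))"
            by (simp add: mult.commute)
        qed
      qed
    qed
    have s1: "(LINT x|lborel. K x * (f x - f a)) = (LINT x|lborel. LINT z|lborel. K x * (k z * indicator {..x} z))"
      by (intro Bochner_Integration.integral_cong refl) (use fX in \<open>auto simp: K_def split: split_indicator\<close>)
    have s2: "(LINT x|lborel. LINT z|lborel. K x * (k z * indicator {..x} z)) =
        (LINT z|lborel. LINT x|lborel. K x * (k z * indicator {..x} z))"
      using lborel_pair.Fubini_integral[OF pair] by simp
    have s3: "(LINT x|lborel. K x * (k z * indicator {..x} z)) = k z * (F b - F z)" for z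
    proof (cases "z \<in> {a..b}")
      case True
      \<comment> \<open>The conditions \<open>z \<le> x\<close> and \<open>z < x\<close> differ only
        at the point \<open>x = z\<close>, which is null.\<close>
      have "(LINT x|lborel. K x * (k z * indicator {..x} z)) = (LINT x|lborel. k z * (K x - K x * indicator {..z} x))"
      proof (rule integral_cong_AE)
        show "AE x in lborel. K x * (k z * indicator {..x} z) = k z * (K x - K x * indicator {..z} x)"
          using AE_lborel_singleton[of z] by eventually_elim (auto split: split_indicator)
      qed (unfold indicator_def atMost_iff, measurable)
      also have "\<dots> = k z * ((F b - F a) - (F z - F a))"
        using FX[OF True] KI Ki by (simp add: Bochner_Integration.integral_diff integrable_real_mult_indicator)
      finally show ?thesis by simp
    next
      case False
      then show ?thesis by (simp add: k_def)
    qed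
    have e: "(LINT x|lborel. K x * (f x - f a)) = (LINT z|lborel. k z * (F b - F z))"
      using s1 s2 s3 by simp
    have j1: "integrable lborel (\<lambda>x. K x * f x)" "integrable lborel (\<lambda>x. k x * F x)"
      using i1[of a b] i2[of a b] unfolding k_def K_def set_integrable_def by (auto simp: mult_ac)
    have "(LINT x|lborel. K x * f x) - f a * (F b - F a) = (f b - f a) * F b - (LINT x|lborel. k x * F x)"
      proof -
      have "(LINT x|lborel. K x * (f x - f a)) = (LINT x|lborel. K x * f x) - (F b - F a) * f a"
        using j1 Ki KI by (simp add: right_diff_distrib)
      moreover have "(LINT x|lborel. k x * (F b - F x)) = (f b - f a) * F b - (LINT x|lborel. k x * F x)"
        using j1 ki kI by (simp add: right_diff_distrib)
      ultimately show ?thesis using e by (simp add: mult.commute)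
    qed
    moreover have "(LINT x:{a..b}|lborel. F x * g x + f x * G x) = (LINT x|lborel. k x * F x) + (LINT x|lborel. K x * f x)"
      using j1 unfolding set_lebesgue_integral_def k_def K_def by (subst Bochner_Integration.integral_add[symmetric])
        (auto simp: algebra_simps)
    ultimately show ?thesis by (simp add: algebra_simps)
  qed
  have "set_integrable lborel {a..b} (\<lambda>x. F x * g x + f x * G x)" for a b
    using i1 i2 by (rule set_integral_add)
  then show ?thesis using main unfolding ac_deriv_def by (simp add: mult.commute)
qed

section \<open>Smooth bump functions\<close>

lemma Ck_on_SucD: "Ck_on (Suc k) S f \<Longrightarrow> Ck_on k S f"
proof (induction k arbitrary: f)
  case 0
  then show ?case
    by (auto simp: continuous_on_eq_continuous_within intro: has_derivative_continuous)
next
  case (Suc k)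
  then show ?case by (metis Ck_on.simps(2))
qed

lemma Ck_on_const: "Ck_on k S (\<lambda>x. c)"
proof (induction k arbitrary: c)
  case (Suc k)
  then show ?case by (auto intro!: exI[of _ "\<lambda>x v. 0"])
qed auto

lemma Ck_on_add: "Ck_on k S f \<Longrightarrow> Ck_on k S g \<Longrightarrow> Ck_on k S (\<lambda>x. f x + g x)"
proof (induction k arbitrary: f g)
  case 0
  then show ?case by (auto intro: continuous_intros)
next
  case (Suc k)
  then obtain f' g' where
    "\<forall>x\<in>S. (f has_derivative f' x) (at x within S)" "\<forall>v. Ck_on k S (\<lambda>x. f' x v)"
    "\<forall>x\<in>S. (g has_derivative g' x) (at x within S)" "\<forall>v. Ck_on k S (\<lambda>x. g' x v)" by auto
  then show ?case using Suc.IH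
    by (auto intro!: exI[of _ "\<lambda>x v. f' x v + g' x v"] has_derivative_add)
qed

lemma Ck_on_mult: "Ck_on k S f \<Longrightarrow> Ck_on k S g \<Longrightarrow> Ck_on k S (\<lambda>x. f x * g x)"
proof (induction k arbitrary: f g)
  case 0
  then show ?case by (auto intro: continuous_intros)
next
  case (Suc k)
  then obtain f' g' where d:
    "\<forall>x\<in>S. (f has_derivative f' x) (at x within S)" "\<forall>v. Ck_on k S (\<lambda>x. f' x v)"
    "\<forall>x\<in>S. (g has_derivative g' x) (at x within S)" "\<forall>v. Ck_on k S (\<lambda>x. g' x v)" by auto
  have "Ck_on k S (\<lambda>x. f x * g' x v + f' x v * g x)" for v
    by (intro Ck_on_add Suc.IH Ck_on_SucD[OF Suc.prems(1)] Ck_on_SucD[OF Suc.prems(2)] d(2)[rule_format] d(4)[rule_format])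
  moreover have "\<forall>x\<in>S. ((\<lambda>x. f x * g x) has_derivative (\<lambda>v. f x * g' x v + f' x v * g x)) (at x within S)"
    using d by (auto intro!: has_derivative_mult)
  ultimately show ?case
    by (auto intro!: exI[of _ "\<lambda>x v. f x * g' x v + f' x v * g x"])
qed

lemma Ck_on_Suc_real:
  fixes f :: "real \<Rightarrow> real"
  assumes "\<And>x. (f has_real_derivative f' x) (at x)" "Ck_on k UNIV f'"
  shows "Ck_on (Suc k) UNIV f"
proof -
  have "Ck_on k UNIV (\<lambda>x. f' x * v)" for v
    by (rule Ck_on_mult[OF assms(2) Ck_on_const])
  moreover have "(f has_derivative (\<lambda>v. f' x * v)) (at x)" for x
    using assms(1)[of x] by (simp add: has_field_derivative_def)
  ultimately show ?thesis
    by (auto intro!: exI[of _ "\<lambda>x v. f' x * v"])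
qed

lemma Ck_on_affine:
  fixes f :: "real \<Rightarrow> real"
  shows "Ck_on k UNIV f \<Longrightarrow> Ck_on k UNIV (\<lambda>x. f (c * x + d))"
proof (induction k arbitrary: f)
  case 0
  then have "continuous_on UNIV f" by simp
  then have "continuous_on UNIV (\<lambda>x. f (c * x + d))"
    by (rule continuous_on_compose2) (auto intro: continuous_intros)
  then show ?case by simp
next
  case (Suc k)
  then obtain f' where d:
    "\<And>x. (f has_derivative f' x) (at x)" "\<And>v. Ck_on k UNIV (\<lambda>x. f' x v)" by auto
  have "((\<lambda>x. f (c * x + d)) has_derivative (\<lambda>v. f' (c * x + d) (c * v))) (at x)" for x
    by (rule has_derivative_compose[of "\<lambda>x. c * x + d" "\<lambda>v. c * v" x UNIV f])
      (auto intro!: derivative_eq_intros d(1))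
  then show ?case using Suc.IH[OF d(2)]
    by (auto intro!: exI[of _ "\<lambda>x v. f' (c * x + d) (c * v)"])
qed

text \<open>The polynomial makes the family closed under differentiation, so that smoothness becomes
  an induction over the order; \<open>flat 1\<close> is the classical function
  \<open>exp (-1/x)\<close>, flat at 0.\<close>

definition flat :: "real poly \<Rightarrow> real \<Rightarrow> real" where
  "flat P x = (if x > 0 then poly P (1/x) * exp (-1/x) else 0)"

lemma poly_exp_tendsto_0: "((\<lambda>s. poly P s * exp (- s)) \<longlongrightarrow> (0::real)) at_top"
proof -
  have "((\<lambda>s. \<Sum>i\<le>degree P. coeff P i * (s ^ i / exp s)) \<longlongrightarrow> (\<Sum>i\<le>degree P. coeff P i * 0)) at_top"
    by (intro tendsto_intros tendsto_power_div_exp_0)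
  moreover have "(\<Sum>i\<le>degree P. coeff P i * (s ^ i / exp s)) = poly P s * exp (- s)" for s
    by (simp add: poly_altdef exp_minus field_simps sum_divide_distrib sum_distrib_left)
  ultimately show ?thesis by simp
qed

text \<open>With \<open>s = 1/x\<close> one has \<open>d/dx = - s^2 d/ds\<close>, and
  differentiating \<open>P(s) exp(-s)\<close> gives the polynomial \<open>s^2 (P - P')\<close>; the
  coefficient list \<open>[:0,0,1:]\<close> is \<open>s^2\<close>.\<close>

lemma flat_has_derivative:
  "(flat P has_real_derivative flat ([:0,0,1:] * (P - pderiv P)) x) (at x)"
proof -
  consider "x > 0" | "x < 0" | "x = 0" by linarith
  then show ?thesis
  proof cases
    case 1
    have "((\<lambda>x. poly P (1/x) * exp (-1/x)) has_real_derivative flat ([:0,0,1:] * (P - pderiv P)) x) (at x)"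
      using 1 by (auto simp: flat_def field_simps power2_eq_square intro!: derivative_eq_intros)
    then show ?thesis
      by (rule has_field_derivative_transform_within_open[where S = "{0<..}"]) (use 1 in \<open>auto simp: flat_def\<close>)
  next
    case 2
    have "((\<lambda>x. 0) has_real_derivative flat ([:0,0,1:] * (P - pderiv P)) x) (at x)"
      using 2 by (auto simp: flat_def)
    then show ?thesis
      by (rule has_field_derivative_transform_within_open[where S = "{..<0}"]) (use 2 in \<open>auto simp: flat_def\<close>)
  next
    case 3
    have "((\<lambda>h. (flat P (0 + h) - flat P 0) / h) \<longlongrightarrow> 0) (at 0)"
      proof (rule filterlim_split_at)
      show "((\<lambda>h. (flat P (0 + h) - flat P 0) / h) \<longlongrightarrow> 0) (at_left 0)"
        by (rule tendsto_eventually) (auto simp: flat_def eventually_at_filter)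
      \<comment> \<open>The difference quotient at 0 contributes one more factor \<open>1/h\<close>,
        absorbed into the polynomial as \<open>[:0,1:]\<close>.\<close>
      have "((\<lambda>h. poly ([:0,1:] * P) (inverse h) * exp (- inverse h)) \<longlongrightarrow> 0) (at_right (0::real))"
        by (rule filterlim_compose[OF poly_exp_tendsto_0 filterlim_inverse_at_top_right])
      then show "((\<lambda>h. (flat P (0 + h) - flat P 0) / h) \<longlongrightarrow> 0) (at_right 0)"
        by (rule Lim_transform_eventually)
          (auto simp: eventually_at_filter flat_def field_simps)
    qed
    then show ?thesis using 3 by (simp add: DERIV_def flat_def)
  qed
qed

lemma Ck_on_flat: "Ck_on k UNIV (flat P)"
proof (induction k arbitrary: P)
  case 0
  show ?case using flat_has_derivative[of P] DERIV_isCont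
    by (auto simp: continuous_on_eq_continuous_at)
next
  case (Suc k)
  show ?case by (rule Ck_on_Suc_real[OF flat_has_derivative Suc])
qed

text \<open>The scale \<open>n\<close> pushes both exponential factors to 1 inside the interval, so
  the bumps tend to the indicator of \<open>{a<..<b}\<close> while staying between 0 and 1. That
  bounded convergence is all that is needed later.\<close>

definition bump :: "real \<Rightarrow> real \<Rightarrow> real \<Rightarrow> real \<Rightarrow> real" where
  "bump n a b x = flat 1 (n * (x - a)) * flat 1 (n * (b - x))"

lemma Ck_on_bump: "Ck_on k UNIV (bump n a b)"
proof -
  have "Ck_on k UNIV (\<lambda>x. flat 1 (n * x + (- n * a)) * flat 1 ((- n) * x + n * b))"
    by (intro Ck_on_mult Ck_on_affine Ck_on_flat)
  then show ?thesis by (simp add: bump_def[abs_def] algebra_simps)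
qed

lemma bump_bounds: "0 \<le> bump n a b x" "bump n a b x \<le> 1"
  by (auto simp: bump_def flat_def intro!: mult_le_one)

lemma bump_outside: "n > 0 \<Longrightarrow> x \<notin> {a..b} \<Longrightarrow> bump n a b x = 0"
  by (auto simp: bump_def flat_def zero_less_mult_iff)

lemma bump_tendsto: "(\<lambda>n. bump (real (Suc n)) a b x) \<longlonglongrightarrow> indicator {a<..<b} x"
proof (cases "x \<in> {a<..<b}")
  case True
  have *: "(\<lambda>n. flat 1 (real (Suc n) * c)) \<longlonglongrightarrow> 1" if "c > 0" for c
  proof -
    have "(\<lambda>n. exp (- (1 / c) * (1 / real (Suc n)))) \<longlonglongrightarrow> exp (- (1 / c) * 0)"
      by (intro tendsto_intros LIMSEQ_Suc lim_1_over_n)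
    moreover have "flat 1 (real (Suc n) * c) = exp (- (1 / c) * (1 / real (Suc n)))" for n
      using that by (simp add: flat_def field_simps del: of_nat_Suc)
    ultimately show ?thesis by simp
  qed
  have "(\<lambda>n. bump (real (Suc n)) a b x) \<longlonglongrightarrow> 1 * 1"
    unfolding bump_def using True by (intro tendsto_mult *) auto
  then show ?thesis using True by simp
next
  case False
  then have "bump (real (Suc n)) a b x = 0" for n
    by (auto simp: bump_def flat_def zero_less_mult_iff)
  then show ?thesis using False by simp
qed

lemma bump_continuous: "continuous_on UNIV (bump n a b)"
  using Ck_on_bump[of 0 n a b] by simp

lemma bump_measurable [measurable]: "bump n a b \<in> borel_measurable borel"
  by (rule borel_measurable_continuous_onI[OF bump_continuous])

lemma test_functionsI_real:
  assumes "\<And>k. Ck_on k UNIV f" "\<And>x. x \<notin> {a..b} \<Longrightarrow> f x = 0"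
  shows "f \<in> test_functions (UNIV :: real set)"
  using assms unfolding test_functions_def Cinf_on_def by (auto intro!: exI[of _ "{a..b}"])

lemma bump_test_function: "n > 0 \<Longrightarrow> bump n a b \<in> test_functions UNIV"
  by (rule test_functionsI_real[OF Ck_on_bump bump_outside])

lemma test_function_real:
  assumes "\<phi> \<in> test_functions (UNIV :: real set)"
  obtains R where "R > 0" "\<And>x. (\<phi> has_real_derivative deriv \<phi> x) (at x)" "continuous_on UNIV (deriv \<phi>)"
    "\<And>x. \<bar>x\<bar> > R \<Longrightarrow> \<phi> x = 0" "\<And>x. \<bar>x\<bar> > R \<Longrightarrow> deriv \<phi> x = 0"
proof -
  obtain K where K: "compact K" "\<And>x. x \<notin> K \<Longrightarrow> \<phi> x = 0" and C: "Ck_on (Suc 0) UNIV \<phi>"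
    using assms unfolding test_functions_def Cinf_on_def by blast
  then obtain f' where f: "\<And>x. (\<phi> has_derivative f' x) (at x)" "\<And>v. continuous_on UNIV (\<lambda>x. f' x v)"
    by auto
  have "(\<phi> has_real_derivative f' x 1) (at x)" for x
  proof -
    have "f' x v = f' x 1 * v" for v
      using linear_cmul[OF has_derivative_linear[OF f(1)[of x]], of v 1] by (simp add: mult.commute)
    then have "f' x = (*) (f' x 1)" by (intro ext) metis
    then show ?thesis using f(1)[of x] by (simp add: has_field_derivative_def)
  qed
  then have d: "deriv \<phi> = (\<lambda>x. f' x 1)" using DERIV_imp_deriv by blast
  have D: "(\<phi> has_real_derivative deriv \<phi> x) (at x)" for x
    using \<open>\<And>x. (\<phi> has_real_derivative f' x 1) (at x)\<close> d by simp
  obtain R0 where R0: "\<And>x. x \<in> K \<Longrightarrow> \<bar>x\<bar> \<le> R0"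
    using compact_imp_bounded[OF K(1)] unfolding bounded_iff by auto
  define R where "R = max R0 1"
  have z: "\<phi> x = 0" if "\<bar>x\<bar> > R" for x
  proof (rule K(2), rule notI)
    assume "x \<in> K"
    then show False using R0 that unfolding R_def by fastforce
  qed
  have "deriv \<phi> x = 0" if "\<bar>x\<bar> > R" for x
  proof -
    have "open {x::real. \<bar>x\<bar> > R}" by (intro open_Collect_less continuous_intros)
    then have "(\<phi> has_real_derivative 0) (at x)"
      by (rule has_field_derivative_transform_within_open[where f = "\<lambda>x. 0", rotated]) (use that z in auto)
    then show ?thesis by (rule DERIV_imp_deriv)
  qed
  then show ?thesis using that[of R] D f(2) d z unfolding R_def by auto
qed

section \<open>Weak derivatives\<close>

lemma set_integrable_lebesgue_iff:
  fixes g :: "real \<Rightarrow> real"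
  assumes "g \<in> borel_measurable borel"
  shows "set_integrable lebesgue {a..b} g \<longleftrightarrow> set_integrable lborel {a..b} g"
proof -
  have "(\<lambda>x. indicator {a..b} x *\<^sub>R g x) \<in> borel_measurable lborel"
    using assms by (intro borel_measurable_scaleR borel_measurable_indicator) auto
  then show ?thesis
    unfolding set_integrable_def by (rule integrable_completion)
qed

lemma lebesgue_Borel_representative:
  fixes g :: "real \<Rightarrow> real"
  assumes "g \<in> borel_measurable lebesgue"
  obtains h where "h \<in> borel_measurable borel" "AE x in lborel. g x = h x" "AE x in lebesgue. g x = h x"
  using completion_ex_borel_measurable_real[OF assms] AE_completion by (metis measurable_lborel2)

lemma locally_integrable_measurable:
  assumes "locally_integrable g"
  shows "g \<in> borel_measurable lebesgue"
proof (rule borel_measurable_LIMSEQ_metric)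
  show "(\<lambda>x. indicator {- real n..real n} x *\<^sub>R g x) \<in> borel_measurable lebesgue" for n
    using assms unfolding locally_integrable_def set_integrable_def by blast
  show "(\<lambda>n. indicator {- real n..real n} x *\<^sub>R g x) \<longlonglongrightarrow> g x" for x
  proof (rule tendsto_eventually)
    obtain N where "\<bar>x\<bar> < real N" using reals_Archimedean2 by blast
    then show "\<forall>\<^sub>F n in sequentially. indicator {- real n..real n} x *\<^sub>R g x = g x"
      by (intro eventually_sequentiallyI[of N]) (auto simp: indicator_def)
  qed
qed

lemma locally_integrable_AE_cong:
  assumes "locally_integrable g" "h \<in> borel_measurable lebesgue" "AE x in lebesgue. g x = h x"
  shows "locally_integrable h"
  unfolding locally_integrable_def set_integrable_def
proof (intro allI)
  fix a b
  have "integrable lebesgue (\<lambda>x. indicator {a..b} x *\<^sub>R g x)"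
    using assms(1) unfolding locally_integrable_def set_integrable_def by blast
  then show "integrable lebesgue (\<lambda>x. indicator {a..b} x *\<^sub>R h x)"
  proof (rule integrable_cong_AE_imp)
    show "(\<lambda>x. indicator {a..b} x *\<^sub>R h x) \<in> borel_measurable lebesgue"
      using assms(2) by (intro borel_measurable_scaleR borel_measurable_indicator) auto
    show "AE x in lebesgue. indicator {a..b} x *\<^sub>R g x = indicator {a..b} x *\<^sub>R h x"
      using assms(3) by eventually_elim simp
  qed
qed

text \<open>The fundamental lemma of the calculus of variations: by dominated convergence the
  integrals against bumps determine the integrals over intervals.\<close>

lemma AE_zero_if_bump_integrals_zero:
  fixes w :: "real \<Rightarrow> real"
  assumes [measurable]: "w \<in> borel_measurable borel"
    and int: "\<And>a b. set_integrable lborel {a..b} w"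
    and zero: "\<And>n a b. n > 0 \<Longrightarrow> a < b \<Longrightarrow> (LINT x|lborel. w x * bump n a b x) = 0"
  shows "AE x in lborel. w x = 0"
proof (rule AE_zero_if_Icc_integrals_zero)
  fix a b :: real assume "a \<le> b"
  show "(LINT x:{a..b}|lborel. w x) = 0"
  proof (cases "a = b")
    case True
    have "(LINT x:{a..b}|lborel. w x) = (LINT x::real|lborel. 0)"
      unfolding set_lebesgue_integral_def
    proof (rule integral_cong_AE)
      show "AE x in lborel. indicator {a..b} x *\<^sub>R w x = 0"
        using AE_lborel_singleton[of a] by eventually_elim (use True in \<open>auto split: split_indicator\<close>)
    qed auto
    then show ?thesis by simp
  next
    case False
    have "(\<lambda>n. LINT x|lborel. w x * bump (real (Suc n)) a b x) \<longlonglongrightarrow> (LINT x|lborel. w x * indicator {a<..<b} x)"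
    proof (rule integral_dominated_convergence)
      show "integrable lborel (\<lambda>x. norm (indicator {a..b} x *\<^sub>R w x))"
        using int[of a b] unfolding set_integrable_def by (rule integrable_norm)
      show "AE x in lborel. (\<lambda>n. w x * bump (real (Suc n)) a b x) \<longlonglongrightarrow> w x * indicator {a<..<b} x"
        by (intro AE_I2 tendsto_intros bump_tendsto)
      show "AE x in lborel. norm (w x * bump (real (Suc n)) a b x) \<le> norm (indicator {a..b} x *\<^sub>R w x)" for n
      proof (rule AE_I2)
        fix x
        show "norm (w x * bump (real (Suc n)) a b x) \<le> norm (indicator {a..b} x *\<^sub>R w x)"
          using bump_outside[of "real (Suc n)" x a b] bump_bounds[of "real (Suc n)" a b x]
          by (cases "x \<in> {a..b}") (auto simp: abs_mult intro: mult_left_le)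
      qed
    qed auto
    then have "(LINT x|lborel. w x * indicator {a<..<b} x) = 0"
      using zero False \<open>a \<le> b\<close> by (simp add: LIMSEQ_const_iff)
    moreover have "(LINT x:{a..b}|lborel. w x) = (LINT x|lborel. w x * indicator {a<..<b} x)"
      unfolding set_lebesgue_integral_def
    proof (rule integral_cong_AE)
      show "AE x in lborel. indicator {a..b} x *\<^sub>R w x = w x * indicator {a<..<b} x"
        using AE_lborel_singleton[of a] AE_lborel_singleton[of b]
        by eventually_elim (auto split: split_indicator)
    qed auto
    ultimately show ?thesis by simp
  qed
qed (use int in auto)

lemma ac_deriv_imp_locally_integrable:
  assumes "ac_deriv f g"
  shows "locally_integrable f" "locally_integrable g"
proof -
  have "set_integrable lborel {a..b} f" for a b
    using borel_integrable_atLeastAtMost'[OF continuous_on_subset[OF ac_deriv_continuous[OF assms]], of a b]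
    by auto
  then show "locally_integrable f" "locally_integrable g"
    using ac_derivD(1,2)[OF assms] ac_deriv_measurable[OF assms]
    unfolding locally_integrable_def by (auto simp: set_integrable_lebesgue_iff)
qed

lemma ac_deriv_imp_weak_deriv:
  assumes fg: "ac_deriv f g"
  shows "has_weak_deriv f g"
  unfolding has_weak_deriv_def
proof (intro conjI ballI)
  fix \<phi> :: "real \<Rightarrow> real" assume "\<phi> \<in> test_functions UNIV"
  then obtain R where R: "R > 0" "\<And>x. (\<phi> has_real_derivative deriv \<phi> x) (at x)" "continuous_on UNIV (deriv \<phi>)"
    "\<And>x. \<bar>x\<bar> > R \<Longrightarrow> \<phi> x = 0" "\<And>x. \<bar>x\<bar> > R \<Longrightarrow> deriv \<phi> x = 0"
    by (rule test_function_real) blast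
  have ac: "ac_deriv \<phi> (deriv \<phi>)" by (rule ac_deriv_C1[OF R(2,3)])
  note [measurable] = ac_derivD(1)[OF fg] ac_deriv_measurable[OF fg] ac_derivD(1)[OF ac] ac_deriv_measurable[OF ac]
  \<comment> \<open>\<open>\<phi>\<close> is known to vanish only for
    \<open>\<bar>x\<bar> > R\<close>; one unit of room makes the boundary terms of the product rule
    vanish.\<close>
  let ?I = "{-(R+1)..R+1}"
  have i1: "set_integrable lborel ?I (\<lambda>x. \<phi> x * g x)"
    by (intro set_integrable_continuous_mult ac_derivD(2)[OF fg] ac_deriv_continuous[OF ac])
  have i2: "set_integrable lborel ?I (\<lambda>x. f x * deriv \<phi> x)"
    by (intro set_integrable_continuous_mult ac_derivD(2)[OF ac] ac_deriv_continuous[OF fg])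
  have "(LINT x:?I|lborel. g x * \<phi> x + f x * deriv \<phi> x) = 0"
    using ac_derivD(3)[OF ac_deriv_mult[OF fg ac], of "-(R+1)" "R+1"] R(1) R(4)[of "-(R+1)"] R(4)[of "R+1"] by auto
  then have "(LINT x:?I|lborel. \<phi> x * g x) + (LINT x:?I|lborel. f x * deriv \<phi> x) = 0"
    using set_integral_add(2)[OF i1 i2] by (simp add: mult.commute)
  moreover have "(LINT x:?I|lborel. \<phi> x * g x) = (LINT x|lebesgue. g x * \<phi> x)"
  proof -
    have "(\<lambda>x. indicator ?I x *\<^sub>R (\<phi> x * g x)) = (\<lambda>x. g x * \<phi> x)"
      using R(4) by (fastforce split: split_indicator)
    then show ?thesis unfolding set_lebesgue_integral_def by (simp add: integral_completion)
  qed
  moreover have "(LINT x:?I|lborel. f x * deriv \<phi> x) = (LINT x|lebesgue. f x * deriv \<phi> x)"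
  proof -
    have "(\<lambda>x. indicator ?I x *\<^sub>R (f x * deriv \<phi> x)) = (\<lambda>x. f x * deriv \<phi> x)"
      using R(5) by (fastforce split: split_indicator)
    then show ?thesis unfolding set_lebesgue_integral_def by (simp add: integral_completion)
  qed
  ultimately show "(LINT x|lebesgue. f x * deriv \<phi> x) = - (LINT x|lebesgue. g x * \<phi> x)" by simp
qed (use ac_deriv_imp_locally_integrable[OF fg] in auto)

lemma integrable_mult_test_function:
  assumes "locally_integrable f" and t: "continuous_on UNIV \<phi>" "\<And>x. \<bar>x\<bar> > R \<Longrightarrow> \<phi> x = 0"
  shows "integrable lebesgue (\<lambda>x. f x * \<phi> x)"
proof -
  have [measurable]: "\<phi> \<in> borel_measurable lebesgue"
    by (rule measurable_completion) (use borel_measurable_continuous_onI[OF t(1)] in simp)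
  have "bounded (\<phi> ` {-R..R})"
    using t(1) by (intro compact_imp_bounded compact_continuous_image) (auto intro: continuous_on_subset)
  then obtain C where C: "\<And>x. x \<in> {-R..R} \<Longrightarrow> \<bar>\<phi> x\<bar> \<le> C"
    unfolding bounded_iff real_norm_def by blast
  have i: "integrable lebesgue (\<lambda>x. indicator {-R..R} x *\<^sub>R f x)"
    using assms(1) unfolding locally_integrable_def set_integrable_def by blast
  have "integrable lebesgue (\<lambda>x. C * (indicator {-R..R} x *\<^sub>R f x))"
    using i by (rule integrable_mult_right)
  then show ?thesis
  proof (rule Bochner_Integration.integrable_bound)
    show "(\<lambda>x. f x * \<phi> x) \<in> borel_measurable lebesgue"
      using locally_integrable_measurable[OF assms(1)] by (intro borel_measurable_times) auto
    show "AE x in lebesgue. norm (f x * \<phi> x) \<le> norm (C * (indicator {-R..R} x *\<^sub>R f x))"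
    proof (rule AE_I2)
      fix x
      show "norm (f x * \<phi> x) \<le> norm (C * (indicator {-R..R} x *\<^sub>R f x))"
      proof (cases "x \<in> {-R..R}")
        case True
        then have "\<bar>\<phi> x\<bar> \<le> \<bar>C\<bar>" using C by fastforce
        then show ?thesis using True by (simp add: abs_mult mult.commute[of "\<bar>f x\<bar>"] mult_right_mono)
      next
        case False
        then have "\<phi> x = 0" by (intro t(2)) auto
        then show ?thesis by simp
      qed
    qed
  qed
qed

lemma weak_deriv_unique:
  assumes "has_weak_deriv f g1" "has_weak_deriv f g2"
  shows "AE x in lebesgue. g1 x = g2 x"
proof -
  have l: "locally_integrable g1" "locally_integrable g2" using assms by (auto simp: has_weak_deriv_def)
  have li: "locally_integrable (\<lambda>x. g1 x - g2 x)"
    using l unfolding locally_integrable_def by (auto intro: set_integral_diff)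
  obtain w where w [measurable]: "w \<in> borel_measurable borel"
    and ae: "AE x in lborel. g1 x - g2 x = w x" "AE x in lebesgue. g1 x - g2 x = w x"
    by (rule lebesgue_Borel_representative[OF locally_integrable_measurable[OF li]])
  have wl: "w \<in> borel_measurable lebesgue" by (rule measurable_completion) simp
  have liw: "locally_integrable w" by (rule locally_integrable_AE_cong[OF li wl ae(2)])
  have "AE x in lborel. w x = 0"
  proof (rule AE_zero_if_bump_integrals_zero[OF w])
    show "set_integrable lborel {a..b} w" for a b
      using liw set_integrable_lebesgue_iff[OF w] unfolding locally_integrable_def by blast
    fix n a b :: real assume n: "n > 0" "a < b"
    have t: "bump n a b \<in> test_functions UNIV" by (rule bump_test_function[OF n(1)])
    have z: "\<bar>x\<bar> > \<bar>a\<bar> + \<bar>b\<bar> \<Longrightarrow> bump n a b x = 0" for x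
      by (rule bump_outside[OF n(1)]) auto
    have i1: "integrable lebesgue (\<lambda>x. g1 x * bump n a b x)" and i2: "integrable lebesgue (\<lambda>x. g2 x * bump n a b x)"
      using integrable_mult_test_function[OF l(1) bump_continuous z] integrable_mult_test_function[OF l(2) bump_continuous z] by auto
    have "(LINT x|lborel. w x * bump n a b x) = (LINT x|lebesgue. w x * bump n a b x)"
      by (simp add: integral_completion)
    also have "\<dots> = (LINT x|lebesgue. g1 x * bump n a b x - g2 x * bump n a b x)"
    proof (rule integral_cong_AE)
      show "(\<lambda>x. w x * bump n a b x) \<in> borel_measurable lebesgue"
        by (rule measurable_completion) simp
      show "AE x in lebesgue. w x * bump n a b x = g1 x * bump n a b x - g2 x * bump n a b x"
        using ae(2) by eventually_elim (simp add: left_diff_distrib[symmetric])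
    qed (use i1 i2 in auto)
    also have "\<dots> = 0"
      using assms t i1 i2 unfolding has_weak_deriv_def by simp
    finally show "(LINT x|lborel. w x * bump n a b x) = 0" .
  qed
  then have "AE x in lebesgue. w x = 0" by (rule AE_completion)
  then show ?thesis using ae(2) by eventually_elim simp
qed

text \<open>\<open>wderiv\<close> is an arbitrary choice; this replaces it by any explicit
  representative, up to a null set.\<close>

lemma wderiv_AE_eq:
  assumes "has_weak_deriv f g"
  shows "has_weak_deriv f (wderiv f)" "AE x in lebesgue. wderiv f x = g x"
proof -
  show "has_weak_deriv f (wderiv f)" unfolding wderiv_def by (rule someI[of "has_weak_deriv f", OF assms])
  then show "AE x in lebesgue. wderiv f x = g x" using weak_deriv_unique assms by blast
qed

text \<open>Such a primitive need not have compact support, but it is constant on either side of the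
  interval, so the difference of two of its translates is a test function.\<close>

lemma bump_primitive:
  assumes "n > 0"
  obtains P where "\<And>k. Ck_on k UNIV P" "\<And>x. (P has_real_derivative bump n a b x) (at x)"
    "\<And>x. x < a \<Longrightarrow> P x = 0" "\<And>x. x > b \<Longrightarrow> P x = P (b + 1)"
proof -
  define P where "P x = integral {a-1..x} (bump n a b)" for x
  have z: "P x = 0" if "x < a" for x
  proof -
    have "integral {a-1..x} (bump n a b) = integral {a-1..x} (\<lambda>x. 0)"
      by (rule integral_cong) (use that bump_outside[OF assms] in auto)
    then show ?thesis by (simp add: P_def)
  qed
  have D: "(P has_real_derivative bump n a b x) (at x)" for x
  proof (cases "x < a")
    case True
    have "((\<lambda>x. 0) has_real_derivative bump n a b x) (at x)"
      using bump_outside[OF assms, of x a b] True by simp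
    then show ?thesis
      by (rule has_field_derivative_transform_within_open[where S = "{..<a}"]) (use True z in auto)
  next
    case False
    have "(P has_real_derivative bump n a b x) (at x within {a-1..x+1})"
      unfolding P_def
      by (rule integral_has_real_derivative)
        (use False in \<open>auto intro: continuous_on_subset[OF bump_continuous]\<close>)
    then show ?thesis using False at_within_Icc_at[of "a-1" x "x+1"] by simp
  qed
  have k: "Ck_on k UNIV P" for k
    using Ck_on_Suc_real[OF D Ck_on_bump, of k] by (rule Ck_on_SucD)
  have "P x = P (b + 1)" if "x > b" for x
  proof -
    have "(P has_real_derivative 0) (at x within {b<..})" if "x > b" for x
      using D[of x] bump_outside[OF assms, of x a b] that by (auto intro: has_field_derivative_at_within)
    then have "\<exists>c. \<forall>x\<in>{b<..}. P x = c"
      by (intro has_field_derivative_zero_constant) auto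
    then show ?thesis using that by auto
  qed
  then show ?thesis using that k D z by blast
qed

lemma continuous_AE_zero:
  fixes w :: "real \<Rightarrow> real"
  assumes "continuous_on UNIV w" "AE x in lborel. w x = 0"
  shows "w x = 0"
proof (rule ccontr)
  assume nz: "w x \<noteq> 0"
  have "open {x. w x \<noteq> 0}"
    using assms(1) by (intro open_Collect_neq) auto
  moreover have "negligible {x. w x \<noteq> 0}"
    using AE_completion[OF assms(2)] by (simp add: negligible_iff_null_sets AE_iff_null_sets completion.complete2 eventually_ae_filter)
      (auto intro: null_sets_completion_subset)
  ultimately show False using open_not_negligible nz by auto
qed

text \<open>The du Bois-Reymond argument: if \<open>P\<close> is a primitive of a bump, then
  \<open>P (x - a) - P (x - b)\<close> is a test function, since the constant values on the right
  cancel. Testing with it and moving the translations over to \<open>w\<close> shows that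
  \<open>w (x + a) - w (x + b)\<close> is orthogonal to every bump, hence 0 by continuity; take
  \<open>x = 0\<close>.\<close>

lemma weak_deriv_zero_imp_constant:
  assumes c: "continuous_on UNIV w" and z: "has_weak_deriv w (\<lambda>x. 0)"
  shows "w a = w b"
proof -
  have cm [measurable]: "w \<in> borel_measurable borel" by (rule borel_measurable_continuous_onI[OF c])
  let ?h = "\<lambda>x. w (x + a) - w (x + b)"
  have hc: "continuous_on UNIV ?h"
    by (intro continuous_intros continuous_on_compose2[OF c]) auto
  have "AE x in lborel. ?h x = 0"
  proof (rule AE_zero_if_bump_integrals_zero)
    show "?h \<in> borel_measurable borel" by simp
    show "set_integrable lborel {s..t} ?h" for s t
      using borel_integrable_atLeastAtMost'[OF continuous_on_subset[OF hc]] by blast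
    fix n s t :: real assume n: "n > 0" "s < t"
    obtain P where P: "\<And>k. Ck_on k UNIV P" "\<And>x. (P has_real_derivative bump n s t x) (at x)"
      "\<And>x. x < s \<Longrightarrow> P x = 0" "\<And>x. x > t \<Longrightarrow> P x = P (t + 1)"
      by (rule bump_primitive[OF n(1)]) blast
    define \<Phi> where "\<Phi> = (\<lambda>x. P (x - a) - P (x - b))"
    have D: "(\<Phi> has_real_derivative (bump n s t (x - a) - bump n s t (x - b))) (at x)" for x
      unfolding \<Phi>_def
    proof (rule DERIV_diff)
      show "((\<lambda>x. P (x - d)) has_real_derivative bump n s t (x - d)) (at x)" for d
      proof -
        have "((\<lambda>x. x - d) has_real_derivative 1) (at x)" by (auto intro!: derivative_eq_intros)
        from DERIV_chain2[OF P(2) this] show ?thesis by simp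
      qed
      then show "((\<lambda>x. P (x - b)) has_real_derivative bump n s t (x - b)) (at x)" .
    qed
    have "Ck_on k UNIV (\<lambda>x. P (1 * x + (- a)) + (-1) * P (1 * x + (- b)))" for k
      by (rule Ck_on_add[OF Ck_on_affine[OF P(1)] Ck_on_mult[OF Ck_on_const Ck_on_affine[OF P(1)]]])
    then have "Ck_on k UNIV \<Phi>" for k unfolding \<Phi>_def by simp
    then have "\<Phi> \<in> test_functions UNIV"
    proof (rule test_functionsI_real)
      fix x assume "x \<notin> {min (s + a) (s + b)..max (t + a) (t + b)}"
      then show "\<Phi> x = 0"
        unfolding \<Phi>_def using P(3)[of "x - a"] P(3)[of "x - b"] P(4)[of "x - a"] P(4)[of "x - b"]
        by (cases "x < min (s + a) (s + b)") auto
    qed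
    then have "(LINT x|lebesgue. w x * deriv \<Phi> x) = 0"
      using z unfolding has_weak_deriv_def by simp
    then have e: "(LINT x|lborel. w x * (bump n s t (x - a) - bump n s t (x - b))) = 0"
      using DERIV_imp_deriv[OF D] by (simp add: integral_completion)
    have i: "integrable lborel (\<lambda>x. w x * bump n s t (x - d))" for d
    proof -
      have "integrable lebesgue (\<lambda>x. w x * bump n s t (x - d))"
      proof (rule integrable_mult_test_function)
        show "locally_integrable w" using z by (simp add: has_weak_deriv_def)
        show "continuous_on UNIV (\<lambda>x. bump n s t (x - d))"
          by (intro continuous_intros continuous_on_compose2[OF bump_continuous]) auto
        show "bump n s t (x - d) = 0" if "\<bar>x\<bar> > \<bar>s\<bar> + \<bar>t\<bar> + \<bar>d\<bar>" for x
          by (rule bump_outside[OF n(1)]) (use that in auto)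
      qed
      then show ?thesis by (simp add: integrable_completion)
    qed
    have "(LINT x|lborel. w x * bump n s t (x - d)) = (LINT x|lborel. w (x + d) * bump n s t x)"
      and "integrable lborel (\<lambda>x. w (x + d) * bump n s t x)" for d
      using lborel_integral_real_affine[of 1 "\<lambda>x. w x * bump n s t (x - d)" d]
        lborel_integrable_real_affine[OF i[of d], of 1 d] by (auto simp: add.commute)
    then show "(LINT x|lborel. ?h x * bump n s t x) = 0"
      using e i by (simp add: left_diff_distrib right_diff_distrib)
  qed
  from continuous_AE_zero[OF hc this, of 0] show ?thesis by simp
qed

lemma ac_deriv_primitive:
  assumes "g \<in> borel_measurable borel" "\<And>a b. set_integrable lborel {a..b} g"
  obtains F where "ac_deriv F g"
proof -
  define F where "F x = (if x \<ge> 0 then integral {0..x} g else - integral {x..0} g)" for x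
  have i: "g integrable_on {a..b}" for a b
    using set_borel_integral_eq_integral(1)[OF assms(2)] .
  have "F b - F a = integral {a..b} g" if "a \<le> b" for a b
    using Henstock_Kurzweil_Integration.integral_combine[OF _ _ i, of 0 a b]
      Henstock_Kurzweil_Integration.integral_combine[OF _ _ i, of a 0 b]
      Henstock_Kurzweil_Integration.integral_combine[OF _ _ i, of a b 0] that
    by (auto simp: F_def)
  then have "ac_deriv F g"
    unfolding ac_deriv_def using assms set_borel_integral_eq_integral(2)[OF assms(2)] by auto
  then show ?thesis using that by blast
qed

lemma has_weak_deriv_AE_cong:
  assumes "has_weak_deriv f g" "h \<in> borel_measurable lebesgue" "AE x in lebesgue. g x = h x"
  shows "has_weak_deriv f h"
  unfolding has_weak_deriv_def
proof (intro conjI ballI)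
  have g: "locally_integrable g" using assms by (simp add: has_weak_deriv_def)
  show "locally_integrable f" using assms by (simp add: has_weak_deriv_def)
  show "locally_integrable h" by (rule locally_integrable_AE_cong[OF g assms(2,3)])
  fix \<phi> :: "real \<Rightarrow> real" assume p: "\<phi> \<in> test_functions UNIV"
  then have "continuous_on UNIV \<phi>"
    by (rule test_function_real) (blast intro: continuous_at_imp_continuous_on DERIV_isCont)
  then have [measurable]: "\<phi> \<in> borel_measurable lebesgue"
    using borel_measurable_continuous_onI measurable_completion measurable_lborel2 by blast
  have "(LINT x|lebesgue. g x * \<phi> x) = (LINT x|lebesgue. h x * \<phi> x)"
    by (rule integral_cong_AE)
      (use assms(2,3) locally_integrable_measurable[OF g] in \<open>auto elim!: eventually_mono\<close>)
  then show "(LINT x|lebesgue. f x * deriv \<phi> x) = - (LINT x|lebesgue. h x * \<phi> x)"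
    using assms(1) p by (simp add: has_weak_deriv_def)
qed

text \<open>Subtracting a primitive of a Borel representative of \<open>g\<close> leaves a
  continuous function with weak derivative 0, that is, a constant.\<close>

lemma weak_deriv_imp_ac_deriv:
  assumes c: "continuous_on UNIV f" and w: "has_weak_deriv f g"
  obtains h where "ac_deriv f h" "AE x in lebesgue. g x = h x"
proof -
  have lg: "locally_integrable g" and lf: "locally_integrable f" using w by (auto simp: has_weak_deriv_def)
  obtain h where h [measurable]: "h \<in> borel_measurable borel" and ae: "AE x in lebesgue. g x = h x"
    using lebesgue_Borel_representative[OF locally_integrable_measurable[OF lg]] by blast
  have hl: "h \<in> borel_measurable lebesgue" by (rule measurable_completion) simp
  have wh: "has_weak_deriv f h" by (rule has_weak_deriv_AE_cong[OF w hl ae])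
  then have "set_integrable lborel {a..b} h" for a b
    using set_integrable_lebesgue_iff[OF h] unfolding has_weak_deriv_def locally_integrable_def by blast
  then obtain F where F: "ac_deriv F h" using ac_deriv_primitive[OF h] by blast
  have wF: "has_weak_deriv F h" by (rule ac_deriv_imp_weak_deriv[OF F])
  have lF: "locally_integrable F" using wF by (simp add: has_weak_deriv_def)
  have "has_weak_deriv (\<lambda>x. f x - F x) (\<lambda>x. 0)"
    unfolding has_weak_deriv_def
  proof (intro conjI ballI)
    show "locally_integrable (\<lambda>x. f x - F x)"
      using lf lF unfolding locally_integrable_def by (auto intro: set_integral_diff)
    show "locally_integrable (\<lambda>x. 0)" by (simp add: locally_integrable_def set_integrable_def)
    fix \<phi> :: "real \<Rightarrow> real" assume p: "\<phi> \<in> test_functions UNIV"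
    then obtain R where R: "continuous_on UNIV (deriv \<phi>)" "\<And>x. \<bar>x\<bar> > R \<Longrightarrow> deriv \<phi> x = 0"
      by (rule test_function_real) blast
    have "(LINT x|lebesgue. (f x - F x) * deriv \<phi> x) =
        (LINT x|lebesgue. f x * deriv \<phi> x) - (LINT x|lebesgue. F x * deriv \<phi> x)"
      using integrable_mult_test_function[OF lf R] integrable_mult_test_function[OF lF R]
      by (simp add: left_diff_distrib)
    also have "\<dots> = 0" using wh wF p by (simp add: has_weak_deriv_def)
    finally show "(LINT x|lebesgue. (f x - F x) * deriv \<phi> x) = - (LINT x|lebesgue. 0 * \<phi> x)" by simp
  qed
  then have "f a - F a = f b - F b" for a b
    by (rule weak_deriv_zero_imp_constant[rotated])
      (intro continuous_intros c ac_deriv_continuous[OF F])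
  then have "f b - f a = F b - F a" for a b by (metis diff_eq_eq diff_add_eq add.commute diff_diff_eq2)
  then have "ac_deriv f h" using F unfolding ac_deriv_def by simp
  then show ?thesis using that ae by blast
qed

section \<open>Monotone changes of variables\<close>

text \<open>Stated as a push-forward of measures, the change of variables needs no pointwise
  derivative. Both sources of such maps fit: absolutely continuous \<open>y\<close> along the flow,
  and the generalised inverse of a distribution function for the initial data.\<close>

locale lebesgue_transport =
  fixes y p :: "real \<Rightarrow> real"
  assumes y_mono: "mono y"
    and p_measurable [measurable]: "p \<in> borel_measurable borel"
    and p_nonneg: "\<And>\<xi>. 0 \<le> p \<xi>"
    and distr_y: "distr (density lborel (\<lambda>\<xi>. ennreal (p \<xi>))) borel y = lborel"
begin

lemma y_measurable [measurable]: "y \<in> borel_measurable borel"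
  using y_mono by (rule borel_measurable_mono)

lemma nn_integral_y:
  assumes [measurable]: "G \<in> borel_measurable borel"
  shows "(\<integral>\<^sup>+\<xi>. ennreal (p \<xi>) * G (y \<xi>) \<partial>lborel) = (\<integral>\<^sup>+x. G x \<partial>lborel)"
proof -
  have "(\<integral>\<^sup>+x. G x \<partial>lborel) = (\<integral>\<^sup>+x. G x \<partial>(distr (density lborel (\<lambda>\<xi>. ennreal (p \<xi>))) borel y))"
    by (simp add: distr_y)
  also have "\<dots> = (\<integral>\<^sup>+\<xi>. ennreal (p \<xi>) * G (y \<xi>) \<partial>lborel)"
    by (subst nn_integral_distr) (auto simp: nn_integral_density)
  finally show ?thesis by simp
qed

lemma integral_y:
  fixes g :: "real \<Rightarrow> real"
  assumes [measurable]: "g \<in> borel_measurable borel"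
  shows "integrable lborel (\<lambda>\<xi>. g (y \<xi>) * p \<xi>) \<longleftrightarrow> integrable lborel g"
    and "(LINT \<xi>|lborel. g (y \<xi>) * p \<xi>) = (LINT x|lborel. g x)"
proof -
  let ?D = "density lborel (\<lambda>\<xi>. ennreal (p \<xi>))"
  have "integrable lborel g \<longleftrightarrow> integrable (distr ?D borel y) g" by (simp add: distr_y)
  also have "\<dots> \<longleftrightarrow> integrable ?D (\<lambda>\<xi>. g (y \<xi>))" by (rule integrable_distr_eq) auto
  also have "\<dots> \<longleftrightarrow> integrable lborel (\<lambda>\<xi>. p \<xi> *\<^sub>R g (y \<xi>))"
    by (rule integrable_density) (auto simp: p_nonneg)
  finally show "integrable lborel (\<lambda>\<xi>. g (y \<xi>) * p \<xi>) \<longleftrightarrow> integrable lborel g" by (simp add: mult.commute)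
  have "(LINT x|lborel. g x) = (LINT x|distr ?D borel y. g x)" by (simp add: distr_y)
  also have "\<dots> = (LINT \<xi>|?D. g (y \<xi>))" by (rule integral_distr) auto
  also have "\<dots> = (LINT \<xi>|lborel. p \<xi> *\<^sub>R g (y \<xi>))"
    by (rule integral_density) (auto simp: p_nonneg)
  finally show "(LINT \<xi>|lborel. g (y \<xi>) * p \<xi>) = (LINT x|lborel. g x)" by (simp add: mult.commute)
qed

text \<open>The preimage of a null set has mass 0 for \<open>p d\<xi>\<close>, but it can have
  positive Lebesgue measure; the alternative \<open>p \<xi> = 0\<close> cannot be dropped.\<close>

lemma AE_y:
  assumes "AE x in lborel. P x"
  shows "AE \<xi> in lborel. p \<xi> = 0 \<or> P (y \<xi>)"
proof -
  obtain N where N: "{x \<in> space lborel. \<not> P x} \<subseteq> N" "emeasure lborel N = 0" "N \<in> sets lborel"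
    using assms by (rule AE_E)
  then have [measurable]: "N \<in> sets borel" by simp
  have "(\<integral>\<^sup>+\<xi>. ennreal (p \<xi>) * indicator N (y \<xi>) \<partial>lborel) = 0"
    using nn_integral_y[of "indicator N"] N by simp
  then have "AE \<xi> in lborel. ennreal (p \<xi>) * indicator N (y \<xi>) = 0"
    by (subst (asm) nn_integral_0_iff_AE) auto
  then show ?thesis
  proof eventually_elim
    fix \<xi> assume "ennreal (p \<xi>) * indicator N (y \<xi>) = 0"
    then show "p \<xi> = 0 \<or> P (y \<xi>)"
      using N(1) p_nonneg[of \<xi>] by (auto simp: indicator_def split: if_splits)
  qed
qed

lemma AE_level_set: "AE \<xi> in lborel. y \<xi> = x \<longrightarrow> p \<xi> = 0"
  using AE_y[OF AE_lborel_singleton[of x]] by eventually_elim auto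

text \<open>If \<open>y\<close> takes the same value at two points, it is constant between them and
  shares this value with a rational. There are only countably many levels \<open>y s\<close> with
  rational \<open>s\<close>, and \<open>p\<close> vanishes almost everywhere on each of
  them.\<close>

lemma AE_injective: "AE \<xi> in lborel. p \<xi> = 0 \<or> (\<forall>\<eta>. y \<eta> = y \<xi> \<longrightarrow> \<eta> = \<xi>)"
proof -
  have "AE \<xi> in lborel. \<forall>s\<in>\<rat>. y \<xi> = y s \<longrightarrow> p \<xi> = 0"
    using AE_level_set by (intro AE_ball_countable[THEN iffD2]) (auto simp: countable_rat)
  then show ?thesis
  proof eventually_elim
    fix \<xi> assume *: "\<forall>s\<in>\<rat>. y \<xi> = y s \<longrightarrow> p \<xi> = 0"
    show "p \<xi> = 0 \<or> (\<forall>\<eta>. y \<eta> = y \<xi> \<longrightarrow> \<eta> = \<xi>)"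
    proof (rule ccontr)
      assume "\<not> ?thesis"
      then obtain \<eta> where \<eta>: "y \<eta> = y \<xi>" "\<eta> \<noteq> \<xi>" "p \<xi> \<noteq> 0" by auto
      then have "min \<eta> \<xi> < max \<eta> \<xi>" by auto
      then obtain s where s: "s \<in> \<rat>" "min \<eta> \<xi> < s" "s < max \<eta> \<xi>"
        using Rats_dense_in_real by blast
      have "y s = y \<xi>"
        using monoD[OF y_mono, of "min \<eta> \<xi>" s] monoD[OF y_mono, of s "max \<eta> \<xi>"] s \<eta>(1)
        by (auto simp: min_def max_def split: if_splits)
      then show False using * s(1) \<eta>(3) by auto
    qed
  qed
qed

text \<open>The preimage of \<open>{y a..y b}\<close> can exceed \<open>{a..b}\<close> only by
  points on the levels \<open>y a\<close> and \<open>y b\<close>, where \<open>p\<close> vanishes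
  almost everywhere.\<close>

lemma AE_Icc_level:
  assumes "a \<le> b"
  shows "AE \<xi> in lborel. p \<xi> = 0 \<or> (indicator {y a..y b} (y \<xi>) :: real) = indicator {a..b} \<xi>"
  using AE_level_set[of "y a"] AE_level_set[of "y b"]
proof eventually_elim
  fix \<xi> assume *: "y \<xi> = y a \<longrightarrow> p \<xi> = 0" "y \<xi> = y b \<longrightarrow> p \<xi> = 0"
  show "p \<xi> = 0 \<or> (indicator {y a..y b} (y \<xi>) :: real) = indicator {a..b} \<xi>"
    using * monoD[OF y_mono, of a \<xi>] monoD[OF y_mono, of \<xi> b] monoD[OF y_mono, of \<xi> a] monoD[OF y_mono, of b \<xi>]
    by (cases "\<xi> < a"; cases "\<xi> > b") (auto simp: indicator_def)
qed

lemma set_integral_y: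
  fixes g :: "real \<Rightarrow> real"
  assumes [measurable]: "g \<in> borel_measurable borel" and "a \<le> b"
    and i: "set_integrable lborel {y a..y b} g"
  shows "set_integrable lborel {a..b} (\<lambda>\<xi>. g (y \<xi>) * p \<xi>)"
    and "(LINT \<xi>:{a..b}|lborel. g (y \<xi>) * p \<xi>) = (LINT x:{y a..y b}|lborel. g x)"
proof -
  let ?G = "\<lambda>x. indicator {y a..y b} x *\<^sub>R g x"
  have ae: "AE \<xi> in lborel. ?G (y \<xi>) * p \<xi> = indicator {a..b} \<xi> *\<^sub>R (g (y \<xi>) * p \<xi>)"
    using AE_Icc_level[OF assms(2)] by eventually_elim auto
  have G: "integrable lborel (\<lambda>\<xi>. ?G (y \<xi>) * p \<xi>)"
    using i integral_y(1)[of ?G] unfolding set_integrable_def by simp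
  then show "set_integrable lborel {a..b} (\<lambda>\<xi>. g (y \<xi>) * p \<xi>)"
    unfolding set_integrable_def by (rule integrable_cong_AE_imp) (use ae in auto)
  have "(LINT \<xi>:{a..b}|lborel. g (y \<xi>) * p \<xi>) = (LINT \<xi>|lborel. ?G (y \<xi>) * p \<xi>)"
    unfolding set_lebesgue_integral_def
    by (rule integral_cong_AE) (use ae in \<open>auto elim!: eventually_mono\<close>)
  also have "\<dots> = (LINT x:{y a..y b}|lborel. g x)"
    unfolding set_lebesgue_integral_def by (rule integral_y(2)) simp
  finally show "(LINT \<xi>:{a..b}|lborel. g (y \<xi>) * p \<xi>) = (LINT x:{y a..y b}|lborel. g x)" .
qed

text \<open>Transporting the constant 1 already yields absolute continuity. This is how the
  generalised inverse in \<open>L_map\<close> gets its derivative.\<close>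

lemma ac_deriv_y: "ac_deriv y p"
proof -
  have i: "set_integrable lborel {a..b} (\<lambda>x. 1::real)" for a b :: real
    by (rule borel_integrable_atLeastAtMost') (rule continuous_on_const)
  have 1: "set_integrable lborel {a..b} p" "(LINT \<xi>:{a..b}|lborel. p \<xi>) = y b - y a" if "a \<le> b" for a b
    using set_integral_y[OF _ that, of "\<lambda>x. 1"] i monoD[OF y_mono that] by (auto simp: set_integral_const)
  have "set_integrable lborel {a..b} p" for a b
    using 1(1)[of a b] by (cases "a \<le> b") (auto simp: set_integrable_def)
  then show ?thesis using 1 unfolding ac_deriv_def by auto
qed

lemma ac_deriv_compose:
  assumes "ac_deriv f g"
  shows "ac_deriv (\<lambda>\<xi>. f (y \<xi>)) (\<lambda>\<xi>. g (y \<xi>) * p \<xi>)"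
proof -
  note [measurable] = ac_derivD(1)[OF assms]
  have 1: "set_integrable lborel {a..b} (\<lambda>\<xi>. g (y \<xi>) * p \<xi>)"
     "(LINT \<xi>:{a..b}|lborel. g (y \<xi>) * p \<xi>) = f (y b) - f (y a)" if "a \<le> b" for a b
    using set_integral_y[OF _ that ac_derivD(2)[OF assms]] ac_derivD(3)[OF assms] monoD[OF y_mono that] by auto
  have "set_integrable lborel {a..b} (\<lambda>\<xi>. g (y \<xi>) * p \<xi>)" for a b
    using 1(1)[of a b] by (cases "a \<le> b") (auto simp: set_integrable_def)
  then show ?thesis using 1 unfolding ac_deriv_def by auto
qed

end

lemma unbounded_surj:
  fixes y :: "real \<Rightarrow> real"
  assumes c: "continuous_on UNIV y" and b: "\<And>\<xi>. \<bar>y \<xi> - \<xi>\<bar> \<le> C"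
  shows "\<exists>\<xi>. y \<xi> = x"
proof -
  have "\<exists>\<xi>. x - \<bar>C\<bar> \<le> \<xi> \<and> \<xi> \<le> x + \<bar>C\<bar> \<and> y \<xi> = x"
  proof (rule IVT')
    show "y (x - \<bar>C\<bar>) \<le> x" using b[of "x - \<bar>C\<bar>"] by linarith
    show "x \<le> y (x + \<bar>C\<bar>)" using b[of "x + \<bar>C\<bar>"] by linarith
  qed (use c continuous_on_subset in auto)
  then show ?thesis by blast
qed

text \<open>Since \<open>y\<close> is continuous, monotone and at bounded distance from the
  identity, each sublevel set \<open>y \<xi> \<le> a\<close> is a half line ending at the last point
  of level \<open>a\<close>. Hence preimages of half-open intervals are half-open intervals even if
  \<open>y\<close> has flat pieces, and \<open>p\<close> integrates over them to the difference of
  levels.\<close>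

lemma lebesgue_transportI:
  assumes ac: "ac_deriv y p" and p: "\<And>\<xi>. 0 \<le> p \<xi>" and b: "\<And>\<xi>. \<bar>y \<xi> - \<xi>\<bar> \<le> C"
  shows "lebesgue_transport y p"
proof
  note [measurable] = ac_derivD(1)[OF ac] ac_deriv_measurable[OF ac]
  have c: "continuous_on UNIV y" by (rule ac_deriv_continuous[OF ac])
  have "y a \<le> y b" if "a \<le> b" for a b
  proof -
    have "0 \<le> (LINT x:{a..b}|lborel. p x)"
      unfolding set_lebesgue_integral_def using p by (intro integral_nonneg_AE) auto
    then show ?thesis using ac_derivD(3)[OF ac that] by simp
  qed
  then show m: "mono y" by (rule monoI)
  have last: "\<exists>\<alpha>. y \<alpha> = a \<and> (\<forall>\<xi>. y \<xi> \<le> a \<longleftrightarrow> \<xi> \<le> \<alpha>)" for a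
  proof -
    define S where "S = {\<xi>. y \<xi> \<le> a}"
    obtain \<xi>0 where "y \<xi>0 = a" using unbounded_surj[OF c b] by blast
    then have ne: "S \<noteq> {}" by (auto simp: S_def)
    have "\<xi> \<le> a + C" if "y \<xi> \<le> a" for \<xi> using b[of \<xi>] that by linarith
    then have bd: "bdd_above S" unfolding S_def by (intro bdd_aboveI) auto
    have "closed S" unfolding S_def using c by (intro closed_Collect_le) auto
    then have "Sup S \<in> S" using closed_contains_Sup[OF ne bd] by blast
    then have s: "y \<xi> \<le> a \<longleftrightarrow> \<xi> \<le> Sup S" for \<xi>
      using monoD[OF m, of \<xi> "Sup S"] cSup_upper[OF _ bd, of \<xi>] unfolding S_def by auto
    then have "\<xi>0 \<le> Sup S" using \<open>y \<xi>0 = a\<close> by auto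
    then have "y (Sup S) = a" using monoD[OF m, of \<xi>0 "Sup S"] \<open>y \<xi>0 = a\<close> s[of "Sup S"] by auto
    then show ?thesis using s by blast
  qed
  show "distr (density lborel (\<lambda>\<xi>. ennreal (p \<xi>))) borel y = lborel"
  proof (rule measure_eqI_Ioc)
    fix a b' :: real assume ab: "a \<le> b'"
    obtain \<alpha> where \<alpha>: "y \<alpha> = a" "\<And>\<xi>. y \<xi> \<le> a \<longleftrightarrow> \<xi> \<le> \<alpha>" using last by blast
    obtain \<beta> where \<beta>: "y \<beta> = b'" "\<And>\<xi>. y \<xi> \<le> b' \<longleftrightarrow> \<xi> \<le> \<beta>" using last by blast
    have le: "\<alpha> \<le> \<beta>" using \<alpha> \<beta> ab by auto
    have "y -` {a<..b'} = {\<alpha><..\<beta>}" using \<alpha>(2) \<beta>(2) by (auto simp: not_le[symmetric])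
    then have "emeasure (distr (density lborel (\<lambda>\<xi>. ennreal (p \<xi>))) borel y) {a<..b'} =
        (\<integral>\<^sup>+\<xi>. ennreal (p \<xi>) * indicator {\<alpha><..\<beta>} \<xi> \<partial>lborel)"
      by (simp add: emeasure_distr emeasure_density)
    also have "\<dots> = (\<integral>\<^sup>+\<xi>. ennreal (indicator {\<alpha>..\<beta>} \<xi> *\<^sub>R p \<xi>) \<partial>lborel)"
    proof (rule nn_integral_cong_AE)
      show "AE \<xi> in lborel. ennreal (p \<xi>) * indicator {\<alpha><..\<beta>} \<xi> = ennreal (indicator {\<alpha>..\<beta>} \<xi> *\<^sub>R p \<xi>)"
        using AE_lborel_singleton[of \<alpha>] by eventually_elim (auto split: split_indicator)
    qed
    also have "\<dots> = ennreal (LINT \<xi>:{\<alpha>..\<beta>}|lborel. p \<xi>)"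
      unfolding set_lebesgue_integral_def
      using ac_derivD(2)[OF ac] p by (intro nn_integral_eq_integral) (auto simp: set_integrable_def)
    also have "\<dots> = ennreal (b' - a)" using ac_derivD(3)[OF ac le] \<alpha> \<beta> by simp
    finally have e: "emeasure (distr (density lborel (\<lambda>\<xi>. ennreal (p \<xi>))) borel y) {a<..b'} = ennreal (b' - a)" .
    show "emeasure (distr (density lborel (\<lambda>\<xi>. ennreal (p \<xi>))) borel y) {a<..b'} \<noteq> \<infinity>"
      using e by simp
    show "emeasure (distr (density lborel (\<lambda>\<xi>. ennreal (p \<xi>))) borel y) {a<..b'} = emeasure lborel {a<..b'}"
      using e ab by simp
  qed auto
qed (use ac_derivD(1)[OF ac] p in auto)

section \<open>Right inverses of the transport map and densities of push-forwards\<close>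

locale surj_transport = lebesgue_transport +
  assumes y_surj: "\<And>x. \<exists>\<xi>. y \<xi> = x"
begin

text \<open>However the preimages are chosen, monotonicity of \<open>y\<close> makes the result
  monotone and hence Borel. The choice is ambiguous only on nondegenerate levels, which the weight
  \<open>p\<close> does not see.\<close>

definition \<kappa> :: "real \<Rightarrow> real" where "\<kappa> x = (SOME \<xi>. y \<xi> = x)"

lemma y_\<kappa> [simp]: "y (\<kappa> x) = x"
  unfolding \<kappa>_def using y_surj by (rule someI_ex)

lemma \<kappa>_mono: "mono \<kappa>"
proof (rule monoI)
  fix a b :: real assume "a \<le> b"
  then show "\<kappa> a \<le> \<kappa> b"
    using monoD[OF y_mono, of "\<kappa> b" "\<kappa> a"] by (metis antisym linear order_refl y_\<kappa>)
qed

lemma \<kappa>_measurable [measurable]: "\<kappa> \<in> borel_measurable borel"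
  using \<kappa>_mono by (rule borel_measurable_mono)

lemma AE_\<kappa>_y: "AE \<xi> in lborel. p \<xi> = 0 \<or> \<kappa> (y \<xi>) = \<xi>"
  using AE_injective by eventually_elim (metis y_\<kappa>)

text \<open>The density with respect to \<open>dx\<close> of the push-forward of \<open>q d\<xi>\<close> on the set where \<open>p > 0\<close>.\<close>

definition pullback :: "(real \<Rightarrow> real) \<Rightarrow> real \<Rightarrow> real" where
  "pullback q x = q (\<kappa> x) / p (\<kappa> x)"

lemma pullback_measurable [measurable]:
  assumes "q \<in> borel_measurable borel"
  shows "pullback q \<in> borel_measurable borel"
  unfolding pullback_def[abs_def]
  by (intro borel_measurable_divide measurable_compose[OF \<kappa>_measurable] assms p_measurable)

lemma AE_pullback: "AE \<xi> in lborel. p \<xi> = 0 \<or> pullback q (y \<xi>) = q \<xi> / p \<xi>"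
  using AE_\<kappa>_y by eventually_elim (auto simp: pullback_def)

lemma AE_pullback_mult:
  assumes "\<And>\<xi>. p \<xi> = 0 \<Longrightarrow> q \<xi> = 0"
  shows "AE \<xi> in lborel. pullback q (y \<xi>) * p \<xi> = q \<xi>"
  using AE_pullback[of q] by eventually_elim (use assms in auto)

lemma set_integral_pullback:
  assumes [measurable]: "q \<in> borel_measurable borel" "A \<in> sets borel" and z: "\<And>\<xi>. p \<xi> = 0 \<Longrightarrow> q \<xi> = 0"
  shows "set_integrable lborel A (pullback q) \<longleftrightarrow> set_integrable lborel (y -` A) q"
    and "(LINT x:A|lborel. pullback q x) = (LINT \<xi>:y -` A|lborel. q \<xi>)"
proof -
  have m [measurable]: "y -` A \<in> sets borel"
    using measurable_sets[OF y_measurable assms(2)] by simp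
  let ?G = "\<lambda>x. indicator A x *\<^sub>R pullback q x"
  have ae: "AE \<xi> in lborel. ?G (y \<xi>) * p \<xi> = indicator (y -` A) \<xi> *\<^sub>R q \<xi>"
  proof -
    have "AE \<xi> in lborel. pullback q (y \<xi>) * p \<xi> = q \<xi>" using z by (rule AE_pullback_mult)
    then show ?thesis by eventually_elim (auto simp: indicator_def)
  qed
  have G [measurable]: "?G \<in> borel_measurable borel" by simp
  have "integrable lborel ?G \<longleftrightarrow> integrable lborel (\<lambda>\<xi>. ?G (y \<xi>) * p \<xi>)"
    by (simp only: integral_y(1)[OF G])
  also have "\<dots> \<longleftrightarrow> integrable lborel (\<lambda>\<xi>. indicator (y -` A) \<xi> *\<^sub>R q \<xi>)"
    by (rule integrable_cong_AE) (use ae in auto)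
  finally show "set_integrable lborel A (pullback q) \<longleftrightarrow> set_integrable lborel (y -` A) q"
    unfolding set_integrable_def .
  have "integral\<^sup>L lborel ?G = (LINT \<xi>|lborel. ?G (y \<xi>) * p \<xi>)" by (simp only: integral_y(2)[OF G])
  also have "\<dots> = (LINT \<xi>|lborel. indicator (y -` A) \<xi> *\<^sub>R q \<xi>)"
    by (rule integral_cong_AE) (use ae in auto)
  finally show "(LINT x:A|lborel. pullback q x) = (LINT \<xi>:y -` A|lborel. q \<xi>)"
    unfolding set_lebesgue_integral_def .
qed

text \<open>On a flat piece of \<open>y\<close> the function \<open>p\<close> vanishes almost
  everywhere, hence so does \<open>q\<close>, and \<open>U\<close> is constant there. So the
  Eulerian velocity does not depend on the chosen preimage.\<close>

lemma \<kappa>_compose: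
  assumes ac: "ac_deriv U q" and z: "\<And>\<xi>. p \<xi> = 0 \<Longrightarrow> q \<xi> = 0"
  shows "U (\<kappa> (y \<xi>)) = U \<xi>"
proof -
  have "U a = U b" if "y a = y b" "a \<le> b" for a b
  proof -
    have "(LINT x:{a..b}|lborel. q x) = (LINT x::real|lborel. 0)"
      unfolding set_lebesgue_integral_def
    proof (rule integral_cong_AE)
      show "AE x in lborel. indicator {a..b} x *\<^sub>R q x = 0"
        using AE_level_set[of "y a"]
      proof eventually_elim
        fix \<xi> assume *: "y \<xi> = y a \<longrightarrow> p \<xi> = 0"
        show "indicator {a..b} \<xi> *\<^sub>R q \<xi> = 0"
        proof (cases "\<xi> \<in> {a..b}")
          case True
          then have "y \<xi> = y a" using monoD[OF y_mono, of a \<xi>] monoD[OF y_mono, of \<xi> b] that by auto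
          then show ?thesis using * z by auto
        qed auto
      qed
    qed (use ac_derivD(1)[OF ac] in auto)
    then show ?thesis using ac_derivD(3)[OF ac that(2)] by simp
  qed
  from this[of "\<kappa> (y \<xi>)" \<xi>] this[of \<xi> "\<kappa> (y \<xi>)"] show ?thesis by (cases "\<kappa> (y \<xi>) \<le> \<xi>") auto
qed

text \<open>Although \<open>\<kappa>\<close> may jump, \<open>U \<circ> \<kappa>\<close> does not:
  up to points with \<open>p = 0\<close>, and therefore \<open>q = 0\<close>, the preimage of
  \<open>{a..b}\<close> is \<open>{\<kappa> a..\<kappa> b}\<close>.\<close>

lemma ac_deriv_\<kappa>:
  assumes ac: "ac_deriv U q" and z: "\<And>\<xi>. p \<xi> = 0 \<Longrightarrow> q \<xi> = 0"
  shows "ac_deriv (\<lambda>x. U (\<kappa> x)) (pullback q)"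
proof -
  note [measurable] = ac_derivD(1)[OF ac]
  have 1: "set_integrable lborel {a..b} (pullback q)"
    "(LINT x:{a..b}|lborel. pullback q x) = U (\<kappa> b) - U (\<kappa> a)" if ab: "a \<le> b" for a b
  proof -
    have k: "\<kappa> a \<le> \<kappa> b" by (rule monoD[OF \<kappa>_mono ab])
    have ae: "AE \<xi> in lborel. indicator (y -` {a..b}) \<xi> *\<^sub>R q \<xi> = indicator {\<kappa> a..\<kappa> b} \<xi> *\<^sub>R q \<xi>"
      using AE_Icc_level[OF k] by eventually_elim (use z in \<open>auto simp: indicator_def\<close>)
    have m [measurable]: "y -` {a..b} \<in> sets borel"
      using measurable_sets[OF y_measurable, of "{a..b}"] by simp
    have "set_integrable lborel (y -` {a..b}) q \<longleftrightarrow> set_integrable lborel {\<kappa> a..\<kappa> b} q"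
      unfolding set_integrable_def by (rule integrable_cong_AE) (use ae in auto)
    then show "set_integrable lborel {a..b} (pullback q)"
      using set_integral_pullback(1)[of q "{a..b}"] z ac_derivD(2)[OF ac] by simp
    have "(LINT \<xi>:y -` {a..b}|lborel. q \<xi>) = (LINT \<xi>:{\<kappa> a..\<kappa> b}|lborel. q \<xi>)"
      unfolding set_lebesgue_integral_def by (rule integral_cong_AE) (use ae in auto)
    then show "(LINT x:{a..b}|lborel. pullback q x) = U (\<kappa> b) - U (\<kappa> a)"
      using set_integral_pullback(2)[of q "{a..b}"] z ac_derivD(3)[OF ac k] by simp
  qed
  have "set_integrable lborel {a..b} (pullback q)" for a b
    using 1(1)[of a b] by (cases "a \<le> b") (auto simp: set_integrable_def)
  then show ?thesis using 1 unfolding ac_deriv_def by auto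
qed

text \<open>
  The set \<open>vacuum\<close> carries the singular part of the push-forward of \<open>h d\<xi>\<close>; the images of
  rational points account for the nondegenerate level sets of \<open>y\<close>.
\<close>

definition vacuum :: "real set" where
  "vacuum = {x. p (\<kappa> x) = 0} \<union> y ` \<rat>"

lemma vacuum_measurable [measurable]: "vacuum \<in> sets borel"
proof -
  have "countable (y ` \<rat>)" by (intro countable_image countable_rat)
  then have "y ` \<rat> \<in> sets borel" by (rule sets.countable[rotated]) auto
  moreover have "{x. p (\<kappa> x) = 0} \<in> sets borel" by measurable
  ultimately show ?thesis unfolding vacuum_def by blast
qed

text \<open>Its Lebesgue measure is an integral of \<open>p\<close> over points whose chosen
  preimage has \<open>p = 0\<close>; almost every point with \<open>p\<close> nonzero is its own
  chosen preimage, so the integrand vanishes. The rational levels are countable.\<close>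

lemma vacuum_null: "vacuum \<in> null_sets lborel"
proof -
  have "countable (y ` \<rat>)" by (intro countable_image countable_rat)
  then have 1: "y ` \<rat> \<in> null_sets lborel" by (rule countable_imp_null_set_lborel)
  have [measurable]: "{x. p (\<kappa> x) = 0} \<in> sets borel" by measurable
  have "emeasure lborel {x. p (\<kappa> x) = 0} = (\<integral>\<^sup>+\<xi>. ennreal (p \<xi>) * indicator {x. p (\<kappa> x) = 0} (y \<xi>) \<partial>lborel)"
    using nn_integral_y[of "indicator {x. p (\<kappa> x) = 0}"] by simp
  also have "\<dots> = 0"
    by (subst nn_integral_0_iff_AE) (use AE_\<kappa>_y in \<open>auto elim!: eventually_mono simp: indicator_def\<close>)
  finally have "{x. p (\<kappa> x) = 0} \<in> null_sets lborel" by (auto simp: null_sets_def)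
  then show ?thesis unfolding vacuum_def using 1 by blast
qed

text \<open>Holds at every point: either \<open>\<xi>\<close> is the chosen preimage of
  \<open>y \<xi>\<close>, or \<open>y\<close> is constant between the two and takes the same value
  at a rational.\<close>

lemma vacuum_y: "p \<xi> = 0 \<Longrightarrow> y \<xi> \<in> vacuum"
proof (cases "\<kappa> (y \<xi>) = \<xi>")
  case True
  then show "p \<xi> = 0 \<Longrightarrow> y \<xi> \<in> vacuum" by (simp add: vacuum_def)
next
  case False
  let ?\<eta> = "\<kappa> (y \<xi>)"
  have "min ?\<eta> \<xi> < max ?\<eta> \<xi>" using False by auto
  then obtain s where s: "s \<in> \<rat>" "min ?\<eta> \<xi> < s" "s < max ?\<eta> \<xi>"
    using Rats_dense_in_real by blast
  have "y s = y \<xi>"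
    using monoD[OF y_mono, of "min ?\<eta> \<xi>" s] monoD[OF y_mono, of s "max ?\<eta> \<xi>"] s
    by (auto simp: min_def max_def split: if_splits)
  then show "y \<xi> \<in> vacuum" using s(1) unfolding vacuum_def by (metis UnI2 imageI)
qed

end

section \<open>From Lagrangian to Eulerian coordinates\<close>

lemma pushforward_eq_distr_density:
  assumes [measurable]: "y \<in> borel_measurable borel" "f \<in> borel_measurable borel"
    and F: "F \<in> borel_measurable lebesgue" and ae: "AE x in lebesgue. F x = f x"
  shows "pushforward y F = distr (density lborel (\<lambda>\<xi>. ennreal (f \<xi>))) borel y"
proof (rule measure_eqI)
  show "sets (pushforward y F) = sets (distr (density lborel (\<lambda>\<xi>. ennreal (f \<xi>))) borel y)"
    by (simp add: pushforward_def)
  fix A assume "A \<in> sets (pushforward y F)"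
  then have A [measurable]: "A \<in> sets borel" by (simp add: pushforward_def)
  have yl: "y \<in> measurable (density lebesgue (\<lambda>\<xi>. ennreal (F \<xi>))) borel"
    using measurable_completion[of y lborel borel] by simp
  have Al: "y -` A \<in> sets lebesgue" and Ab [measurable]: "y -` A \<in> sets borel"
    using measurable_sets[of y lborel borel A] by auto
  have "emeasure (pushforward y F) A = (\<integral>\<^sup>+\<xi>. ennreal (F \<xi>) * indicator (y -` A) \<xi> \<partial>lebesgue)"
    unfolding pushforward_def using yl Al F by (simp add: emeasure_distr emeasure_density)
  also have "\<dots> = (\<integral>\<^sup>+\<xi>. ennreal (f \<xi>) * indicator (y -` A) \<xi> \<partial>lebesgue)"
    by (rule nn_integral_cong_AE) (use ae in \<open>auto elim!: eventually_mono\<close>)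
  also have "\<dots> = (\<integral>\<^sup>+\<xi>. ennreal (f \<xi>) * indicator (y -` A) \<xi> \<partial>lborel)"
    by (rule nn_integral_completion)
  also have "\<dots> = emeasure (distr (density lborel (\<lambda>\<xi>. ennreal (f \<xi>))) borel y) A"
    by (simp add: emeasure_distr emeasure_density)
  finally show "emeasure (pushforward y F) A = emeasure (distr (density lborel (\<lambda>\<xi>. ennreal (f \<xi>))) borel y) A" .
qed

lemma measurable_lebesgueI:
  fixes f :: "real \<Rightarrow> real"
  assumes "f \<in> borel_measurable borel"
  shows "f \<in> borel_measurable lebesgue"
  using measurable_completion[of f lborel borel] assms by simp

text \<open>Both densities have the same integrals over compact intervals. This controls the
  arbitrary choice of \<open>\<rho>\<close> in \<open>M_map\<close>.\<close>

lemma pushforward_density_unique: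
  assumes "is_pushforward_density y r \<rho>1" "is_pushforward_density y r \<rho>2"
  shows "AE x in lebesgue. \<rho>1 x = \<rho>2 x"
proof -
  have l: "locally_integrable \<rho>1" "locally_integrable \<rho>2"
    using assms by (auto simp: is_pushforward_density_def)
  then have li: "locally_integrable (\<lambda>x. \<rho>1 x - \<rho>2 x)"
    unfolding locally_integrable_def by (auto intro: set_integral_diff)
  obtain w where w [measurable]: "w \<in> borel_measurable borel"
    and ae: "AE x in lebesgue. \<rho>1 x - \<rho>2 x = w x"
    by (rule lebesgue_Borel_representative[OF locally_integrable_measurable[OF li]])
  have liw: "locally_integrable w"
    by (rule locally_integrable_AE_cong[OF li measurable_lebesgueI[OF w] ae])
  have "AE x in lborel. w x = 0"
  proof (rule AE_zero_if_Icc_integrals_zero[OF w])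
    show "set_integrable lborel {a..b} w" for a b
      using liw set_integrable_lebesgue_iff[OF w] unfolding locally_integrable_def by blast
    fix a b :: real
    have m: "(\<lambda>x. indicator {a..b} x *\<^sub>R (\<rho>1 x - \<rho>2 x)) \<in> borel_measurable lebesgue"
      using li unfolding locally_integrable_def set_integrable_def by blast
    have mb: "(\<lambda>x. indicator {a..b} x *\<^sub>R w x) \<in> borel_measurable borel" by simp
    have "(LINT x:{a..b}|lborel. w x) = (LINT x:{a..b}|lebesgue. w x)"
      unfolding set_lebesgue_integral_def using mb by (subst integral_completion) auto
    also have "\<dots> = (LINT x:{a..b}|lebesgue. \<rho>1 x - \<rho>2 x)"
      unfolding set_lebesgue_integral_def
      by (rule integral_cong_AE) (use ae m measurable_lebesgueI[OF mb] in \<open>auto elim!: eventually_mono\<close>)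
    also have "\<dots> = (LINT x:{a..b}|lebesgue. \<rho>1 x) - (LINT x:{a..b}|lebesgue. \<rho>2 x)"
      using l unfolding locally_integrable_def by (intro set_integral_diff) auto
    also have "\<dots> = 0" using assms unfolding is_pushforward_density_def by auto
    finally show "(LINT x:{a..b}|lborel. w x) = 0" .
  qed
  then have "AE x in lebesgue. w x = 0" by (rule AE_completion)
  then show ?thesis using ae by eventually_elim simp
qed

text \<open>Here \<open>p\<close>, \<open>q\<close>, \<open>h\<close> and \<open>s\<close> are Borel
  representatives of the derivatives of \<open>y\<close>, \<open>U\<close>, \<open>H\<close> and of
  \<open>r\<close>, for which the relations hold everywhere and not just almost everywhere. One
  crude constant \<open>K\<close> serves for all bounds, so that the flow preserves the locale with
  a larger constant; \<open>m\<close> is the total energy.\<close>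

locale lagrangian =
  fixes y U H p q h s :: "real \<Rightarrow> real" and K m :: real
  assumes ac_y: "ac_deriv y p" and ac_U: "ac_deriv U q" and ac_H: "ac_deriv H h"
    and s_measurable [measurable]: "s \<in> borel_measurable borel"
    and p_ge: "\<And>\<xi>. 0 \<le> p \<xi>" and h_ge: "\<And>\<xi>. 0 \<le> h \<xi>"
    and energy: "\<And>\<xi>. p \<xi> * h \<xi> = (q \<xi>)\<^sup>2 + (s \<xi>)\<^sup>2"
    and p_le: "\<And>\<xi>. p \<xi> \<le> K" and h_le: "\<And>\<xi>. h \<xi> \<le> K"
    and y_bound: "\<And>\<xi>. \<bar>y \<xi> - \<xi>\<bar> \<le> K" and U_bound: "\<And>\<xi>. \<bar>U \<xi>\<bar> \<le> K"
    and H_bot: "(H \<longlongrightarrow> 0) at_bot" and H_top: "(H \<longlongrightarrow> m) at_top"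

sublocale lagrangian \<subseteq> surj_transport y p
proof (intro surj_transport.intro surj_transport_axioms.intro)
  show "lebesgue_transport y p" by (rule lebesgue_transportI[OF ac_y p_ge y_bound])
  show "\<exists>\<xi>. y \<xi> = x" for x by (rule unbounded_surj[OF ac_deriv_continuous[OF ac_y] y_bound])
qed

context lagrangian
begin

lemma h_measurable [measurable]: "h \<in> borel_measurable borel"
  using ac_derivD(1)[OF ac_H] .

lemma q_measurable [measurable]: "q \<in> borel_measurable borel"
  using ac_derivD(1)[OF ac_U] .

lemma U_measurable [measurable]: "U \<in> borel_measurable borel"
  using ac_deriv_measurable[OF ac_U] .

lemma q_s_zero: "p \<xi> = 0 \<Longrightarrow> q \<xi> = 0" "p \<xi> = 0 \<Longrightarrow> s \<xi> = 0"
  using energy[of \<xi>] by (auto simp: add_nonneg_eq_0_iff)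

text \<open>By the energy relation \<open>\<bar>q\<bar>\<close> and \<open>\<bar>s\<bar>\<close> are
  at most the geometric mean of \<open>p\<close> and \<open>h\<close>.\<close>

lemma q_s_le: "\<bar>q \<xi>\<bar> \<le> K" "\<bar>s \<xi>\<bar> \<le> K"
proof -
  have "K \<ge> 0" using p_ge[of 0] p_le[of 0] by linarith
  then have "p \<xi> * h \<xi> \<le> K * K" by (intro mult_mono p_le h_le h_ge)
  then have "(q \<xi>)\<^sup>2 \<le> K\<^sup>2" "(s \<xi>)\<^sup>2 \<le> K\<^sup>2"
    using energy[of \<xi>] zero_le_power2[of "q \<xi>"] zero_le_power2[of "s \<xi>"]
    unfolding power2_eq_square[of K] by linarith+
  then show "\<bar>q \<xi>\<bar> \<le> K" "\<bar>s \<xi>\<bar> \<le> K"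
    using \<open>K \<ge> 0\<close> by (auto intro: power2_le_imp_le)
qed

lemma h_integral_Iic: "integrable lborel (\<lambda>x. h x * indicator {..\<xi>} x)"
  "(LINT x|lborel. h x * indicator {..\<xi>} x) = H \<xi>"
proof -
  let ?f = "\<lambda>n x. h x * indicator {\<xi> - real n..\<xi>} x"
  have i: "integrable lborel (?f n)" for n
    using ac_derivD(2)[OF ac_H, of "\<xi> - real n" \<xi>] unfolding set_integrable_def by (simp add: mult.commute)
  have v: "integral\<^sup>L lborel (?f n) = H \<xi> - H (\<xi> - real n)" for n
    using ac_derivD(3)[OF ac_H, of "\<xi> - real n" \<xi>] unfolding set_lebesgue_integral_def by (simp add: mult.commute)
  have "filterlim (\<lambda>n. \<xi> - real n) at_bot sequentially"
    unfolding filterlim_at_bot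
  proof
    fix Z
    obtain N where "\<xi> - Z < real N" using reals_Archimedean2 by blast
    then show "\<forall>\<^sub>F n in sequentially. \<xi> - real n \<le> Z"
      by (intro eventually_sequentiallyI[of N]) auto
  qed
  then have "(\<lambda>n. H (\<xi> - real n)) \<longlonglongrightarrow> 0" by (rule filterlim_compose[OF H_bot])
  then have lim: "(\<lambda>n. integral\<^sup>L lborel (?f n)) \<longlonglongrightarrow> H \<xi>"
    unfolding v using tendsto_diff[OF tendsto_const[of "H \<xi>"]] by fastforce
  have mono: "AE x in lborel. mono (\<lambda>n. ?f n x)"
    using h_ge by (auto intro!: AE_I2 monoI mult_left_mono simp: indicator_def)
  have pt: "AE x in lborel. (\<lambda>n. ?f n x) \<longlonglongrightarrow> h x * indicator {..\<xi>} x"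
  proof (intro AE_I2 tendsto_eventually)
    fix x
    obtain N where "\<xi> - x < real N" using reals_Archimedean2 by blast
    then show "\<forall>\<^sub>F n in sequentially. ?f n x = h x * indicator {..\<xi>} x"
      by (intro eventually_sequentiallyI[of N]) (auto simp: indicator_def)
  qed
  show "integrable lborel (\<lambda>x. h x * indicator {..\<xi>} x)" "(LINT x|lborel. h x * indicator {..\<xi>} x) = H \<xi>"
    using integrable_monotone_convergence[OF i mono pt lim] integral_monotone_convergence[OF i mono pt lim] by auto
qed

lemma h_integral: "integrable lborel h" "integral\<^sup>L lborel h = m"
proof -
  let ?f = "\<lambda>n x. h x * indicator {..real n} x"
  have lim: "(\<lambda>n. integral\<^sup>L lborel (?f n)) \<longlonglongrightarrow> m"
    unfolding h_integral_Iic(2) by (rule filterlim_compose[OF H_top filterlim_real_sequentially])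
  have mono: "AE x in lborel. mono (\<lambda>n. ?f n x)"
    using h_ge by (auto intro!: AE_I2 monoI mult_left_mono simp: indicator_def)
  have pt: "AE x in lborel. (\<lambda>n. ?f n x) \<longlonglongrightarrow> h x"
  proof (intro AE_I2 tendsto_eventually)
    fix x
    obtain N where "x < real N" using reals_Archimedean2 by blast
    then show "\<forall>\<^sub>F n in sequentially. ?f n x = h x"
      by (intro eventually_sequentiallyI[of N]) (auto simp: indicator_def)
  qed
  show "integrable lborel h" "integral\<^sup>L lborel h = m"
    using integrable_monotone_convergence[OF h_integral_Iic(1) mono pt lim]
      integral_monotone_convergence[OF h_integral_Iic(1) mono pt lim] by auto
qed

definition \<mu> :: "real measure" where
  "\<mu> = distr (density lborel (\<lambda>\<xi>. ennreal (h \<xi>))) borel y"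

lemma sets_\<mu> [simp, measurable_cong]: "sets \<mu> = sets borel"
  by (simp add: \<mu>_def)

lemma space_\<mu> [simp]: "space \<mu> = UNIV"
  by (simp add: \<mu>_def)

lemma integral_\<mu>:
  fixes G :: "real \<Rightarrow> real"
  assumes [measurable]: "G \<in> borel_measurable borel"
  shows "integrable \<mu> G \<longleftrightarrow> integrable lborel (\<lambda>\<xi>. h \<xi> * G (y \<xi>))"
    and "(LINT x|\<mu>. G x) = (LINT \<xi>|lborel. h \<xi> * G (y \<xi>))"
proof -
  have "integrable \<mu> G \<longleftrightarrow> integrable (density lborel (\<lambda>\<xi>. ennreal (h \<xi>))) (\<lambda>\<xi>. G (y \<xi>))"
    unfolding \<mu>_def by (rule integrable_distr_eq) auto
  also have "\<dots> \<longleftrightarrow> integrable lborel (\<lambda>\<xi>. h \<xi> *\<^sub>R G (y \<xi>))"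
    by (rule integrable_density) (auto simp: h_ge)
  finally show "integrable \<mu> G \<longleftrightarrow> integrable lborel (\<lambda>\<xi>. h \<xi> * G (y \<xi>))" by simp
  have "(LINT x|\<mu>. G x) = (LINT \<xi>|density lborel (\<lambda>\<xi>. ennreal (h \<xi>)). G (y \<xi>))"
    unfolding \<mu>_def by (rule integral_distr) auto
  also have "\<dots> = (LINT \<xi>|lborel. h \<xi> *\<^sub>R G (y \<xi>))"
    by (rule integral_density) (auto simp: h_ge)
  finally show "(LINT x|\<mu>. G x) = (LINT \<xi>|lborel. h \<xi> * G (y \<xi>))" by simp
qed

lemma finite_measure_\<mu>: "finite_measure \<mu>"
proof
  have "emeasure \<mu> UNIV = (\<integral>\<^sup>+\<xi>. ennreal (h \<xi>) \<partial>lborel)"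
    by (simp add: \<mu>_def emeasure_distr emeasure_density)
  also have "\<dots> = ennreal m"
    using h_integral h_ge by (simp add: nn_integral_eq_integral)
  finally show "emeasure \<mu> (space \<mu>) \<noteq> \<infinity>" by simp
qed

lemma measure_\<mu>:
  assumes [measurable]: "A \<in> sets borel"
  shows "measure \<mu> A = (LINT \<xi>|lborel. h \<xi> * indicator A (y \<xi>))"
  using integral_\<mu>(2)[of "indicator A"] by simp

lemma measure_\<mu>_UNIV: "measure \<mu> UNIV = m"
  using measure_\<mu>[of UNIV] h_integral by simp

text \<open>If \<open>\<xi>\<close> is the only point of its level, the preimages of the half lines
  at \<open>y \<xi>\<close> are the half lines at \<open>\<xi>\<close>. On a flat piece
  \<open>\<mu>\<close> may have an atom and the formulas may fail, but there \<open>p\<close>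
  vanishes almost everywhere.\<close>

lemma AE_measure_\<mu>_half_lines:
  "AE \<xi> in lborel. p \<xi> = 0 \<or> (measure \<mu> {..<y \<xi>} = H \<xi> \<and> measure \<mu> {y \<xi><..} = m - H \<xi>)"
  using AE_injective
proof eventually_elim
  fix \<xi> assume *: "p \<xi> = 0 \<or> (\<forall>\<eta>. y \<eta> = y \<xi> \<longrightarrow> \<eta> = \<xi>)"
  have "measure \<mu> {..<y \<xi>} = H \<xi> \<and> measure \<mu> {y \<xi><..} = m - H \<xi>" if inj: "\<forall>\<eta>. y \<eta> = y \<xi> \<longrightarrow> \<eta> = \<xi>"
  proof -
    have lt: "y \<eta> < y \<xi> \<longleftrightarrow> \<eta> < \<xi>" "y \<eta> > y \<xi> \<longleftrightarrow> \<eta> > \<xi>" for \<eta>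
      using monoD[OF y_mono, of \<eta> \<xi>] monoD[OF y_mono, of \<xi> \<eta>] inj[rule_format, of \<eta>]
      by (cases \<eta> \<xi> rule: linorder_cases; fastforce)+
    have "measure \<mu> {..<y \<xi>} = (LINT \<eta>|lborel. h \<eta> * indicator {..\<xi>} \<eta>)"
      unfolding measure_\<mu>[OF lessThan_borel]
    proof (rule integral_cong_AE)
      show "AE \<eta> in lborel. h \<eta> * indicator {..<y \<xi>} (y \<eta>) = h \<eta> * indicator {..\<xi>} \<eta>"
        using AE_lborel_singleton[of \<xi>] by eventually_elim (use lt in \<open>auto simp: indicator_def\<close>)
    qed auto
    moreover have "measure \<mu> {y \<xi><..} = (LINT \<eta>|lborel. h \<eta> - h \<eta> * indicator {..\<xi>} \<eta>)"
      unfolding measure_\<mu>[OF greaterThan_borel]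
      by (rule Bochner_Integration.integral_cong) (use lt in \<open>auto simp: indicator_def\<close>)
    ultimately show ?thesis using h_integral h_integral_Iic by simp
  qed
  then show "p \<xi> = 0 \<or> (measure \<mu> {..<y \<xi>} = H \<xi> \<and> measure \<mu> {y \<xi><..} = m - H \<xi>)" using * by blast
qed

definition u :: "real \<Rightarrow> real" where "u x = U (\<kappa> x)"

lemma u_y [simp]: "u (y \<xi>) = U \<xi>"
  unfolding u_def using q_s_zero(1) by (rule \<kappa>_compose[OF ac_U])

lemma ac_u: "ac_deriv u (pullback q)"
  unfolding u_def[abs_def] using q_s_zero(1) by (rule ac_deriv_\<kappa>[OF ac_U])

lemma u_measurable [measurable]: "u \<in> borel_measurable borel"
  by (rule ac_deriv_measurable[OF ac_u])

lemma u_bound: "\<bar>u x\<bar> \<le> K"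
  using U_bound by (simp add: u_def)

lemma THE_u: "(THE v. \<forall>\<xi>. y \<xi> = x \<longrightarrow> U \<xi> = v) = u x"
proof (rule the_equality)
  show "\<forall>\<xi>. y \<xi> = x \<longrightarrow> U \<xi> = u x" using u_y by metis
  show "v = u x" if "\<forall>\<xi>. y \<xi> = x \<longrightarrow> U \<xi> = v" for v
    using that[rule_format, of "\<kappa> x"] by (simp add: u_def)
qed

lemma locally_integrable_pullback_s: "locally_integrable (pullback s)"
proof -
  have "set_integrable lborel {a..b} s" for a b
    unfolding set_integrable_def
  proof (rule Bochner_Integration.integrable_bound)
    show "integrable lborel (\<lambda>x. indicator {a..b} x * K)"
      using borel_integrable_atLeastAtMost'[of a b "\<lambda>x. K"] by (simp add: set_integrable_def)
    show "AE x in lborel. norm (indicator {a..b} x *\<^sub>R s x) \<le> norm (indicator {a..b} x * K)"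
      using q_s_le(2) by (auto intro!: AE_I2 simp: indicator_def intro: order_trans[OF _ abs_ge_self])
  qed auto
  \<comment> \<open>\<open>F\<close> has no meaning of its own: it lets
    \<open>ac_deriv_\<kappa>\<close> be applied with \<open>s\<close> in the place of
    \<open>q\<close>.\<close>
  then obtain F where "ac_deriv F s" using ac_deriv_primitive[OF s_measurable] by blast
  then show ?thesis
    using ac_deriv_imp_locally_integrable(2)[OF ac_deriv_\<kappa>] q_s_zero(2) by blast
qed

lemma is_pushforward_density_pullback:
  assumes r: "r \<in> borel_measurable lebesgue" "AE \<xi> in lebesgue. r \<xi> = s \<xi>"
  shows "is_pushforward_density y r (pullback s)"
  unfolding is_pushforward_density_def
proof (intro conjI ballI impI locally_integrable_pullback_s)
  fix A :: "real set" assume A [measurable]: "A \<in> sets borel"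
  have m [measurable]: "y -` A \<in> sets borel"
    using measurable_sets[OF y_measurable A] by simp
  have "(LINT x:A|lebesgue. pullback s x) = (LINT x:A|lborel. pullback s x)"
    unfolding set_lebesgue_integral_def by (rule integral_completion) simp
  also have "\<dots> = (LINT \<xi>:y -` A|lborel. s \<xi>)"
    using q_s_zero(2) by (intro set_integral_pullback) auto
  also have "\<dots> = (LINT \<xi>:y -` A|lebesgue. s \<xi>)"
    unfolding set_lebesgue_integral_def by (rule integral_completion[symmetric]) simp
  also have "\<dots> = (LINT \<xi>:y -` A|lebesgue. r \<xi>)"
    unfolding set_lebesgue_integral_def
  proof (rule integral_cong_AE)
    show "(\<lambda>\<xi>. indicator (y -` A) \<xi> *\<^sub>R s \<xi>) \<in> borel_measurable lebesgue"
      by (rule measurable_lebesgueI) simp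
    show "(\<lambda>\<xi>. indicator (y -` A) \<xi> *\<^sub>R r \<xi>) \<in> borel_measurable lebesgue"
      using m r(1) by (intro borel_measurable_scaleR borel_measurable_indicator) auto
    show "AE \<xi> in lebesgue. indicator (y -` A) \<xi> *\<^sub>R s \<xi> = indicator (y -` A) \<xi> *\<^sub>R r \<xi>"
      using r(2) by eventually_elim simp
  qed
  finally show "(LINT x:A|lebesgue. pullback s x) = (LINT \<xi>:y -` A|lebesgue. r \<xi>)" .
qed

text \<open>Where \<open>p\<close> is nonzero, \<open>((q/p)^2 + (s/p)^2) p = p h / p = h\<close> by
  the energy relation; elsewhere both sides are 0.\<close>

lemma AE_energy_density:
  "AE \<xi> in lborel. ((pullback q (y \<xi>))\<^sup>2 + (pullback s (y \<xi>))\<^sup>2) * p \<xi> = h \<xi> * indicator {\<xi>. p \<xi> \<noteq> 0} \<xi>"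
  using AE_pullback[of q] AE_pullback[of s]
proof eventually_elim
  fix \<xi> assume *: "p \<xi> = 0 \<or> pullback q (y \<xi>) = q \<xi> / p \<xi>" "p \<xi> = 0 \<or> pullback s (y \<xi>) = s \<xi> / p \<xi>"
  show "((pullback q (y \<xi>))\<^sup>2 + (pullback s (y \<xi>))\<^sup>2) * p \<xi> = h \<xi> * indicator {\<xi>. p \<xi> \<noteq> 0} \<xi>"
  proof (cases "p \<xi> = 0")
    case False
    then have "((pullback q (y \<xi>))\<^sup>2 + (pullback s (y \<xi>))\<^sup>2) * p \<xi> = ((q \<xi>)\<^sup>2 + (s \<xi>)\<^sup>2) / p \<xi>"
      using * by (simp add: power_divide add_divide_distrib[symmetric] power2_eq_square[of "p \<xi>"])
    then show ?thesis using False by (simp add: energy[symmetric])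
  qed auto
qed

lemma integrable_energy_density: "integrable lborel (\<lambda>x. (pullback q x)\<^sup>2 + (pullback s x)\<^sup>2)"
proof -
  have [measurable]: "{\<xi>. p \<xi> \<noteq> 0} \<in> sets borel" by measurable
  have "integrable lborel (\<lambda>\<xi>. h \<xi> * indicator {\<xi>. p \<xi> \<noteq> 0} \<xi>)"
    using h_integral(1) by (intro integrable_real_mult_indicator) auto
  then have "integrable lborel (\<lambda>\<xi>. ((pullback q (y \<xi>))\<^sup>2 + (pullback s (y \<xi>))\<^sup>2) * p \<xi>)"
    by (rule integrable_cong_AE_imp) (use AE_energy_density in \<open>auto elim!: eventually_mono\<close>)
  then show ?thesis using integral_y(1)[of "\<lambda>x. (pullback q x)\<^sup>2 + (pullback s x)\<^sup>2"] by simp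
qed

lemma is_ac_part_\<mu>:
  "is_ac_part \<mu> (density lborel (\<lambda>x. ennreal ((pullback q x)\<^sup>2 + (pullback s x)\<^sup>2)))"
proof -
  define e where "e = (\<lambda>x. (pullback q x)\<^sup>2 + (pullback s x)\<^sup>2)"
  define Z where "Z = {\<xi>. p \<xi> = 0}"
  define \<sigma> where "\<sigma> = distr (density lborel (\<lambda>\<xi>. ennreal (h \<xi>) * indicator Z \<xi>)) borel y"
  have [measurable]: "e \<in> borel_measurable borel" unfolding e_def by measurable
  have [measurable]: "Z \<in> sets borel" unfolding Z_def by measurable
  have s\<sigma>: "emeasure \<sigma> A = (\<integral>\<^sup>+\<xi>. ennreal (h \<xi>) * indicator Z \<xi> * indicator A (y \<xi>) \<partial>lborel)"
    if [measurable]: "A \<in> sets borel" for A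
  proof -
    have [measurable]: "y -` A \<in> sets borel" using measurable_sets[OF y_measurable that] by simp
    show ?thesis unfolding \<sigma>_def
      by (simp add: emeasure_distr emeasure_density indicator_vimage[abs_def] comp_def)
  qed
  have s\<mu>: "emeasure \<mu> A = (\<integral>\<^sup>+\<xi>. ennreal (h \<xi>) * indicator A (y \<xi>) \<partial>lborel)"
    if [measurable]: "A \<in> sets borel" for A
  proof -
    have [measurable]: "y -` A \<in> sets borel" using measurable_sets[OF y_measurable that] by simp
    show ?thesis unfolding \<mu>_def
      by (simp add: emeasure_distr emeasure_density indicator_vimage[abs_def] comp_def)
  qed
  \<comment> \<open>Every point with \<open>p = 0\<close> is mapped into \<open>vacuum\<close>, so
    the integrand is 0 everywhere, without exceptional sets.\<close>
  have "emeasure \<sigma> (- vacuum) = (\<integral>\<^sup>+\<xi>. (0::ennreal) \<partial>(lborel :: real measure))"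
    unfolding s\<sigma>[OF borel_comp[OF vacuum_measurable]]
    by (rule nn_integral_cong) (use vacuum_y in \<open>auto simp: Z_def indicator_def\<close>)
  then have 1: "emeasure \<sigma> (- vacuum) = 0" by simp
  have 2: "emeasure \<mu> A = emeasure (density lborel (\<lambda>x. ennreal (e x))) A + emeasure \<sigma> A"
    if A [measurable]: "A \<in> sets borel" for A
  proof -
    have "emeasure (density lborel (\<lambda>x. ennreal (e x))) A = (\<integral>\<^sup>+x. ennreal (e x) * indicator A x \<partial>lborel)"
      by (simp add: emeasure_density)
    also have "\<dots> = (\<integral>\<^sup>+\<xi>. ennreal (p \<xi>) * (ennreal (e (y \<xi>)) * indicator A (y \<xi>)) \<partial>lborel)"
      using nn_integral_y[of "\<lambda>x. ennreal (e x) * indicator A x"] by simp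
    also have "\<dots> = (\<integral>\<^sup>+\<xi>. ennreal (h \<xi>) * indicator (- Z) \<xi> * indicator A (y \<xi>) \<partial>lborel)"
    proof (rule nn_integral_cong_AE)
      show "AE \<xi> in lborel. ennreal (p \<xi>) * (ennreal (e (y \<xi>)) * indicator A (y \<xi>)) =
          ennreal (h \<xi>) * indicator (- Z) \<xi> * indicator A (y \<xi>)"
        using AE_energy_density
      proof eventually_elim
        fix \<xi> assume *: "((pullback q (y \<xi>))\<^sup>2 + (pullback s (y \<xi>))\<^sup>2) * p \<xi> = h \<xi> * indicator {\<xi>. p \<xi> \<noteq> 0} \<xi>"
        have "ennreal (p \<xi>) * ennreal (e (y \<xi>)) = ennreal (h \<xi> * indicator {\<xi>. p \<xi> \<noteq> 0} \<xi>)"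
          using * p_ge[of \<xi>] by (subst ennreal_mult[symmetric]) (auto simp: e_def mult.commute)
        also have "\<dots> = ennreal (h \<xi>) * indicator (- Z) \<xi>" by (auto simp: Z_def indicator_def)
        finally show "ennreal (p \<xi>) * (ennreal (e (y \<xi>)) * indicator A (y \<xi>)) =
          ennreal (h \<xi>) * indicator (- Z) \<xi> * indicator A (y \<xi>)"
          by (simp add: mult.assoc[symmetric])
      qed
    qed
    finally have "emeasure (density lborel (\<lambda>x. ennreal (e x))) A + emeasure \<sigma> A =
      (\<integral>\<^sup>+\<xi>. ennreal (h \<xi>) * indicator (- Z) \<xi> * indicator A (y \<xi>) +
         ennreal (h \<xi>) * indicator Z \<xi> * indicator A (y \<xi>) \<partial>lborel)"
      unfolding s\<sigma>[OF A] by (subst nn_integral_add) auto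
    also have "\<dots> = emeasure \<mu> A"
      unfolding s\<mu>[OF A] by (rule nn_integral_cong) (auto simp: indicator_def)
    finally show ?thesis by simp
  qed
  have 3: "absolutely_continuous lborel (density lborel (\<lambda>x. ennreal (e x)))"
    by (rule absolutely_continuousI_density) simp
  have "sets \<sigma> = sets borel" by (simp add: \<sigma>_def)
  then have "\<exists>\<sigma> N. sets \<sigma> = sets borel \<and> N \<in> null_sets lborel \<and> emeasure \<sigma> (- N) = 0 \<and>
        (\<forall>A\<in>sets borel. emeasure \<mu> A = emeasure (density lborel (\<lambda>x. ennreal (e x))) A + emeasure \<sigma> A)"
    using 1 2 vacuum_null by (intro exI[of _ \<sigma>] exI[of _ vacuum]) auto
  then show ?thesis using 3 unfolding is_ac_part_def e_def by simp
qed

text \<open>The density is obtained rather than named: \<open>M_map\<close> picks an unknown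
  representative, of which only measurability and the values up to a null set are available.\<close>

lemma M_map_lagrangian:
  assumes r: "r \<in> borel_measurable lebesgue" "AE \<xi> in lebesgue. r \<xi> = s \<xi>"
  obtains \<rho> where "M_map (y, U, H, r) = (u, \<rho>, \<mu>)" "(u, \<rho>, \<mu>) \<in> D_set"
    "\<rho> \<in> borel_measurable lebesgue" "AE x in lebesgue. \<rho> x = pullback s x"
proof -
  define \<rho> where "\<rho> = (SOME \<rho>. is_pushforward_density y r \<rho>)"
  have pd: "is_pushforward_density y r (pullback s)" by (rule is_pushforward_density_pullback[OF r])
  have pd': "is_pushforward_density y r \<rho>" unfolding \<rho>_def by (rule someI[of "is_pushforward_density y r", OF pd])
  have ae: "AE x in lebesgue. \<rho> x = pullback s x" by (rule pushforward_density_unique[OF pd' pd])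
  have \<rho>m: "\<rho> \<in> borel_measurable lebesgue"
    using pd' locally_integrable_measurable by (simp add: is_pushforward_density_def)
  have wH: "has_weak_deriv H (wderiv H)" "AE x in lebesgue. wderiv H x = h x"
    using wderiv_AE_eq[OF ac_deriv_imp_weak_deriv[OF ac_H]] by auto
  have wu: "has_weak_deriv u (pullback q)" "has_weak_deriv u (wderiv u)" "AE x in lebesgue. wderiv u x = pullback q x"
    using wderiv_AE_eq[OF ac_deriv_imp_weak_deriv[OF ac_u]] ac_deriv_imp_weak_deriv[OF ac_u] by auto
  have wm: "wderiv H \<in> borel_measurable lebesgue" "wderiv u \<in> borel_measurable lebesgue"
    using wH(1) wu(2) by (auto simp: has_weak_deriv_def intro: locally_integrable_measurable)
  have "pushforward y (wderiv H) = \<mu>"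
    unfolding \<mu>_def by (rule pushforward_eq_distr_density[OF y_measurable h_measurable wm(1) wH(2)])
  then have M: "M_map (y, U, H, r) = (u, \<rho>, \<mu>)"
    unfolding M_map_def by (simp add: THE_u \<rho>_def)
  have "pushforward (\<lambda>x. x) (\<lambda>x. (wderiv u x)\<^sup>2 + (\<rho> x)\<^sup>2) =
      distr (density lborel (\<lambda>x. ennreal ((pullback q x)\<^sup>2 + (pullback s x)\<^sup>2))) borel (\<lambda>x. x)"
  proof (rule pushforward_eq_distr_density)
    show "(\<lambda>x. (wderiv u x)\<^sup>2 + (\<rho> x)\<^sup>2) \<in> borel_measurable lebesgue" using wm \<rho>m by measurable
    show "AE x in lebesgue. (wderiv u x)\<^sup>2 + (\<rho> x)\<^sup>2 = (pullback q x)\<^sup>2 + (pullback s x)\<^sup>2"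
      using ae wu(3) by eventually_elim simp
  qed auto
  also have "\<dots> = density lborel (\<lambda>x. ennreal ((pullback q x)\<^sup>2 + (pullback s x)\<^sup>2))"
    by (rule distr_id2) simp
  finally have ac: "is_ac_part \<mu> (pushforward (\<lambda>x. x) (\<lambda>x. (wderiv u x)\<^sup>2 + (\<rho> x)\<^sup>2))"
    using is_ac_part_\<mu> by simp
  have "integrable lborel (\<lambda>x. (pullback q x)\<^sup>2)" "integrable lborel (\<lambda>x. (pullback s x)\<^sup>2)"
    by (rule Bochner_Integration.integrable_bound[OF integrable_energy_density]; simp)+
  then have i: "integrable lebesgue (\<lambda>x. (pullback q x)\<^sup>2)" "integrable lebesgue (\<lambda>x. (pullback s x)\<^sup>2)"
    by (auto simp: integrable_completion)
  have q2: "pullback q \<in> L2" using i(1) measurable_lebesgueI[of "pullback q"] unfolding L2_def by simp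
  have "integrable lebesgue (\<lambda>x. (\<rho> x)\<^sup>2)"
    by (rule integrable_cong_AE_imp[OF i(2)]) (use \<rho>m ae in \<open>auto elim!: eventually_mono\<close>)
  then have \<rho>2: "\<rho> \<in> L2" using \<rho>m unfolding L2_def by simp
  have "u \<in> Linf" using measurable_lebesgueI[OF u_measurable] u_bound unfolding Linf_def by auto
  then have "u \<in> E2" using q2 wu(1) ac_deriv_continuous[OF ac_u] unfolding E2_def by auto
  then have "(u, \<rho>, \<mu>) \<in> D_set" using \<rho>2 finite_measure_\<mu> ac unfolding D_set_def by simp
  then show ?thesis using that M \<rho>m ae by blast
qed

end

section \<open>From Eulerian to Lagrangian coordinates\<close>

text \<open>Completeness of Lebesgue measure. It gives measurability of \<open>r\<close>, which
  contains the composition of the merely Lebesgue measurable \<open>\<rho>0\<close> with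
  \<open>y\<close>.\<close>

lemma measurable_lebesgue_AE_cong:
  fixes f g :: "real \<Rightarrow> real"
  assumes f: "f \<in> borel_measurable lebesgue" and ae: "AE x in lebesgue. f x = g x"
  shows "g \<in> borel_measurable lebesgue"
proof (rule measurableI)
  fix A :: "real set" assume "A \<in> sets borel"
  then have "f -` A \<inter> space lebesgue \<in> sets lebesgue" by (rule measurable_sets[OF f])
  then show "g -` A \<inter> space lebesgue \<in> sets lebesgue"
    by (rule completion.in_sets_AE[rotated]) (use ae in \<open>auto elim!: eventually_mono\<close>)
qed auto

text \<open>Provides \<open>\<mu> + dx\<close> as a measure, so that uniqueness on half-open
  intervals can be applied to it.\<close>

lemma exists_sum_measure:
  fixes M N :: "'a measure"
  assumes N: "sets N = sets M"
  obtains S where "sets S = sets M" "\<And>A. A \<in> sets M \<Longrightarrow> emeasure S A = emeasure M A + emeasure N A"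
proof -
  let ?S = "measure_of (space M) (sets M) (\<lambda>A. emeasure M A + emeasure N A)"
  have "countably_additive (sets M) (\<lambda>A. emeasure M A + emeasure N A)"
  proof (rule countably_additiveI)
    fix A :: "nat \<Rightarrow> 'a set"
    assume A: "range A \<subseteq> sets M" "disjoint_family A"
    have "(\<Sum>i. emeasure M (A i) + emeasure N (A i)) = (\<Sum>i. emeasure M (A i)) + (\<Sum>i. emeasure N (A i))"
      by (intro suminf_add[symmetric]) auto
    then show "(\<Sum>i. emeasure M (A i) + emeasure N (A i)) = emeasure M (\<Union>(range A)) + emeasure N (\<Union>(range A))"
      using A N by (simp add: suminf_emeasure)
  qed
  then have "emeasure ?S A = emeasure M A + emeasure N A" if "A \<in> sets M" for A
    using that by (intro emeasure_measure_of_sigma sets.sigma_algebra_axioms) (auto simp: positive_def)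
  moreover have "sets ?S = sets M" by simp
  ultimately show ?thesis using that by blast
qed

text \<open>
  The function \<open>y\<close> of \<open>L_map\<close> is the generalised inverse of the distribution function of
  \<open>\<mu> + dx\<close>, hence transports \<open>d\<xi>\<close> to \<open>\<mu> + dx\<close>.
\<close>

locale quantile = finite_borel_measure \<mu> for \<mu> :: "real measure"
begin

definition y :: "real \<Rightarrow> real" where
  "y \<xi> = Sup {x. measure \<mu> {..<x} + x < \<xi>}"

lemma sets_\<mu>: "sets \<mu> = sets borel"
  using M_is_borel .

lemma space_\<mu>: "space \<mu> = UNIV"
  using sets_eq_imp_space_eq[OF sets_\<mu>] by simp

lemma mass_le: "measure \<mu> A \<le> measure \<mu> UNIV"
  using bounded_measure[of A] by (simp add: space_\<mu>)

lemma level_props: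
  shows level_nonempty: "{x. measure \<mu> {..<x} + x < \<xi>} \<noteq> {}"
    and level_bdd: "bdd_above {x. measure \<mu> {..<x} + x < \<xi>}"
    and y_le: "y \<xi> \<le> \<xi>"
    and y_ge: "\<xi> - measure \<mu> UNIV \<le> y \<xi>"
proof -
  have u: "x \<le> \<xi>" if "measure \<mu> {..<x} + x < \<xi>" for x
    using that measure_nonneg[of \<mu> "{..<x}"] by linarith
  have l: "measure \<mu> {..<x} + x < \<xi>" if "x < \<xi> - measure \<mu> UNIV" for x
    using that mass_le[of "{..<x}"] by linarith
  show ne: "{x. measure \<mu> {..<x} + x < \<xi>} \<noteq> {}"
  proof -
    have "\<xi> - measure \<mu> UNIV - 1 \<in> {x. measure \<mu> {..<x} + x < \<xi>}"
      using l[of "\<xi> - measure \<mu> UNIV - 1"] by simp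
    then show ?thesis by blast
  qed
  show bd: "bdd_above {x. measure \<mu> {..<x} + x < \<xi>}"
    using u by (intro bdd_aboveI[of _ \<xi>]) auto
  show "y \<xi> \<le> \<xi>" unfolding y_def using u by (intro cSup_least[OF ne]) auto
  show "\<xi> - measure \<mu> UNIV \<le> y \<xi>"
  proof (rule dense_le)
    fix x assume "x < \<xi> - measure \<mu> UNIV"
    then show "x \<le> y \<xi>" unfolding y_def using l by (intro cSup_upper[OF _ bd]) auto
  qed
qed

text \<open>The supremum defining \<open>y\<close> uses the left-continuous distribution function,
  this criterion the right-continuous one. For \<open>x > b\<close> the two can be exchanged, and
  right continuity carries the bound down to \<open>b\<close>.\<close>

lemma y_le_iff: "y \<xi> \<le> b \<longleftrightarrow> \<xi> \<le> measure \<mu> {..b} + b"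
proof
  assume *: "\<xi> \<le> measure \<mu> {..b} + b"
  show "y \<xi> \<le> b"
    unfolding y_def
  proof (rule cSup_least[OF level_nonempty])
    fix x assume "x \<in> {x. measure \<mu> {..<x} + x < \<xi>}"
    then have x: "measure \<mu> {..<x} + x < \<xi>" by simp
    show "x \<le> b"
    proof (rule ccontr)
      assume "\<not> x \<le> b"
      then have "measure \<mu> {..b} \<le> measure \<mu> {..<x}"
        by (intro finite_measure_mono) (auto simp: sets_\<mu>)
      then show False using x * \<open>\<not> x \<le> b\<close> by linarith
    qed
  qed
next
  assume *: "y \<xi> \<le> b"
  have le: "\<xi> \<le> measure \<mu> {..x} + x" if "x > b" for x
  proof (rule ccontr)
    assume "\<not> \<xi> \<le> measure \<mu> {..x} + x"
    moreover have "measure \<mu> {..<x} \<le> measure \<mu> {..x}"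
      by (intro finite_measure_mono) (auto simp: sets_\<mu>)
    ultimately have "x \<in> {x. measure \<mu> {..<x} + x < \<xi>}" by auto
    then have "x \<le> y \<xi>" unfolding y_def by (rule cSup_upper[OF _ level_bdd])
    then show False using * that by linarith
  qed
  have "((\<lambda>x. cdf \<mu> x + x) \<longlongrightarrow> cdf \<mu> b + b) (at_right b)"
    using cdf_is_right_cont[of b] unfolding continuous_within by (intro tendsto_intros)
  then show "\<xi> \<le> measure \<mu> {..b} + b"
    unfolding cdf_def2[symmetric]
  proof (rule tendsto_lowerbound)
    show "\<forall>\<^sub>F x in at_right b. \<xi> \<le> cdf \<mu> x + x"
      using le unfolding cdf_def2 by (auto simp: eventually_at_filter)
  qed auto
qed

lemma mono_y: "mono y"
proof (rule monoI)
  fix a b :: real assume "a \<le> b"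
  then show "y a \<le> y b" using y_le_iff[of b "y b"] y_le_iff[of a "y b"] by linarith
qed

lemma y_measurable [measurable]: "y \<in> borel_measurable borel"
  using mono_y by (rule borel_measurable_mono)

text \<open>The preimage of \<open>{a<..b}\<close> is an interval whose length is the increment of
  the distribution function of \<open>\<mu> + dx\<close>.\<close>

lemma emeasure_distr_y:
  assumes "A \<in> sets borel"
  shows "emeasure (distr lborel borel y) A = emeasure \<mu> A + emeasure lborel A"
proof -
  obtain S where S: "sets S = sets \<mu>" "\<And>A. A \<in> sets \<mu> \<Longrightarrow> emeasure S A = emeasure \<mu> A + emeasure lborel A"
    by (rule exists_sum_measure[of lborel \<mu>]) (use sets_\<mu> in auto)
  have "distr lborel borel y = S"
  proof (rule measure_eqI_Ioc)
    show "sets S = sets borel" using S sets_\<mu> by simp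
    fix a b :: real assume ab: "a \<le> b"
    have "y -` {a<..b} = {measure \<mu> {..a} + a<..measure \<mu> {..b} + b}"
      using y_le_iff by (auto simp: not_le[symmetric])
    then have "emeasure (distr lborel borel y) {a<..b} =
        emeasure lborel {measure \<mu> {..a} + a<..measure \<mu> {..b} + b}"
      by (simp add: emeasure_distr)
    also have "\<dots> = ennreal ((measure \<mu> {..b} + b) - (measure \<mu> {..a} + a))"
      using ab cdf_nondecreasing[OF ab] by (intro emeasure_lborel_Ioc) (simp add: cdf_def2)
    also have "(measure \<mu> {..b} + b) - (measure \<mu> {..a} + a) = measure \<mu> {a<..b} + (b - a)"
    proof (cases "a = b")
      case False
      then show ?thesis using cdf_diff_eq[of a b] ab by (simp add: cdf_def2)
    qed auto
    also have "ennreal \<dots> = emeasure S {a<..b}"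
      using S(2)[of "{a<..b}"] ab by (simp add: sets_\<mu> emeasure_eq_measure ennreal_plus[symmetric] del: ennreal_plus)
    finally show e: "emeasure (distr lborel borel y) {a<..b} = emeasure S {a<..b}" .
    show "emeasure (distr lborel borel y) {a<..b} \<noteq> \<infinity>"
      unfolding e using S(2)[of "{a<..b}"] ab by (simp add: sets_\<mu> emeasure_eq_measure)
  qed auto
  then show ?thesis using S assms sets_\<mu> by simp
qed

lemma H_limits: "((\<lambda>\<xi>. \<xi> - y \<xi>) \<longlongrightarrow> 0) at_bot" "((\<lambda>\<xi>. \<xi> - y \<xi>) \<longlongrightarrow> measure \<mu> UNIV) at_top"
proof -
  have "\<xi> - y \<xi> \<le> cdf \<mu> \<xi>" for \<xi>
    using y_le_iff[of \<xi> "y \<xi>"] cdf_nondecreasing[OF y_le[of \<xi>]] by (simp add: cdf_def2)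
  then show "((\<lambda>\<xi>. \<xi> - y \<xi>) \<longlongrightarrow> 0) at_bot"
    using y_le by (intro tendsto_sandwich[OF _ _ tendsto_const cdf_lim_at_bot]) auto
  \<comment> \<open>\<open>y \<xi>\<close> is at least \<open>\<xi>\<close> minus the total mass,
    and the extra 1 pays for stepping left of \<open>y \<xi>\<close> by \<open>d \<le> 1\<close>,
    where \<open>y_le_iff\<close> yields a strict inequality.\<close>
  have lower: "cdf \<mu> (\<xi> - (measure \<mu> UNIV + 1)) \<le> \<xi> - y \<xi>" for \<xi>
  proof (rule field_le_epsilon)
    fix e :: real assume "e > 0"
    define d where "d = min e 1"
    have d: "0 < d" "d \<le> e" "d \<le> 1" using \<open>e > 0\<close> by (auto simp: d_def)
    have "\<not> y \<xi> \<le> y \<xi> - d" using d by simp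
    then have "measure \<mu> {..y \<xi> - d} + (y \<xi> - d) < \<xi>" using y_le_iff by auto
    moreover have "cdf \<mu> (\<xi> - (measure \<mu> UNIV + 1)) \<le> cdf \<mu> (y \<xi> - d)"
      using y_ge[of \<xi>] d by (intro cdf_nondecreasing) simp
    ultimately show "cdf \<mu> (\<xi> - (measure \<mu> UNIV + 1)) \<le> \<xi> - y \<xi> + e"
      using d by (simp add: cdf_def2)
  qed
  have lim: "((\<lambda>\<xi>. cdf \<mu> (\<xi> - (measure \<mu> UNIV + 1))) \<longlongrightarrow> measure \<mu> UNIV) at_top"
  proof (rule filterlim_compose[of "cdf \<mu>"])
    show "(cdf \<mu> \<longlongrightarrow> measure \<mu> UNIV) at_top" using cdf_lim_at_top by (simp add: space_\<mu>)
    show "filterlim (\<lambda>\<xi>. \<xi> - (measure \<mu> UNIV + 1)) at_top at_top"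
      using filterlim_tendsto_add_at_top[OF tendsto_const[of "- (measure \<mu> UNIV + 1)"] filterlim_ident]
      by (simp only: add.commute[of "- (measure \<mu> UNIV + 1)"] diff_conv_add_uminus)
  qed
  have upper: "\<xi> - y \<xi> \<le> measure \<mu> UNIV" for \<xi> using y_ge[of \<xi>] by simp
  show "((\<lambda>\<xi>. \<xi> - y \<xi>) \<longlongrightarrow> measure \<mu> UNIV) at_top"
  proof (rule tendsto_sandwich[OF _ _ lim tendsto_const])
    show "\<forall>\<^sub>F \<xi> in at_top. cdf \<mu> (\<xi> - (measure \<mu> UNIV + 1)) \<le> \<xi> - y \<xi>"
      using lower by (intro always_eventually allI)
    show "\<forall>\<^sub>F \<xi> in at_top. \<xi> - y \<xi> \<le> measure \<mu> UNIV"
      using upper by (intro always_eventually allI)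
  qed
qed

text \<open>Off \<open>N\<close> the measure \<open>\<mu> + dx\<close> has density
  \<open>1 + e\<close>, which the weight \<open>f = 1 / (1 + e)\<close> reduces to
  \<open>dx\<close>; on \<open>N\<close>, a null set, the value 0 of \<open>f\<close> discards the
  singular part. The complementary weight \<open>1 - f\<close> must then leave
  \<open>\<mu>\<close>.\<close>

lemma transport_y:
  assumes [measurable]: "e \<in> borel_measurable borel" "N \<in> sets borel" and e: "\<And>x. 0 \<le> e x"
    and N: "N \<in> null_sets lborel"
    and off: "\<And>A. A \<in> sets borel \<Longrightarrow> A \<inter> N = {} \<Longrightarrow> emeasure \<mu> A = emeasure (density lborel (\<lambda>x. ennreal (e x))) A"
    and f_def: "f = (\<lambda>x. if x \<in> N then 0 else 1 / (1 + e x))"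
  shows "distr (density lborel (\<lambda>\<xi>. ennreal (f (y \<xi>)))) borel y = lborel"
    and "distr (density lborel (\<lambda>\<xi>. ennreal (1 - f (y \<xi>)))) borel y = \<mu>"
proof -
  let ?D = "distr lborel borel y" and ?I = "indicator (- N) :: real \<Rightarrow> ennreal"
  have f [measurable]: "f \<in> borel_measurable borel" unfolding f_def by measurable
  have f01: "0 \<le> f x" "f x \<le> 1" for x using e[of x] by (auto simp: f_def)
  have "density ?D ?I = density lborel (\<lambda>x. ennreal (1 + e x) * ?I x)"
  proof (rule measure_eqI)
    fix A assume "A \<in> sets (density ?D ?I)"
    then have A [measurable]: "A \<in> sets borel" by simp
    have "emeasure (density ?D ?I) A = (\<integral>\<^sup>+x. ?I x * indicator A x \<partial>?D)"
      by (rule emeasure_density) auto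
    also have "\<dots> = (\<integral>\<^sup>+x. indicator (A - N) x \<partial>?D)"
      by (rule nn_integral_cong) (auto split: split_indicator)
    also have "\<dots> = emeasure ?D (A - N)" by (rule nn_integral_indicator) simp
    also have "\<dots> = emeasure (density lborel (\<lambda>x. ennreal (e x))) (A - N) + emeasure lborel (A - N)"
      using off[of "A - N"] by (simp add: emeasure_distr_y Diff_Int_distrib2 Int_Diff)
    also have "\<dots> = (\<integral>\<^sup>+x. ennreal (e x) * indicator (A - N) x + indicator (A - N) x \<partial>lborel)"
      by (subst nn_integral_add) (auto simp: emeasure_density)
    also have "\<dots> = (\<integral>\<^sup>+x. ennreal (1 + e x) * ?I x * indicator A x \<partial>lborel)"
      by (rule nn_integral_cong) (use e in \<open>auto simp: indicator_def add.commute\<close>)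
    also have "\<dots> = emeasure (density lborel (\<lambda>x. ennreal (1 + e x) * ?I x)) A"
      by (simp add: emeasure_density)
    finally show "emeasure (density ?D ?I) A = emeasure (density lborel (\<lambda>x. ennreal (1 + e x) * ?I x)) A" .
  qed simp
  then have "density (density ?D ?I) (\<lambda>x. ennreal (f x)) =
      density (density lborel (\<lambda>x. ennreal (1 + e x) * ?I x)) (\<lambda>x. ennreal (f x))" by simp
  moreover have "density (density ?D ?I) (\<lambda>x. ennreal (f x)) = density ?D (\<lambda>x. ennreal (f x))"
    by (subst density_density_eq) (auto intro!: density_cong simp: f_def indicator_def)
  moreover have "density (density lborel (\<lambda>x. ennreal (1 + e x) * ?I x)) (\<lambda>x. ennreal (f x)) = density lborel (\<lambda>x. 1)"
  proof (subst density_density_eq, simp, simp, rule density_cong, simp, simp)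
    show "AE x in lborel. ennreal (1 + e x) * ?I x * ennreal (f x) = 1"
      using AE_not_in[OF N]
    proof eventually_elim
      fix x assume "x \<notin> N"
      moreover have "(1 + e x) * (1 / (1 + e x)) = 1" using e[of x] by simp
      ultimately show "ennreal (1 + e x) * ?I x * ennreal (f x) = 1"
        using e[of x] by (simp add: f_def ennreal_mult[symmetric] del: times_divide_eq_right ennreal_plus)
    qed
  qed
  ultimately have Df: "density ?D (\<lambda>x. ennreal (f x)) = lborel" by (simp add: density_1)
  then show "distr (density lborel (\<lambda>\<xi>. ennreal (f (y \<xi>)))) borel y = lborel"
    by (subst (asm) density_distr) auto
  have "density ?D (\<lambda>x. ennreal (1 - f x)) = \<mu>"
  proof (rule measure_eqI_Ioc)
    fix a b :: real assume ab: "a \<le> b"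
    \<comment> \<open>The two weighted measures add up to \<open>\<mu> + dx\<close>; on a bounded
      interval the Lebesgue part is finite and can be cancelled.\<close>
    have "emeasure (density ?D (\<lambda>x. ennreal (1 - f x))) {a<..b} + emeasure lborel {a<..b} =
       emeasure (density ?D (\<lambda>x. ennreal (1 - f x))) {a<..b} + emeasure (density ?D (\<lambda>x. ennreal (f x))) {a<..b}"
      by (simp add: Df)
    also have "\<dots> = (\<integral>\<^sup>+x. ennreal (1 - f x) * indicator {a<..b} x + ennreal (f x) * indicator {a<..b} x \<partial>?D)"
      by (subst nn_integral_add) (auto simp: emeasure_density)
    also have "\<dots> = (\<integral>\<^sup>+x. indicator {a<..b} x \<partial>?D)"
      by (rule nn_integral_cong) (use f01 in \<open>auto simp: indicator_def ennreal_plus[symmetric] simp del: ennreal_plus\<close>)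
    also have "\<dots> = emeasure \<mu> {a<..b} + emeasure lborel {a<..b}"
      by (simp add: emeasure_distr_y)
    finally show e: "emeasure (density ?D (\<lambda>x. ennreal (1 - f x))) {a<..b} = emeasure \<mu> {a<..b}"
      using ab by (simp add: ennreal_add_left_cancel add.commute[of _ "ennreal (b - a)"])
    show "emeasure (density ?D (\<lambda>x. ennreal (1 - f x))) {a<..b} \<noteq> \<infinity>"
      unfolding e by (simp add: emeasure_eq_measure)
  qed (simp_all add: sets_\<mu>)
  then show "distr (density lborel (\<lambda>\<xi>. ennreal (1 - f (y \<xi>)))) borel y = \<mu>"
    by (subst (asm) density_distr) auto
qed

end

lemma continuous_AE_bounded:
  fixes f :: "real \<Rightarrow> real"
  assumes "continuous_on UNIV f" "AE x in lebesgue. \<bar>f x\<bar> \<le> C"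
  shows "\<bar>f x\<bar> \<le> C"
proof -
  have "AE x in lborel. max (\<bar>f x\<bar> - C) 0 = 0"
    using assms(2) by (simp add: AE_completion_iff max_def)
  then have "max (\<bar>f x\<bar> - C) 0 = 0"
    by (rule continuous_AE_zero[rotated]) (intro continuous_intros assms(1))
  then show ?thesis by simp
qed

lemma L_map_lagrangian:
  assumes D: "(u0, \<rho>0, \<mu>0) \<in> D_set"
  obtains y r p q h \<rho>B K where
    "L_map (u0, \<rho>0, \<mu>0) = (y, \<lambda>\<xi>. u0 (y \<xi>), \<lambda>\<xi>. \<xi> - y \<xi>, r)"
    "lagrangian y (\<lambda>\<xi>. u0 (y \<xi>)) (\<lambda>\<xi>. \<xi> - y \<xi>) p q h (\<lambda>\<xi>. \<rho>B (y \<xi>) * p \<xi>) K (measure \<mu>0 UNIV)"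
    "r \<in> borel_measurable lebesgue" "AE \<xi> in lebesgue. r \<xi> = \<rho>B (y \<xi>) * p \<xi>"
    "\<rho>B \<in> borel_measurable borel" "AE x in lebesgue. \<rho>0 x = \<rho>B x"
    "distr (density lborel (\<lambda>\<xi>. ennreal (h \<xi>))) borel y = \<mu>0"
    "continuous_on UNIV u0"
proof -
  have u0: "u0 \<in> Linf" "continuous_on UNIV u0" and \<rho>0: "\<rho>0 \<in> borel_measurable lebesgue"
    and \<mu>0: "sets \<mu>0 = sets borel" "finite_measure \<mu>0"
    and acp: "is_ac_part \<mu>0 (pushforward (\<lambda>x. x) (\<lambda>x. (wderiv u0 x)\<^sup>2 + (\<rho>0 x)\<^sup>2))"
    using D unfolding D_set_def E2_def L2_def by auto
  obtain v where "has_weak_deriv u0 v" using D unfolding D_set_def E2_def by auto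
  then have wd: "has_weak_deriv u0 (wderiv u0)" by (rule wderiv_AE_eq)
  then obtain g where g: "ac_deriv u0 g" "AE x in lebesgue. wderiv u0 x = g x"
    by (rule weak_deriv_imp_ac_deriv[OF u0(2)])
  note [measurable] = ac_derivD(1)[OF g(1)]
  obtain \<rho>B where \<rho>B [measurable]: "\<rho>B \<in> borel_measurable borel"
    and \<rho>ae: "AE x in lborel. \<rho>0 x = \<rho>B x" "AE x in lebesgue. \<rho>0 x = \<rho>B x"
    by (rule lebesgue_Borel_representative[OF \<rho>0])
  define e where "e = (\<lambda>x. (g x)\<^sup>2 + (\<rho>B x)\<^sup>2)"
  have e [measurable]: "e \<in> borel_measurable borel" and e0: "\<And>x. 0 \<le> e x" unfolding e_def by auto
  have wm: "wderiv u0 \<in> borel_measurable lebesgue"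
    using wd by (auto simp: has_weak_deriv_def intro: locally_integrable_measurable)
  have "pushforward (\<lambda>x. x) (\<lambda>x. (wderiv u0 x)\<^sup>2 + (\<rho>0 x)\<^sup>2) = distr (density lborel (\<lambda>x. ennreal (e x))) borel (\<lambda>x. x)"
  proof (rule pushforward_eq_distr_density)
    show "(\<lambda>x. (wderiv u0 x)\<^sup>2 + (\<rho>0 x)\<^sup>2) \<in> borel_measurable lebesgue" using wm \<rho>0 by measurable
    show "AE x in lebesgue. (wderiv u0 x)\<^sup>2 + (\<rho>0 x)\<^sup>2 = e x"
      using g(2) \<rho>ae(2) by eventually_elim (simp add: e_def)
  qed auto
  also have "\<dots> = density lborel (\<lambda>x. ennreal (e x))" by (rule distr_id2) simp
  finally have "is_ac_part \<mu>0 (density lborel (\<lambda>x. ennreal (e x)))" using acp by simp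
  then obtain \<sigma> N1 where \<sigma>: "sets \<sigma> = sets borel" "N1 \<in> null_sets lborel" "emeasure \<sigma> (- N1) = 0"
    "\<And>A. A \<in> sets borel \<Longrightarrow> emeasure \<mu>0 A = emeasure (density lborel (\<lambda>x. ennreal (e x))) A + emeasure \<sigma> A"
    unfolding is_ac_part_def by blast
  \<comment> \<open>Changing \<open>\<rho>0\<close> on a null set may change
    \<open>\<rho>0 \<circ> y\<close> on a set of positive measure. Putting the discrepancy into
    \<open>N\<close>, where \<open>f\<close> is 0, makes the product with \<open>p\<close>
    insensitive to it.\<close>
  obtain N2 where N2: "{x \<in> space lborel. \<rho>0 x \<noteq> \<rho>B x} \<subseteq> N2" "emeasure lborel N2 = 0" "N2 \<in> sets lborel"
    using \<rho>ae(1) by (rule AE_E)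
  define N where "N = N1 \<union> N2"
  have N: "N \<in> null_sets lborel" unfolding N_def using \<sigma>(2) N2 by (intro null_sets.Un null_setsI) auto
  then have Nb [measurable]: "N \<in> sets borel" by (auto simp: null_sets_def)
  have off: "emeasure \<mu>0 A = emeasure (density lborel (\<lambda>x. ennreal (e x))) A"
    if "A \<in> sets borel" "A \<inter> N = {}" for A
  proof -
    have "- N1 \<in> sets \<sigma>" using \<sigma>(1,2) by (auto simp: null_sets_def intro: borel_comp)
    then have "emeasure \<sigma> A \<le> emeasure \<sigma> (- N1)"
      using that(2) by (intro emeasure_mono) (auto simp: N_def)
    then show ?thesis using \<sigma>(3,4) that(1) by simp
  qed
  interpret Q: quantile \<mu>0
    using \<mu>0 by (simp add: quantile_def finite_borel_measure_def finite_borel_measure_axioms_def)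
  define f where "f = (\<lambda>x. if x \<in> N then 0 else 1 / (1 + e x))"
  have [measurable]: "f \<in> borel_measurable borel" unfolding f_def by measurable
  have f01: "0 \<le> f x" "f x \<le> 1" for x using e0[of x] by (auto simp: f_def)
  note tr = Q.transport_y[OF e Nb e0 N off f_def]
  define p where "p = (\<lambda>\<xi>. f (Q.y \<xi>))"
  interpret T: lebesgue_transport Q.y p
    using Q.mono_y f01(1) tr(1) by unfold_locales (auto simp: p_def)
  have p01: "0 \<le> p \<xi>" "p \<xi> \<le> 1" for \<xi> using f01 by (auto simp: p_def)
  have acH: "ac_deriv (\<lambda>\<xi>. \<xi> - Q.y \<xi>) (\<lambda>\<xi>. 1 - p \<xi>)"
    using ac_deriv_add[OF ac_deriv_C1[of "\<lambda>x. x" "\<lambda>x. 1"] ac_deriv_cmult[OF T.ac_deriv_y, of "-1"]] by simp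
  obtain C where "AE x in lebesgue. \<bar>u0 x\<bar> \<le> C" using u0(1) unfolding Linf_def by blast
  then have C: "\<bar>u0 x\<bar> \<le> C" for x by (rule continuous_AE_bounded[OF u0(2)])
  \<comment> \<open>The 1 bounds \<open>p\<close> and \<open>1 - p\<close>, the constant
    \<open>C\<close> bounds \<open>u0\<close>, and the total mass bounds
    \<open>\<xi> - y \<xi>\<close>.\<close>
  define K where "K = max 1 (max C (measure \<mu>0 UNIV))"
  define r where "r = (\<lambda>\<xi>. \<rho>0 (Q.y \<xi>) * wderiv Q.y \<xi>)"
  have L: "L_map (u0, \<rho>0, \<mu>0) = (Q.y, \<lambda>\<xi>. u0 (Q.y \<xi>), \<lambda>\<xi>. \<xi> - Q.y \<xi>, r)"
    by (simp add: L_map_def Let_def Q.y_def[abs_def] r_def)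
  have "AE \<xi> in lebesgue. wderiv Q.y \<xi> = p \<xi>"
    by (rule wderiv_AE_eq[OF ac_deriv_imp_weak_deriv[OF T.ac_deriv_y]])
  then have rae: "AE \<xi> in lebesgue. r \<xi> = \<rho>B (Q.y \<xi>) * p \<xi>"
  proof eventually_elim
    fix \<xi> assume "wderiv Q.y \<xi> = p \<xi>"
    then show "r \<xi> = \<rho>B (Q.y \<xi>) * p \<xi>"
      using N2(1) by (auto simp: r_def p_def f_def N_def)
  qed
  have rm: "r \<in> borel_measurable lebesgue"
  proof (rule measurable_lebesgue_AE_cong)
    show "(\<lambda>\<xi>. \<rho>B (Q.y \<xi>) * p \<xi>) \<in> borel_measurable lebesgue" by (rule measurable_lebesgueI) measurable
    show "AE \<xi> in lebesgue. \<rho>B (Q.y \<xi>) * p \<xi> = r \<xi>" using rae by eventually_elim simp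
  qed
  have lag: "lagrangian Q.y (\<lambda>\<xi>. u0 (Q.y \<xi>)) (\<lambda>\<xi>. \<xi> - Q.y \<xi>) p (\<lambda>\<xi>. g (Q.y \<xi>) * p \<xi>) (\<lambda>\<xi>. 1 - p \<xi>)
     (\<lambda>\<xi>. \<rho>B (Q.y \<xi>) * p \<xi>) K (measure \<mu>0 UNIV)"
  proof
    show "ac_deriv Q.y p" by (rule T.ac_deriv_y)
    show "ac_deriv (\<lambda>\<xi>. u0 (Q.y \<xi>)) (\<lambda>\<xi>. g (Q.y \<xi>) * p \<xi>)" by (rule T.ac_deriv_compose[OF g(1)])
    show "ac_deriv (\<lambda>\<xi>. \<xi> - Q.y \<xi>) (\<lambda>\<xi>. 1 - p \<xi>)" by (rule acH)
    show "(\<lambda>\<xi>. \<rho>B (Q.y \<xi>) * p \<xi>) \<in> borel_measurable borel" by measurable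
    \<comment> \<open>Off \<open>N\<close>, \<open>p = 1 / (1 + e)\<close> means
      \<open>1 - p = p e\<close>, so the left side is \<open>p^2 e\<close>; on \<open>N\<close>
      everything vanishes. Thus the relation holds at every point.\<close>
    show "p \<xi> * (1 - p \<xi>) = (g (Q.y \<xi>) * p \<xi>)\<^sup>2 + (\<rho>B (Q.y \<xi>) * p \<xi>)\<^sup>2" for \<xi>
    proof (cases "Q.y \<xi> \<in> N")
      case False
      then have "p \<xi> * (1 + e (Q.y \<xi>)) = 1" using e0[of "Q.y \<xi>"] by (simp add: p_def f_def)
      then have "1 - p \<xi> = p \<xi> * e (Q.y \<xi>)" by (simp add: algebra_simps)
      then have "p \<xi> * (1 - p \<xi>) = p \<xi> * (p \<xi> * e (Q.y \<xi>))" by simp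
      then show ?thesis by (simp only: e_def algebra_simps power2_eq_square)
    qed (simp add: p_def f_def)
    show "\<bar>Q.y \<xi> - \<xi>\<bar> \<le> K" for \<xi> using Q.y_le[of \<xi>] Q.y_ge[of \<xi>] unfolding K_def by linarith
    show "\<bar>u0 (Q.y \<xi>)\<bar> \<le> K" for \<xi> using C[of "Q.y \<xi>"] unfolding K_def by linarith
    show "p \<xi> \<le> K" "1 - p \<xi> \<le> K" "0 \<le> 1 - p \<xi>" "0 \<le> p \<xi>" for \<xi>
      using p01[of \<xi>] unfolding K_def by linarith+
  qed (use Q.H_limits in auto)
  have push: "distr (density lborel (\<lambda>\<xi>. ennreal (1 - p \<xi>))) borel Q.y = \<mu>0"
    using tr(2) by (simp add: p_def)
  show ?thesis by (rule that[OF L lag rm rae \<rho>B \<rho>ae(2) push u0(2)])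
qed

section \<open>The flow in Lagrangian coordinates\<close>

context lagrangian
begin

lemma H_bounds: "0 \<le> H \<xi>" "H \<xi> \<le> m"
proof -
  show "0 \<le> H \<xi>"
    unfolding h_integral_Iic(2)[symmetric] using h_ge by (intro integral_nonneg_AE) auto
  have "(LINT x|lborel. h x * indicator {..\<xi>} x) \<le> (LINT x|lborel. h x)"
    using h_ge by (intro integral_mono h_integral h_integral_Iic(1)) (auto simp: indicator_def)
  then show "H \<xi> \<le> m" by (simp add: h_integral h_integral_Iic)
qed

lemma K_nonneg: "0 \<le> K"
  using p_ge[of 0] p_le[of 0] by linarith

lemma m_nonneg: "0 \<le> m"
  using H_bounds[of 0] by linarith

definition y_at :: "real \<Rightarrow> real \<Rightarrow> real" where
  "y_at t \<xi> = 1/4 * (H \<xi> - 1/2 * m) * t\<^sup>2 + U \<xi> * t + y \<xi>"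

definition U_at :: "real \<Rightarrow> real \<Rightarrow> real" where
  "U_at t \<xi> = 1/2 * (H \<xi> - 1/2 * m) * t + U \<xi>"

definition p_at :: "real \<Rightarrow> real \<Rightarrow> real" where
  "p_at t \<xi> = p \<xi> + t * q \<xi> + t\<^sup>2/4 * h \<xi>"

definition q_at :: "real \<Rightarrow> real \<Rightarrow> real" where
  "q_at t \<xi> = q \<xi> + t/2 * h \<xi>"

text \<open>All quantities along the flow are combinations of \<open>1\<close>, \<open>t\<close>,
  \<open>t^2\<close> with coefficients at most \<open>K\<close> or \<open>m\<close> in modulus. A
  bound uniform for \<open>t \<le> T\<close> is what dominated integration over a time interval
  needs.\<close>

definition bound_at :: "real \<Rightarrow> real" where
  "bound_at T = (K + m) * (1 + T + T\<^sup>2)"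

lemma S_map_eq: "S_map t (y, U, H, r) = (y_at t, U_at t, H, r)"
proof -
  have "Lim at_top H = m" using H_top by (intro tendsto_Lim) auto
  then show ?thesis by (simp add: S_map_def Let_def y_at_def[abs_def] U_at_def[abs_def])
qed

lemma at_bounds:
  assumes "0 \<le> t" "t \<le> T"
  shows "\<bar>y_at t \<xi> - \<xi>\<bar> \<le> bound_at T" "\<bar>U_at t \<xi>\<bar> \<le> bound_at T" "p_at t \<xi> \<le> bound_at T"
    "\<bar>p_at t \<xi>\<bar> \<le> bound_at T" "\<bar>q_at t \<xi>\<bar> \<le> bound_at T" "h \<xi> \<le> bound_at T" "\<bar>s \<xi>\<bar> \<le> bound_at T"
proof -
  have T: "0 \<le> T" "t\<^sup>2 \<le> T\<^sup>2" using assms by (auto intro: power_mono)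
  have Hm: "\<bar>1/4 * (H \<xi> - 1/2 * m)\<bar> \<le> m" "\<bar>1/2 * (H \<xi> - 1/2 * m)\<bar> \<le> m"
    using H_bounds[of \<xi>] by (simp_all add: abs_le_iff)
  have b: "bound_at T = K + K * T + K * T\<^sup>2 + (m + m * T + m * T\<^sup>2)"
    by (simp add: bound_at_def algebra_simps)
  have pos: "0 \<le> K * T" "0 \<le> K * T\<^sup>2" "0 \<le> m * T" "0 \<le> m * T\<^sup>2"
    using T K_nonneg m_nonneg by simp_all
  have 1: "\<bar>1/4 * (H \<xi> - 1/2 * m) * t\<^sup>2\<bar> \<le> m * T\<^sup>2"
    unfolding abs_mult[of _ "t\<^sup>2"] using Hm T m_nonneg by (intro mult_mono) auto
  have 2: "\<bar>1/2 * (H \<xi> - 1/2 * m) * t\<bar> \<le> m * T"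
    unfolding abs_mult[of _ t] using Hm assms m_nonneg by (intro mult_mono) auto
  have 3: "\<bar>U \<xi> * t\<bar> \<le> K * T"
    unfolding abs_mult using U_bound assms K_nonneg by (intro mult_mono) auto
  have 4: "\<bar>t * q \<xi>\<bar> \<le> K * T"
    unfolding abs_mult using q_s_le(1)[of \<xi>] assms K_nonneg
    by (subst mult.commute) (intro mult_mono, auto)
  have 5: "\<bar>t\<^sup>2/4 * h \<xi>\<bar> \<le> K * T\<^sup>2"
  proof -
    have "\<bar>h \<xi>\<bar> * \<bar>t\<^sup>2/4\<bar> \<le> K * T\<^sup>2"
      using h_le[of \<xi>] h_ge[of \<xi>] T K_nonneg zero_le_power2[of t]
      by (intro mult_mono; linarith)
    then show ?thesis by (simp add: abs_mult mult.commute)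
  qed
  have 6: "\<bar>t/2 * h \<xi>\<bar> \<le> K * T"
    unfolding abs_mult using h_le[of \<xi>] h_ge[of \<xi>] assms K_nonneg
    by (subst mult.commute) (intro mult_mono, auto)
  show "\<bar>y_at t \<xi> - \<xi>\<bar> \<le> bound_at T"
    unfolding y_at_def b using 1 3 y_bound[of \<xi>] pos m_nonneg K_nonneg by linarith
  show "\<bar>U_at t \<xi>\<bar> \<le> bound_at T"
    unfolding U_at_def b using 2 U_bound[of \<xi>] pos m_nonneg K_nonneg by linarith
  show "\<bar>p_at t \<xi>\<bar> \<le> bound_at T"
    unfolding p_at_def b using 4 5 p_le[of \<xi>] p_ge[of \<xi>] pos m_nonneg K_nonneg by linarith
  then show "p_at t \<xi> \<le> bound_at T" by linarith
  show "\<bar>q_at t \<xi>\<bar> \<le> bound_at T"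
    unfolding q_at_def b using 6 q_s_le(1)[of \<xi>] pos m_nonneg K_nonneg by linarith
  show "h \<xi> \<le> bound_at T" "\<bar>s \<xi>\<bar> \<le> bound_at T"
    unfolding b using h_le[of \<xi>] q_s_le(2)[of \<xi>] pos m_nonneg K_nonneg by linarith+
qed

lemma ac_y_at: "ac_deriv (y_at t) (p_at t)"
proof -
  have "ac_deriv (\<lambda>\<xi>. (t\<^sup>2/4 * (H \<xi> + - (1/2 * m)) + t * U \<xi>) + y \<xi>) (\<lambda>\<xi>. (t\<^sup>2/4 * (h \<xi> + 0) + t * q \<xi>) + p \<xi>)"
    by (intro ac_deriv_add ac_deriv_cmult ac_deriv_const ac_y ac_U ac_H)
  moreover have "(\<lambda>\<xi>. (t\<^sup>2/4 * (H \<xi> + - (1/2 * m)) + t * U \<xi>) + y \<xi>) = y_at t"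
    by (rule ext) (simp add: y_at_def field_simps)
  moreover have "(\<lambda>\<xi>. (t\<^sup>2/4 * (h \<xi> + 0) + t * q \<xi>) + p \<xi>) = p_at t"
    by (auto simp: p_at_def algebra_simps)
  ultimately show ?thesis by simp
qed

lemma ac_U_at: "ac_deriv (U_at t) (q_at t)"
proof -
  have "ac_deriv (\<lambda>\<xi>. t/2 * (H \<xi> + - (1/2 * m)) + U \<xi>) (\<lambda>\<xi>. t/2 * (h \<xi> + 0) + q \<xi>)"
    by (intro ac_deriv_add ac_deriv_cmult ac_deriv_const ac_U ac_H)
  moreover have "(\<lambda>\<xi>. t/2 * (H \<xi> + - (1/2 * m)) + U \<xi>) = U_at t"
    by (auto simp: U_at_def algebra_simps)
  moreover have "(\<lambda>\<xi>. t/2 * (h \<xi> + 0) + q \<xi>) = q_at t"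
    by (auto simp: q_at_def algebra_simps)
  ultimately show ?thesis by simp
qed

text \<open>Complete the square: multiplied by \<open>p\<close>, the new derivative is
  \<open>(p + t q / 2)^2 + t^2 s^2 / 4\<close> by the energy relation. If \<open>p = 0\<close>, then
  \<open>q = 0\<close> and only \<open>t^2 h / 4\<close> remains.\<close>

lemma p_at_nonneg: "0 \<le> p_at t \<xi>"
proof (cases "p \<xi> = 0")
  case True
  then show ?thesis using q_s_zero(1)[of \<xi>] h_ge[of \<xi>] by (simp add: p_at_def)
next
  case False
  have "p \<xi> * p_at t \<xi> = (p \<xi>)\<^sup>2 + t * (p \<xi> * q \<xi>) + t\<^sup>2/4 * (p \<xi> * h \<xi>)"
    by (simp add: p_at_def algebra_simps power2_eq_square)
  also have "\<dots> = (p \<xi> + t/2 * q \<xi>)\<^sup>2 + t\<^sup>2/4 * (s \<xi>)\<^sup>2"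
    unfolding energy by (simp add: algebra_simps power2_eq_square)
  finally have "0 \<le> p \<xi> * p_at t \<xi>" by simp
  then show ?thesis using False p_ge[of \<xi>] by (simp add: zero_le_mult_iff)
qed

lemma energy_at: "p_at t \<xi> * h \<xi> = (q_at t \<xi>)\<^sup>2 + (s \<xi>)\<^sup>2"
proof -
  have "p_at t \<xi> * h \<xi> = p \<xi> * h \<xi> + t * (q \<xi> * h \<xi>) + t\<^sup>2/4 * (h \<xi>)\<^sup>2"
    by (simp add: p_at_def algebra_simps power2_eq_square)
  then show ?thesis unfolding energy by (simp add: q_at_def algebra_simps power2_eq_square)
qed

text \<open>The locale is invariant under the flow with unchanged \<open>H\<close>,
  \<open>h\<close>, \<open>s\<close> and \<open>m\<close>, so the passage to Eulerian coordinates
  applies at each time.\<close>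

lemma lagrangian_at:
  assumes "0 \<le> t"
  shows "lagrangian (y_at t) (U_at t) H (p_at t) (q_at t) h s (bound_at t) m"
  by unfold_locales
    (use assms at_bounds[of t t] in
      \<open>auto intro: ac_y_at ac_U_at ac_H p_at_nonneg h_ge energy_at H_bot H_top\<close>)

end

section \<open>Test functions on the half plane\<close>

lemma has_derivative_half_plane_slices:
  fixes \<phi> :: "real \<times> real \<Rightarrow> real"
  assumes D: "(\<phi> has_derivative L) (at (x, t) within UNIV \<times> {0..})" and t: "t \<ge> 0"
  shows "dx \<phi> x t = L (1, 0)" "dt \<phi> x t = L (0, 1)"
proof -
  have l: "linear L" by (rule has_derivative_linear[OF D])
  have "((\<lambda>z. \<phi> (z, t)) has_derivative (\<lambda>v. L (v, 0))) (at x)"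
    by (rule has_derivative_in_compose[of "\<lambda>z. (z, t)" "\<lambda>v. (v, 0)" x UNIV \<phi> L])
      (use t in \<open>auto intro!: derivative_eq_intros has_derivative_subset[OF D]\<close>)
  moreover have "(\<lambda>v. L (v, 0)) = (*) (L (1, 0))"
  proof
    show "L (v, 0) = L (1, 0) * v" for v
      using linear_cmul[OF l, of v "(1, 0)"] by (simp add: mult.commute)
  qed
  ultimately have "((\<lambda>z. \<phi> (z, t)) has_real_derivative L (1, 0)) (at x)"
    by (simp add: has_field_derivative_def)
  then show "dx \<phi> x t = L (1, 0)" unfolding dx_def by (rule DERIV_imp_deriv)
  have "((\<lambda>s. \<phi> (x, s)) has_derivative (\<lambda>v. L (0, v))) (at t within {0..})"
    by (rule has_derivative_in_compose[of "\<lambda>s. (x, s)" "\<lambda>v. (0, v)" t "{0..}" \<phi> L])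
      (use t in \<open>auto intro!: derivative_eq_intros has_derivative_subset[OF D]\<close>)
  moreover have "(\<lambda>v. L (0, v)) = (\<lambda>v. v *\<^sub>R L (0, 1))"
  proof
    show "L (0, v) = v *\<^sub>R L (0, 1)" for v
      using linear_cmul[OF l, of v "(0, 1)"] by simp
  qed
  ultimately have "((\<lambda>s. \<phi> (x, s)) has_vector_derivative L (0, 1)) (at t within {0..})"
    by (simp add: has_vector_derivative_def)
  \<comment> \<open>Makes the derivative within the half line unique, including the one-sided case
    \<open>t = 0\<close>.\<close>
  moreover have "t islimpt {0..}"
    by (rule islimpt_subset[OF islimpt_greaterThanLessThan1[of t "t + 1"]]) (use t in auto)
  ultimately show "dt \<phi> x t = L (0, 1)"
    unfolding dt_def by (intro vector_derivative_within) (auto simp: trivial_limit_within)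
qed

lemma half_plane_bounded:
  fixes G :: "real \<times> real \<Rightarrow> real"
  assumes "continuous_on UNIV G" "\<And>x t. 0 \<le> t \<Longrightarrow> \<bar>x\<bar> > R \<or> t > R \<Longrightarrow> G (x, t) = 0"
  obtains C where "C \<ge> 0" "\<And>x t. 0 \<le> t \<Longrightarrow> \<bar>G (x, t)\<bar> \<le> C"
proof -
  have "compact ({-R..R} \<times> {0..R})" by (intro compact_Times) auto
  then have "bounded (G ` ({-R..R} \<times> {0..R}))"
    by (intro compact_imp_bounded compact_continuous_image continuous_on_subset[OF assms(1)]) auto
  then obtain C where C: "\<And>z. z \<in> {-R..R} \<times> {0..R} \<Longrightarrow> \<bar>G z\<bar> \<le> C"
    unfolding bounded_iff real_norm_def by blast
  have "\<bar>G (x, t)\<bar> \<le> max C 0" if "0 \<le> t" for x t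
  proof (cases "\<bar>x\<bar> > R \<or> t > R")
    case False
    then have "(x, t) \<in> {-R..R} \<times> {0..R}" using that by (simp add: abs_le_iff not_less)
    then show ?thesis using C by (simp add: max.coboundedI1)
  qed (use assms(2)[OF that] in simp)
  then show ?thesis using that[of "max C 0"] by auto
qed

text \<open>\<open>\<phi>\<close> and its derivative are controlled only on the closed half plane.
  Freezing time at 0 for negative \<open>t\<close> extends them continuously to the plane, so that
  measurability is immediate, while derivatives are claimed only for
  \<open>t \<ge> 0\<close>.\<close>

lemma test_function_half_plane:
  fixes \<phi> :: "real \<times> real \<Rightarrow> real"
  assumes "\<phi> \<in> test_functions (UNIV \<times> {0..})"
  obtains F Fx Ft R C where
    "continuous_on UNIV F" "continuous_on UNIV Fx" "continuous_on UNIV Ft" "R > 0" "C \<ge> 0"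
    "\<And>x t. 0 \<le> t \<Longrightarrow> \<phi> (x, t) = F (x, t)"
    "\<And>x t. 0 \<le> t \<Longrightarrow> dx \<phi> x t = Fx (x, t)"
    "\<And>x t. 0 \<le> t \<Longrightarrow> dt \<phi> x t = Ft (x, t)"
    "\<And>x t. 0 \<le> t \<Longrightarrow> ((\<lambda>z. F (z, t)) has_real_derivative Fx (x, t)) (at x)"
    "\<And>a a' t. 0 \<le> t \<Longrightarrow> (a has_real_derivative a') (at t within {0..}) \<Longrightarrow>
        ((\<lambda>s. F (a s, s)) has_real_derivative (Ft (a t, t) + a' * Fx (a t, t))) (at t within {0..})"
    "\<And>x t. 0 \<le> t \<Longrightarrow> \<bar>x\<bar> > R \<or> t > R \<Longrightarrow> F (x, t) = 0 \<and> Fx (x, t) = 0 \<and> Ft (x, t) = 0"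
    "\<And>x t. 0 \<le> t \<Longrightarrow> \<bar>F (x, t)\<bar> \<le> C \<and> \<bar>Fx (x, t)\<bar> \<le> C \<and> \<bar>Ft (x, t)\<bar> \<le> C"
proof -
  let ?S = "UNIV \<times> {0..} :: (real \<times> real) set"
  have "Cinf_on ?S \<phi> \<and> (\<exists>K. compact K \<and> K \<subseteq> ?S \<and> (\<forall>x\<in>?S - K. \<phi> x = 0))"
    using assms by (simp only: test_functions_def mem_Collect_eq)
  then obtain K where "Cinf_on ?S \<phi>" and K: "compact K" "\<And>x. x \<in> ?S - K \<Longrightarrow> \<phi> x = 0" by metis
  then have C1: "Ck_on (Suc 0) ?S \<phi>" by (simp only: Cinf_on_def)
  then obtain f' where f: "\<And>z. z \<in> ?S \<Longrightarrow> (\<phi> has_derivative f' z) (at z within ?S)"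
    and f'c: "\<And>v. continuous_on ?S (\<lambda>z. f' z v)" by auto
  have \<phi>c: "continuous_on ?S \<phi>"
    unfolding continuous_on_eq_continuous_within using f by (blast intro: has_derivative_continuous)
  define e :: "real \<times> real \<Rightarrow> real \<times> real" where "e = (\<lambda>z. (fst z, max (snd z) 0))"
  define F where "F = (\<lambda>z. \<phi> (e z))"
  define Fx where "Fx = (\<lambda>z. f' (e z) (1, 0))"
  define Ft where "Ft = (\<lambda>z. f' (e z) (0, 1))"
  have ec: "continuous_on UNIV e" unfolding e_def by (intro continuous_intros)
  have eS: "e z \<in> ?S" for z by (auto simp: e_def)
  have ex: "e (x, t) = (x, t)" if "0 \<le> t" for x t using that by (simp add: e_def)
  have cF: "continuous_on UNIV F" "continuous_on UNIV Fx" "continuous_on UNIV Ft"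
    unfolding F_def Fx_def Ft_def using eS
    by (blast intro: continuous_on_compose2[OF \<phi>c ec] continuous_on_compose2[OF f'c ec])+
  have D: "(\<phi> has_derivative f' (x, t)) (at (x, t) within ?S)" if "0 \<le> t" for x t
    using f[of "(x, t)"] that by auto
  have f'_eq: "f' (x, t) (v, w) = Ft (x, t) * w + v * Fx (x, t)" if "0 \<le> t" for x t v w
  proof -
    have l: "linear (f' (x, t))" by (rule has_derivative_linear[OF D[OF that]])
    have "f' (x, t) (v, w) = f' (x, t) (v *\<^sub>R (1, 0) + w *\<^sub>R (0, 1))" by simp
    also have "\<dots> = v * f' (x, t) (1, 0) + w * f' (x, t) (0, 1)"
      by (simp only: linear_add[OF l] linear_cmul[OF l] real_scaleR_def)
    finally show ?thesis using that by (simp add: Fx_def Ft_def ex)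
  qed
  have part: "dx \<phi> x t = Fx (x, t)" "dt \<phi> x t = Ft (x, t)" if "0 \<le> t" for x t
    using has_derivative_half_plane_slices[OF D[OF that] that] f'_eq[OF that] that by auto
  have chain: "((\<lambda>s. F (a s, s)) has_real_derivative (Ft (a t, t) + a' * Fx (a t, t))) (at t within {0..})"
    if t: "0 \<le> t" and a: "(a has_real_derivative a') (at t within {0..})" for a a' t
  proof -
    have "((\<lambda>s. \<phi> (a s, s)) has_derivative (\<lambda>v. f' (a t, t) (a' * v, v))) (at t within {0..})"
      by (rule has_derivative_in_compose[of "\<lambda>s. (a s, s)" "\<lambda>v. (a' * v, v)" t "{0..}" \<phi>])
        (use t a in \<open>auto intro!: derivative_eq_intros has_derivative_subset[OF D] simp: has_field_derivative_def\<close>)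
    then have "((\<lambda>s. \<phi> (a s, s)) has_real_derivative (Ft (a t, t) + a' * Fx (a t, t))) (at t within {0..})"
      unfolding has_field_derivative_def f'_eq[OF t]
      by (rule has_derivative_eq_rhs) (auto simp: algebra_simps)
    then show ?thesis
      by (rule has_field_derivative_transform_within[where d = 1]) (use t in \<open>auto simp: F_def ex\<close>)
  qed
  have sliceD: "((\<lambda>z. F (z, t)) has_real_derivative Fx (x, t)) (at x)" if t: "0 \<le> t" for x t
  proof -
    have "((\<lambda>z. \<phi> (z, t)) has_derivative (\<lambda>v. f' (x, t) (v, 0))) (at x)"
      by (rule has_derivative_in_compose[of "\<lambda>z. (z, t)" "\<lambda>v. (v, 0)" x UNIV \<phi>])
        (use t in \<open>auto intro!: derivative_eq_intros has_derivative_subset[OF D]\<close>)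
    then show ?thesis
      using t unfolding has_field_derivative_def f'_eq[OF t] by (simp add: F_def ex mult.commute[of _ "Fx (x, t)"])
  qed
  obtain R0 where R0: "\<And>z. z \<in> K \<Longrightarrow> norm z \<le> R0"
    using compact_imp_bounded[OF K(1)] unfolding bounded_iff by auto
  define R where "R = max R0 1"
  have far: "norm (x, t) > R0" if "0 \<le> t" "\<bar>x\<bar> > R \<or> t > R" for x t :: real
    using that norm_fst_le[of x t] norm_snd_le[of t x] unfolding R_def by auto
  have supp: "F (x, t) = 0 \<and> Fx (x, t) = 0 \<and> Ft (x, t) = 0" if "0 \<le> t" "\<bar>x\<bar> > R \<or> t > R" for x t
  proof -
    have z: "\<phi> z = 0" if "z \<in> ?S" "norm z > R0" for z
      using K(2)[of z] R0[of z] that by force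
    have n: "norm (x, t) > R0" by (rule far[OF that])
    have S: "(x, t) \<in> ?S" using that by auto

    \<comment> \<open>Outside the ball of radius \<open>R0\<close> the function agrees with 0 near
      \<open>(x, t)\<close> within the half plane, so 0 is a derivative; the slices determine the
      partial derivatives, hence those of \<open>f'\<close> vanish as well.\<close>
    have "((\<lambda>z. 0) has_derivative (\<lambda>v. 0)) (at (x, t) within ?S)" by simp
    then have "(\<phi> has_derivative (\<lambda>v. 0)) (at (x, t) within ?S)"
    proof (rule has_derivative_transform_within)
      show "0 < norm (x, t) - R0" using n by simp
      fix z assume "z \<in> ?S" "dist z (x, t) < norm (x, t) - R0"
      then show "0 = \<phi> z" using z[of z] norm_triangle_ineq2[of "(x, t)" z] by (simp add: dist_norm norm_minus_commute)
    qed (rule S)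
    from has_derivative_half_plane_slices[OF this that(1)] part[OF that(1), of x]
    show ?thesis using z[OF S n] that(1) by (simp add: F_def ex)
  qed
  obtain Ca where Ca: "Ca \<ge> 0" "\<And>x t. 0 \<le> t \<Longrightarrow> \<bar>F (x, t)\<bar> \<le> Ca"
    using half_plane_bounded[OF cF(1), of R] supp by blast
  obtain Cb where Cb: "Cb \<ge> 0" "\<And>x t. 0 \<le> t \<Longrightarrow> \<bar>Fx (x, t)\<bar> \<le> Cb"
    using half_plane_bounded[OF cF(2), of R] supp by blast
  obtain Cc where Cc: "Cc \<ge> 0" "\<And>x t. 0 \<le> t \<Longrightarrow> \<bar>Ft (x, t)\<bar> \<le> Cc"
    using half_plane_bounded[OF cF(3), of R] supp by blast
  define C where "C = Ca + Cb + Cc"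
  have bd: "\<bar>F (x, t)\<bar> \<le> C \<and> \<bar>Fx (x, t)\<bar> \<le> C \<and> \<bar>Ft (x, t)\<bar> \<le> C" if "0 \<le> t" for x t
    using Ca(1) Cb(1) Cc(1) Ca(2)[OF that, of x] Cb(2)[OF that, of x] Cc(2)[OF that, of x]
    unfolding C_def by linarith
  have val: "\<phi> (x, t) = F (x, t)" if "0 \<le> t" for x t using that by (simp add: F_def ex)
  have "R > 0" "C \<ge> 0" using Ca Cb Cc by (auto simp: R_def C_def)
  from that[OF cF this val part sliceD chain supp bd] show ?thesis by blast
qed

text \<open>Fubini moves the time integral inside, where the fundamental theorem of calculus leaves
  only the boundary term at \<open>t = 0\<close>. The bound and the support make the integrand
  integrable on a rectangle.\<close>

lemma integral_half_line_of_time_derivative: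
  fixes G g :: "real \<Rightarrow> real \<Rightarrow> real"
  assumes m: "(\<lambda>(t, \<xi>). g t \<xi>) \<in> borel_measurable (lborel \<Otimes>\<^sub>M lborel)"
    and D: "\<And>t \<xi>. 0 \<le> t \<Longrightarrow> ((\<lambda>t. G t \<xi>) has_real_derivative g t \<xi>) (at t within {0..})"
    and bnd: "\<And>t \<xi>. 0 \<le> t \<Longrightarrow> t \<le> R \<Longrightarrow> \<bar>g t \<xi>\<bar> \<le> C"
    and supp: "\<And>t \<xi>. 0 \<le> t \<Longrightarrow> \<bar>\<xi>\<bar> > R' \<or> t > R \<Longrightarrow> g t \<xi> = 0"
    and G: "\<And>t \<xi>. t > R \<Longrightarrow> G t \<xi> = 0" and R: "R > 0"
  shows "\<And>t. 0 \<le> t \<Longrightarrow> integrable lborel (g t)"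
    and "set_integrable lebesgue {0..} (\<lambda>t. LINT \<xi>|lborel. g t \<xi>)"
    and "(LINT t:{0..}|lebesgue. (LINT \<xi>|lborel. g t \<xi>)) = - (LINT \<xi>|lborel. G 0 \<xi>)"
proof -
  have gm: "g t \<in> borel_measurable lborel" for t
    using measurable_Pair2[OF m, of t] by simp
  have gm': "(\<lambda>t. g t \<xi>) \<in> borel_measurable lborel" for \<xi>
    using measurable_Pair1[OF m, of \<xi>] by simp
  show "integrable lborel (g t)" if "0 \<le> t" for t
  proof (rule integrableI_bounded_set[of "{-R'..R'}" _ _ C])
    show "AE \<xi> in lborel. \<xi> \<in> {-R'..R'} \<longrightarrow> norm (g t \<xi>) \<le> C"
    proof (rule AE_I2, rule impI)
      fix \<xi>
      have "0 \<le> C" using bnd[of 0 0] R by linarith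
      then show "norm (g t \<xi>) \<le> C"
        using bnd[OF that] supp[OF that] by (cases "t \<le> R") auto
    qed
    show "AE \<xi> in lborel. \<xi> \<notin> {-R'..R'} \<longrightarrow> g t \<xi> = 0"
    proof (rule AE_I2, rule impI)
      fix \<xi> assume "\<xi> \<notin> {-R'..R'}"
      then have "\<bar>\<xi>\<bar> > R'" by auto
      then show "g t \<xi> = 0" using supp[OF that] by blast
    qed
  qed (use gm in \<open>auto simp: emeasure_lborel_Icc_eq\<close>)
  define k where "k = (\<lambda>t \<xi>. indicator {0..R} t * g t \<xi>)"
  have km: "(\<lambda>(t, \<xi>). k t \<xi>) \<in> borel_measurable (lborel \<Otimes>\<^sub>M lborel)"
  proof -
    have "(\<lambda>z. indicator {0..R} (fst z) * (case z of (t, \<xi>) \<Rightarrow> g t \<xi>)) \<in> borel_measurable (lborel \<Otimes>\<^sub>M lborel)"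
      using m by (intro borel_measurable_times) auto
    then show ?thesis by (simp add: k_def case_prod_beta)
  qed
  have ki: "integrable (lborel \<Otimes>\<^sub>M lborel) (\<lambda>(t, \<xi>). k t \<xi>)"
  proof (rule integrableI_bounded_set[of "{0..R} \<times> {-R'..R'}" _ _ C])
    show "emeasure (lborel \<Otimes>\<^sub>M lborel) ({0..R} \<times> {-R'..R'}) < \<infinity>"
      by (subst lborel.emeasure_pair_measure_Times) (auto simp: ennreal_mult_less_top emeasure_lborel_Icc_eq)
    show "AE z in lborel \<Otimes>\<^sub>M lborel. z \<in> {0..R} \<times> {-R'..R'} \<longrightarrow> norm (case z of (t, \<xi>) \<Rightarrow> k t \<xi>) \<le> C"
      using bnd by (auto intro!: AE_I2 simp: k_def)
    show "AE z in lborel \<Otimes>\<^sub>M lborel. z \<notin> {0..R} \<times> {-R'..R'} \<longrightarrow> (case z of (t, \<xi>) \<Rightarrow> k t \<xi>) = 0"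
    proof (rule AE_I2, rule impI)
      fix z :: "real \<times> real" assume z: "z \<notin> {0..R} \<times> {-R'..R'}"
      obtain t \<xi> where zt: "z = (t, \<xi>)" by (cases z)
      show "(case z of (t, \<xi>) \<Rightarrow> k t \<xi>) = 0"
      proof (cases "t \<in> {0..R}")
        case True
        then have "\<bar>\<xi>\<bar> > R'" using z zt by auto
        then show ?thesis using supp[of t \<xi>] True zt by (auto simp: k_def)
      qed (simp add: k_def zt)
    qed
  qed (use km in auto)
  have inner: "(LINT t|lborel. k t \<xi>) = - G 0 \<xi>" for \<xi>
  proof -
    \<comment> \<open>\<open>G\<close> is known to vanish only for times strictly above
      \<open>R\<close>; the endpoint \<open>R + 1\<close> removes the upper boundary term.\<close>
    have si: "set_integrable lborel {0..R + 1} (\<lambda>t. g t \<xi>)"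
      unfolding set_integrable_def
    proof (rule integrableI_bounded_set[of "{0..R + 1}" _ _ "\<bar>C\<bar>"])
      show "AE t in lborel. t \<in> {0..R + 1} \<longrightarrow> norm (indicator {0..R + 1} t *\<^sub>R g t \<xi>) \<le> \<bar>C\<bar>"
      proof (rule AE_I2, rule impI)
        fix t assume "t \<in> {0..R + 1}"
        then show "norm (indicator {0..R + 1} t *\<^sub>R g t \<xi>) \<le> \<bar>C\<bar>"
          using bnd[of t \<xi>] supp[of t \<xi>] by (cases "t \<le> R") auto
      qed
    qed (use gm' in \<open>auto simp: emeasure_lborel_Icc_eq\<close>)
    have "((\<lambda>t. g t \<xi>) has_integral (G (R + 1) \<xi> - G 0 \<xi>)) {0..R + 1}"
    proof (rule fundamental_theorem_of_calculus)
      fix t assume "t \<in> {0..R + 1}"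
      then show "((\<lambda>t. G t \<xi>) has_vector_derivative g t \<xi>) (at t within {0..R + 1})"
        using DERIV_subset[OF D[of t \<xi>], of "{0..R + 1}"]
        by (auto simp: has_real_derivative_iff_has_vector_derivative)
    qed (use R in auto)
    then have "(LINT t:{0..R + 1}|lborel. g t \<xi>) = - G 0 \<xi>"
      using set_borel_integral_eq_integral(2)[OF si] G[of "R + 1" \<xi>] R by (simp add: integral_unique)
    moreover have "(\<lambda>t. indicator {0..R + 1} t *\<^sub>R g t \<xi>) = (\<lambda>t. k t \<xi>)"
    proof
      show "indicator {0..R + 1} t *\<^sub>R g t \<xi> = k t \<xi>" for t
        using supp[of t \<xi>] by (auto simp: k_def indicator_def)
    qed
    ultimately show ?thesis unfolding set_lebesgue_integral_def by simp
  qed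
  have eq: "indicator {0..} t *\<^sub>R (LINT \<xi>|lborel. g t \<xi>) = (LINT \<xi>|lborel. k t \<xi>)" for t
  proof (cases "0 \<le> t \<and> t > R")
    case True
    then have "g t = (\<lambda>\<xi>. 0)" using supp by blast
    then show ?thesis by (simp add: k_def)
  qed (auto simp: k_def indicator_def)
  have "integrable lborel (\<lambda>t. LINT \<xi>|lborel. k t \<xi>)"
    using lborel_pair.integrable_fst'[OF ki] by simp
  then have oi: "integrable lborel (\<lambda>t. indicator {0..} t *\<^sub>R (LINT \<xi>|lborel. g t \<xi>))" by (simp only: eq)
  then show "set_integrable lebesgue {0..} (\<lambda>t. LINT \<xi>|lborel. g t \<xi>)"
    unfolding set_integrable_def by (subst integrable_completion) auto
  have "(LINT t:{0..}|lebesgue. (LINT \<xi>|lborel. g t \<xi>)) = (LINT t|lborel. LINT \<xi>|lborel. k t \<xi>)"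
    unfolding set_lebesgue_integral_def eq[symmetric] by (rule integral_completion) (use oi in auto)
  also have "\<dots> = (LINT \<xi>|lborel. LINT t|lborel. k t \<xi>)"
    using lborel_pair.Fubini_integral[OF ki] by simp
  finally show "(LINT t:{0..}|lebesgue. (LINT \<xi>|lborel. g t \<xi>)) = - (LINT \<xi>|lborel. G 0 \<xi>)"
    by (simp add: inner)
qed

section \<open>The weak formulation\<close>

lemma has_iterated_integralI:
  assumes "\<And>t. 0 \<le> t \<Longrightarrow> integrable (\<nu> t) (f t) \<and> (LINT x|\<nu> t. f t x) = I t"
    and "set_integrable lebesgue {0..} I" "(LINT t:{0..}|lebesgue. I t) = J"
  shows "has_iterated_integral \<nu> f J"
proof -
  have eq: "(\<lambda>t. indicator {0..} t *\<^sub>R (LINT x|\<nu> t. f t x)) = (\<lambda>t. indicator {0..} t *\<^sub>R I t)"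
    using assms(1) by (auto simp: indicator_def)
  then show ?thesis
    using assms unfolding has_iterated_integral_def set_integrable_def set_lebesgue_integral_def eq by simp
qed

lemma measure_half_lines_measurable:
  fixes \<mu> :: "real measure"
  assumes "finite_measure \<mu>" "sets \<mu> = sets borel"
  shows "(\<lambda>x. measure \<mu> {..<x}) \<in> borel_measurable borel" "(\<lambda>x. measure \<mu> {x<..}) \<in> borel_measurable borel"
proof -
  interpret finite_measure \<mu> by fact
  show "(\<lambda>x. measure \<mu> {..<x}) \<in> borel_measurable borel"
    by (rule borel_measurable_mono, rule monoI, rule finite_measure_mono) (auto simp: assms)
  have "(\<lambda>x. - measure \<mu> {x<..}) \<in> borel_measurable borel"
    by (rule borel_measurable_mono, rule monoI, rule le_imp_neg_le, rule finite_measure_mono) (auto simp: assms)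
  then show "(\<lambda>x. measure \<mu> {x<..}) \<in> borel_measurable borel"
    using borel_measurable_uminus_eq by blast
qed

context lagrangian
begin

lemma lagrangian_form_\<mu>:
  assumes [measurable]: "\<Phi>x \<in> borel_measurable borel" "\<Phi>t \<in> borel_measurable borel"
    and i: "integrable lborel (\<lambda>\<xi>. h \<xi> * (\<Phi>t (y \<xi>) + U \<xi> * \<Phi>x (y \<xi>)))"
  shows "integrable \<mu> (\<lambda>x. \<Phi>t x + u x * \<Phi>x x) \<and>
    (LINT x|\<mu>. \<Phi>t x + u x * \<Phi>x x) = (LINT \<xi>|lborel. h \<xi> * (\<Phi>t (y \<xi>) + U \<xi> * \<Phi>x (y \<xi>)))"
  using i integral_\<mu>[of "\<lambda>x. \<Phi>t x + u x * \<Phi>x x"] by simp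

lemma lagrangian_form_\<rho>:
  assumes [measurable]: "\<Phi>x \<in> borel_measurable borel" "\<Phi>t \<in> borel_measurable borel"
    and \<rho>: "\<rho> \<in> borel_measurable lebesgue" "AE x in lebesgue. \<rho> x = pullback s x"
    and i: "integrable lborel (\<lambda>\<xi>. s \<xi> * (\<Phi>t (y \<xi>) + U \<xi> * \<Phi>x (y \<xi>)))"
  shows "integrable lebesgue (\<lambda>x. \<rho> x * \<Phi>t x + \<rho> x * u x * \<Phi>x x) \<and>
    (LINT x|lebesgue. \<rho> x * \<Phi>t x + \<rho> x * u x * \<Phi>x x) =
      (LINT \<xi>|lborel. s \<xi> * (\<Phi>t (y \<xi>) + U \<xi> * \<Phi>x (y \<xi>)))"
proof -
  let ?E = "\<lambda>x. pullback s x * \<Phi>t x + pullback s x * u x * \<Phi>x x"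
  have E [measurable]: "?E \<in> borel_measurable borel" by measurable
  have "AE \<xi> in lborel. pullback s (y \<xi>) * p \<xi> = s \<xi>"
    using q_s_zero(2) by (rule AE_pullback_mult)
  then have ae: "AE \<xi> in lborel. ?E (y \<xi>) * p \<xi> = s \<xi> * (\<Phi>t (y \<xi>) + U \<xi> * \<Phi>x (y \<xi>))"
  proof eventually_elim
    fix \<xi> assume "pullback s (y \<xi>) * p \<xi> = s \<xi>"
    then have "s \<xi> * (\<Phi>t (y \<xi>) + U \<xi> * \<Phi>x (y \<xi>)) = pullback s (y \<xi>) * p \<xi> * (\<Phi>t (y \<xi>) + U \<xi> * \<Phi>x (y \<xi>))"
      by simp
    then show "?E (y \<xi>) * p \<xi> = s \<xi> * (\<Phi>t (y \<xi>) + U \<xi> * \<Phi>x (y \<xi>))"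
      by (simp add: algebra_simps)
  qed
  have "integrable lborel (\<lambda>\<xi>. ?E (y \<xi>) * p \<xi>)"
    by (rule integrable_cong_AE_imp[OF i]) (use ae in \<open>auto elim!: eventually_mono\<close>)
  then have Ei: "integrable lborel ?E" by (simp only: integral_y(1)[OF E])
  have "(LINT \<xi>|lborel. ?E (y \<xi>) * p \<xi>) = (LINT \<xi>|lborel. s \<xi> * (\<Phi>t (y \<xi>) + U \<xi> * \<Phi>x (y \<xi>)))"
    by (rule integral_cong_AE) (use ae in auto)
  then have EI: "integral\<^sup>L lborel ?E = (LINT \<xi>|lborel. s \<xi> * (\<Phi>t (y \<xi>) + U \<xi> * \<Phi>x (y \<xi>)))"
    by (simp only: integral_y(2)[OF E])
  have m: "(\<lambda>x. \<rho> x * \<Phi>t x + \<rho> x * u x * \<Phi>x x) \<in> borel_measurable lebesgue"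
    using \<rho>(1) measurable_lebesgueI[of \<Phi>t] measurable_lebesgueI[of \<Phi>x] measurable_lebesgueI[of u]
    by (intro borel_measurable_add borel_measurable_times) auto
  have ae': "AE x in lebesgue. ?E x = \<rho> x * \<Phi>t x + \<rho> x * u x * \<Phi>x x"
    using \<rho>(2) by eventually_elim simp
  have Ei': "integrable lebesgue ?E" using Ei E by (simp add: integrable_completion)
  have "integrable lebesgue (\<lambda>x. \<rho> x * \<Phi>t x + \<rho> x * u x * \<Phi>x x)"
    by (rule integrable_cong_AE_imp[OF Ei' m ae'])
  moreover have "(LINT x|lebesgue. \<rho> x * \<Phi>t x + \<rho> x * u x * \<Phi>x x) = integral\<^sup>L lebesgue ?E"
    by (rule integral_cong_AE[OF m measurable_lebesgueI[OF E]]) (use ae' in \<open>auto elim!: eventually_mono\<close>)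
  moreover have "integral\<^sup>L lebesgue ?E = integral\<^sup>L lborel ?E" by (rule integral_completion) simp
  ultimately show ?thesis using EI by simp
qed

text \<open>
  The two integrands differ by half the \<open>\<xi>\<close>-derivative of \<open>U\<^sup>2 (\<Phi> \<circ> y)\<close>,
  whose integral vanishes.
\<close>

lemma lagrangian_form_u:
  assumes \<Phi>: "ac_deriv \<Phi> \<Phi>x" and [measurable]: "\<Phi>t \<in> borel_measurable borel"
    and supp: "\<And>x. \<bar>x\<bar> > R \<Longrightarrow> \<Phi> x = 0 \<and> \<Phi>x x = 0"
    and g_def: "g = (\<lambda>\<xi>. (1/2 * (H \<xi> - 1/2 * m) * \<Phi> (y \<xi>) + U \<xi> * (\<Phi>t (y \<xi>) + U \<xi> * \<Phi>x (y \<xi>))) * p \<xi>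
      + U \<xi> * \<Phi> (y \<xi>) * q \<xi>)"
    and i: "integrable lborel g"
  shows "integrable lebesgue (\<lambda>x. u x * \<Phi>t x + 1/2 * (u x)\<^sup>2 * \<Phi>x x
        + 1/4 * (measure \<mu> {..<x} - measure \<mu> {x<..}) * \<Phi> x) \<and>
    (LINT x|lebesgue. u x * \<Phi>t x + 1/2 * (u x)\<^sup>2 * \<Phi>x x
        + 1/4 * (measure \<mu> {..<x} - measure \<mu> {x<..}) * \<Phi> x) = integral\<^sup>L lborel g"
proof -
  note [measurable] = ac_derivD(1)[OF \<Phi>] ac_deriv_measurable[OF \<Phi>] ac_deriv_measurable[OF ac_H]
    measure_half_lines_measurable[OF finite_measure_\<mu> sets_\<mu>]
  define E where "E = (\<lambda>x. u x * \<Phi>t x + 1/2 * (u x)\<^sup>2 * \<Phi>x x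
        + 1/4 * (measure \<mu> {..<x} - measure \<mu> {x<..}) * \<Phi> x)"
  have E [measurable]: "E \<in> borel_measurable borel" unfolding E_def by measurable
  define d where "d = (\<lambda>\<xi>. (q \<xi> * U \<xi> + U \<xi> * q \<xi>) * \<Phi> (y \<xi>) + U \<xi> * U \<xi> * (\<Phi>x (y \<xi>) * p \<xi>))"
  have ac: "ac_deriv (\<lambda>\<xi>. U \<xi> * U \<xi> * \<Phi> (y \<xi>)) d"
    unfolding d_def by (rule ac_deriv_mult[OF ac_deriv_mult[OF ac_U ac_U] ac_deriv_compose[OF \<Phi>]])
  \<comment> \<open>Since \<open>y\<close> moves points by at most \<open>K\<close>, beyond
    \<open>R'\<close> the image lies strictly outside \<open>{-R..R}\<close>.\<close>
  define R' where "R' = \<bar>R\<bar> + K + 1"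
  have out: "\<bar>y \<xi>\<bar> > R" if "\<bar>\<xi>\<bar> \<ge> R'" for \<xi>
    using that y_bound[of \<xi>] unfolding R'_def by linarith
  have R'0: "R' \<ge> 0" using K_nonneg by (simp add: R'_def)
  have dI: "(\<lambda>\<xi>. indicator {-R'..R'} \<xi> *\<^sub>R d \<xi>) = d"
  proof
    fix \<xi> show "indicator {-R'..R'} \<xi> *\<^sub>R d \<xi> = d \<xi>"
    proof (cases "\<xi> \<in> {-R'..R'}")
      case False
      then have "\<bar>y \<xi>\<bar> > R" by (intro out) auto
      then show ?thesis using supp by (simp add: d_def)
    qed simp
  qed
  have di: "integrable lborel d"
    using ac_derivD(2)[OF ac, of "-R'" R'] unfolding set_integrable_def dI .
  have d0: "integral\<^sup>L lborel d = 0"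
    using ac_derivD(3)[OF ac, of "-R'" R'] supp[OF out[of R']] supp[OF out[of "-R'"]] R'0
    unfolding set_lebesgue_integral_def dI by simp
  \<comment> \<open>The half-line masses are known only where \<open>p\<close> is nonzero; where
    \<open>p = 0\<close>, also \<open>q = 0\<close> and both sides vanish.\<close>
  have ae: "AE \<xi> in lborel. E (y \<xi>) * p \<xi> = g \<xi> - 1/2 * d \<xi>"
    using AE_measure_\<mu>_half_lines
  proof eventually_elim
    fix \<xi> assume *: "p \<xi> = 0 \<or> measure \<mu> {..<y \<xi>} = H \<xi> \<and> measure \<mu> {y \<xi><..} = m - H \<xi>"
    show "E (y \<xi>) * p \<xi> = g \<xi> - 1/2 * d \<xi>"
    proof (cases "p \<xi> = 0")
      case True
      then show ?thesis using q_s_zero(1)[OF True] by (simp add: g_def d_def)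
    next
      case False
      then have E_y: "E (y \<xi>) = U \<xi> * \<Phi>t (y \<xi>) + 1/2 * (U \<xi>)\<^sup>2 * \<Phi>x (y \<xi>) + 1/4 * (H \<xi> - (m - H \<xi>)) * \<Phi> (y \<xi>)"
        using * by (simp add: E_def)
      show ?thesis unfolding E_y by (simp add: g_def d_def field_simps power2_eq_square)
    qed
  qed
  have gi: "integrable lborel (\<lambda>\<xi>. g \<xi> - 1/2 * d \<xi>)"
    by (intro Bochner_Integration.integrable_diff integrable_mult_right i di)
  have mE: "(\<lambda>\<xi>. E (y \<xi>) * p \<xi>) \<in> borel_measurable lborel" by simp
  have "integrable lborel (\<lambda>\<xi>. E (y \<xi>) * p \<xi>)"
    by (rule integrable_cong_AE_imp[OF gi mE]) (use ae in \<open>auto elim!: eventually_mono\<close>)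
  then have Ei: "integrable lborel E" by (simp only: integral_y(1)[OF E])
  have "(LINT \<xi>|lborel. E (y \<xi>) * p \<xi>) = (LINT \<xi>|lborel. g \<xi> - 1/2 * d \<xi>)"
    by (rule integral_cong_AE[OF mE borel_measurable_integrable[OF gi] ae])
  also have "\<dots> = integral\<^sup>L lborel g - (LINT \<xi>|lborel. 1/2 * d \<xi>)"
    by (rule Bochner_Integration.integral_diff[OF i]) (intro integrable_mult_right di)
  also have "(LINT \<xi>|lborel. 1/2 * d \<xi>) = 0" using d0 by simp
  finally have "integral\<^sup>L lborel E = integral\<^sup>L lborel g" by (simp only: integral_y(2)[OF E] diff_zero)
  then have "integrable lebesgue E \<and> integral\<^sup>L lebesgue E = integral\<^sup>L lborel g"
    using Ei E by (simp add: integrable_completion integral_completion)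
  then show ?thesis unfolding E_def .
qed

section \<open>Time derivatives and joint measurability along the flow\<close>

lemma y_at_derivative: "((\<lambda>t. y_at t \<xi>) has_real_derivative U_at t \<xi>) (at t within {0..})"
  unfolding y_at_def[abs_def] U_at_def
  by (auto intro!: derivative_eq_intros simp: field_simps)

lemma U_at_derivative: "((\<lambda>t. U_at t \<xi>) has_real_derivative 1/2 * (H \<xi> - 1/2 * m)) (at t within {0..})"
  unfolding U_at_def[abs_def] by (auto intro!: derivative_eq_intros)

lemma p_at_derivative: "((\<lambda>t. p_at t \<xi>) has_real_derivative q_at t \<xi>) (at t within {0..})"
  unfolding p_at_def[abs_def] q_at_def
  by (auto intro!: derivative_eq_intros simp: field_simps)

lemma at_measurable:
  "(\<lambda>z. y_at (fst z) (snd z)) \<in> borel_measurable (lborel \<Otimes>\<^sub>M lborel)"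
  "(\<lambda>z. U_at (fst z) (snd z)) \<in> borel_measurable (lborel \<Otimes>\<^sub>M lborel)"
  "(\<lambda>z. p_at (fst z) (snd z)) \<in> borel_measurable (lborel \<Otimes>\<^sub>M lborel)"
  "(\<lambda>z. q_at (fst z) (snd z)) \<in> borel_measurable (lborel \<Otimes>\<^sub>M lborel)"
proof -
  have [measurable]: "H \<in> borel_measurable borel" by (rule ac_deriv_measurable[OF ac_H])
  show "(\<lambda>z. y_at (fst z) (snd z)) \<in> borel_measurable (lborel \<Otimes>\<^sub>M lborel)"
    "(\<lambda>z. U_at (fst z) (snd z)) \<in> borel_measurable (lborel \<Otimes>\<^sub>M lborel)"
    "(\<lambda>z. p_at (fst z) (snd z)) \<in> borel_measurable (lborel \<Otimes>\<^sub>M lborel)"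
    "(\<lambda>z. q_at (fst z) (snd z)) \<in> borel_measurable (lborel \<Otimes>\<^sub>M lborel)"
    unfolding y_at_def U_at_def p_at_def q_at_def by measurable
qed

lemma y_at_outside:
  assumes "0 \<le> t" "\<bar>\<xi>\<bar> > R + bound_at R \<or> t > R"
  shows "\<bar>y_at t \<xi>\<bar> > R \<or> t > R"
proof (cases "t \<le> R")
  case True
  then show ?thesis using at_bounds(1)[OF assms(1) True, of \<xi>] assms(2) by linarith
qed simp

text \<open>The Eulerian initial data enter only through \<open>U = u0 \<circ> y\<close>,
  \<open>s = (\<rho>B \<circ> y) p\<close> and \<open>\<mu>\<close>, which convert the Lagrangian
  boundary terms at time 0. For negative times the given family is unconstrained.\<close>

theorem conservative_weak_solution_flow:
  fixes u' \<rho>' :: "real \<Rightarrow> real \<Rightarrow> real" and \<mu>' :: "real \<Rightarrow> real measure"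
  assumes r: "r \<in> borel_measurable lebesgue" "AE \<xi> in lebesgue. r \<xi> = s \<xi>"
    and sol: "\<And>t. 0 \<le> t \<Longrightarrow> (u' t, \<rho>' t, \<mu>' t) = M_map (y_at t, U_at t, H, r)"
    and u0: "u0 \<in> borel_measurable borel" "\<And>\<xi>. U \<xi> = u0 (y \<xi>)"
    and \<rho>0: "\<rho>B \<in> borel_measurable borel" "\<And>\<xi>. s \<xi> = \<rho>B (y \<xi>) * p \<xi>"
      "\<rho>0 \<in> borel_measurable lebesgue" "AE x in lebesgue. \<rho>0 x = \<rho>B x"
  shows "conservative_weak_solution u' \<rho>' \<mu>' u0 \<rho>0 \<mu> \<and> (\<forall>t\<ge>0. measure (\<mu>' t) UNIV = m)"
proof -
  note [measurable] = u0(1) \<rho>0(1)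
  have T: "(u' t, \<rho>' t, \<mu>' t) \<in> D_set \<and> \<rho>' t \<in> borel_measurable lebesgue \<and>
      (AE x in lebesgue. \<rho>' t x = surj_transport.pullback (y_at t) (p_at t) s x) \<and>
      u' t = lagrangian.u (y_at t) (U_at t) \<and> \<mu>' t = lagrangian.\<mu> (y_at t) h"
    if t: "0 \<le> t" for t
  proof -
    interpret T: lagrangian "y_at t" "U_at t" H "p_at t" "q_at t" h s "bound_at t" m
      by (rule lagrangian_at[OF t])
    obtain \<rho> where "M_map (y_at t, U_at t, H, r) = (T.u, \<rho>, T.\<mu>)" "(T.u, \<rho>, T.\<mu>) \<in> D_set"
      "\<rho> \<in> borel_measurable lebesgue" "AE x in lebesgue. \<rho> x = T.pullback s x"
      by (rule T.M_map_lagrangian[OF r])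
    then show ?thesis using sol[OF t] by auto
  qed
  have mass: "measure (\<mu>' t) UNIV = m" if "0 \<le> t" for t
    using lagrangian.measure_\<mu>_UNIV[OF lagrangian_at[OF that]] T[OF that] by simp
  have "conservative_weak_solution u' \<rho>' \<mu>' u0 \<rho>0 \<mu>"
    unfolding conservative_weak_solution_def
  proof (intro conjI ballI allI impI)
    show "(u' t, \<rho>' t, \<mu>' t) \<in> D_set" if "0 \<le> t" for t using T[OF that] by blast
  next
    fix \<phi> :: "real \<times> real \<Rightarrow> real" assume "\<phi> \<in> test_functions (UNIV \<times> {0..})"
    then obtain F Fx Ft R C where cont: "continuous_on UNIV F" "continuous_on UNIV Fx" "continuous_on UNIV Ft"
      and R: "R > 0" and C: "C \<ge> 0"
      and val: "\<And>x t. 0 \<le> t \<Longrightarrow> \<phi> (x, t) = F (x, t)" "\<And>x t. 0 \<le> t \<Longrightarrow> dx \<phi> x t = Fx (x, t)"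
        "\<And>x t. 0 \<le> t \<Longrightarrow> dt \<phi> x t = Ft (x, t)"
      and slice: "\<And>x t. 0 \<le> t \<Longrightarrow> ((\<lambda>z. F (z, t)) has_real_derivative Fx (x, t)) (at x)"
      and chain: "\<And>a a' t. 0 \<le> t \<Longrightarrow> (a has_real_derivative a') (at t within {0..}) \<Longrightarrow>
        ((\<lambda>s. F (a s, s)) has_real_derivative (Ft (a t, t) + a' * Fx (a t, t))) (at t within {0..})"
      and supp: "\<And>x t. 0 \<le> t \<Longrightarrow> \<bar>x\<bar> > R \<or> t > R \<Longrightarrow> F (x, t) = 0 \<and> Fx (x, t) = 0 \<and> Ft (x, t) = 0"
      and bd: "\<And>x t. 0 \<le> t \<Longrightarrow> \<bar>F (x, t)\<bar> \<le> C \<and> \<bar>Fx (x, t)\<bar> \<le> C \<and> \<bar>Ft (x, t)\<bar> \<le> C"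
      by (rule test_function_half_plane) blast
    have slice_c: "continuous_on UNIV (\<lambda>x. G (x, t))" if "continuous_on UNIV G" for G :: "real \<times> real \<Rightarrow> real" and t
      by (rule continuous_on_compose2[OF that]) (auto intro!: continuous_intros)
    have slice_m [measurable]: "(\<lambda>x. F (x, t)) \<in> borel_measurable borel" "(\<lambda>x. Fx (x, t)) \<in> borel_measurable borel"
      "(\<lambda>x. Ft (x, t)) \<in> borel_measurable borel" for t
      by (intro borel_measurable_continuous_onI slice_c cont)+
    have curve: "(\<lambda>z. G (y_at (fst z) (snd z), fst z)) \<in> borel_measurable (lborel \<Otimes>\<^sub>M lborel)"
      if "continuous_on UNIV G" for G :: "real \<times> real \<Rightarrow> real"
      by (rule measurable_compose[OF borel_measurable_Pair[OF at_measurable(1)] borel_measurable_continuous_onI[OF that]]) simp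
    note curves = curve[OF cont(1)] curve[OF cont(2)] curve[OF cont(3)]
    let ?B = "bound_at R"
    have B0: "?B \<ge> 0" using at_bounds(1)[of 0 R 0] R by linarith
    have z: "F (y_at t \<xi>, t) = 0 \<and> Fx (y_at t \<xi>, t) = 0 \<and> Ft (y_at t \<xi>, t) = 0"
      if "0 \<le> t" "\<bar>\<xi>\<bar> > R + ?B \<or> t > R" for t \<xi>
      using supp[OF that(1)] y_at_outside[OF that] by blast
    \<comment> \<open>The material derivative: the time derivative of the test function along the
      trajectory of \<open>\<xi>\<close>.\<close>
    define D where "D t \<xi> = Ft (y_at t \<xi>, t) + U_at t \<xi> * Fx (y_at t \<xi>, t)" for t \<xi>
    have Dm: "(\<lambda>z. D (fst z) (snd z)) \<in> borel_measurable (lborel \<Otimes>\<^sub>M lborel)"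
      unfolding D_def by (intro borel_measurable_add borel_measurable_times curves at_measurable)
    have Db: "\<bar>D t \<xi>\<bar> \<le> C + ?B * C" if "0 \<le> t" "t \<le> R" for t \<xi>
    proof -
      have "\<bar>U_at t \<xi> * Fx (y_at t \<xi>, t)\<bar> \<le> ?B * C"
        unfolding abs_mult using at_bounds(2)[OF that] bd[OF that(1)] B0 by (intro mult_mono) auto
      then show ?thesis using bd[OF that(1), of "y_at t \<xi>"] unfolding D_def by linarith
    qed
    have FD: "((\<lambda>t. F (y_at t \<xi>, t)) has_real_derivative D t \<xi>) (at t within {0..})" if "0 \<le> t" for t \<xi>
      unfolding D_def by (rule chain[OF that y_at_derivative])
    have at0: "y_at 0 = y" "U_at 0 = U" "p_at 0 = p"
      by (auto simp: y_at_def U_at_def p_at_def)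

    \<comment> \<open>The flow does not change \<open>h\<close> and \<open>s\<close>, so the energy
      and the density equation are the same statement with \<open>w = h\<close> and
      \<open>w = s\<close>.\<close>
    have weighted: "\<And>t. 0 \<le> t \<Longrightarrow> integrable lborel (\<lambda>\<xi>. w \<xi> * D t \<xi>)"
        "set_integrable lebesgue {0..} (\<lambda>t. LINT \<xi>|lborel. w \<xi> * D t \<xi>)"
        "(LINT t:{0..}|lebesgue. (LINT \<xi>|lborel. w \<xi> * D t \<xi>)) = - (LINT \<xi>|lborel. w \<xi> * F (y \<xi>, 0))"
      if w [measurable]: "w \<in> borel_measurable borel" and wK: "\<And>\<xi>. \<bar>w \<xi>\<bar> \<le> K" for w
    proof -
      have m: "(\<lambda>(t, \<xi>). w \<xi> * D t \<xi>) \<in> borel_measurable (lborel \<Otimes>\<^sub>M lborel)"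
        unfolding case_prod_beta by (intro borel_measurable_times Dm) measurable
      have "((\<lambda>t. w \<xi> * F (y_at t \<xi>, t)) has_real_derivative w \<xi> * D t \<xi>) (at t within {0..})" if "0 \<le> t" for t \<xi>
        by (rule DERIV_cmult[OF FD[OF that]])
      moreover have "\<bar>w \<xi> * D t \<xi>\<bar> \<le> K * (C + ?B * C)" if "0 \<le> t" "t \<le> R" for t \<xi>
        unfolding abs_mult using wK Db[OF that] K_nonneg by (intro mult_mono) auto
      moreover have "w \<xi> * D t \<xi> = 0" if "0 \<le> t" "\<bar>\<xi>\<bar> > R + ?B \<or> t > R" for t \<xi>
        using z[OF that] by (simp add: D_def)
      moreover have "w \<xi> * F (y_at t \<xi>, t) = 0" if "t > R" for t \<xi>
        using z[of t \<xi>] that R by simp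
      ultimately show "\<And>t. 0 \<le> t \<Longrightarrow> integrable lborel (\<lambda>\<xi>. w \<xi> * D t \<xi>)"
        "set_integrable lebesgue {0..} (\<lambda>t. LINT \<xi>|lborel. w \<xi> * D t \<xi>)"
        "(LINT t:{0..}|lebesgue. (LINT \<xi>|lborel. w \<xi> * D t \<xi>)) = - (LINT \<xi>|lborel. w \<xi> * F (y \<xi>, 0))"
        using integral_half_line_of_time_derivative[OF m, of "\<lambda>t \<xi>. w \<xi> * F (y_at t \<xi>, t)" R "K * (C + ?B * C)" "R + ?B"] R
        by (simp_all add: at0)
    qed

    \<comment> \<open>The product rule for \<open>U_at * F * p_at\<close>, where \<open>p_at\<close>
      has time derivative \<open>q_at\<close>; this last term is what makes the correction by a
      \<open>\<xi>\<close>-derivative necessary.\<close>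
    define g where "g t \<xi> = (1/2 * (H \<xi> - 1/2 * m) * F (y_at t \<xi>, t) + U_at t \<xi> * D t \<xi>) * p_at t \<xi>
      + U_at t \<xi> * F (y_at t \<xi>, t) * q_at t \<xi>" for t \<xi>
    have [measurable]: "H \<in> borel_measurable borel" by (rule ac_deriv_measurable[OF ac_H])
    have gm: "(\<lambda>(t, \<xi>). g t \<xi>) \<in> borel_measurable (lborel \<Otimes>\<^sub>M lborel)"
      unfolding case_prod_beta g_def
      by (intro borel_measurable_add borel_measurable_times curves at_measurable Dm) measurable
    have gD: "((\<lambda>t. U_at t \<xi> * F (y_at t \<xi>, t) * p_at t \<xi>) has_real_derivative g t \<xi>) (at t within {0..})"
      if "0 \<le> t" for t \<xi>
      by (rule DERIV_cong[OF DERIV_mult[OF DERIV_mult[OF U_at_derivative FD[OF that]] p_at_derivative]])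
        (simp add: g_def algebra_simps)
    have gb: "\<bar>g t \<xi>\<bar> \<le> (m * C + ?B * (C + ?B * C)) * ?B + ?B * C * ?B" if t: "0 \<le> t" "t \<le> R" for t \<xi>
    proof -
      have "\<bar>1/2 * (H \<xi> - 1/2 * m)\<bar> \<le> m" using H_bounds[of \<xi>] by (simp add: abs_le_iff)
      then have "\<bar>1/2 * (H \<xi> - 1/2 * m) * F (y_at t \<xi>, t)\<bar> \<le> m * C"
        unfolding abs_mult[of _ "F (y_at t \<xi>, t)"] using bd[OF t(1)] m_nonneg by (intro mult_mono) auto
      moreover have "\<bar>U_at t \<xi> * D t \<xi>\<bar> \<le> ?B * (C + ?B * C)"
        unfolding abs_mult using at_bounds(2)[OF t] Db[OF t] B0 by (intro mult_mono) auto
      ultimately have "\<bar>1/2 * (H \<xi> - 1/2 * m) * F (y_at t \<xi>, t) + U_at t \<xi> * D t \<xi>\<bar> \<le> m * C + ?B * (C + ?B * C)"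
        by linarith
      then have 1: "\<bar>(1/2 * (H \<xi> - 1/2 * m) * F (y_at t \<xi>, t) + U_at t \<xi> * D t \<xi>) * p_at t \<xi>\<bar> \<le> (m * C + ?B * (C + ?B * C)) * ?B"
        unfolding abs_mult[of _ "p_at t \<xi>"] using at_bounds(4)[OF t] B0 C m_nonneg by (intro mult_mono) auto
      have "\<bar>U_at t \<xi> * F (y_at t \<xi>, t)\<bar> \<le> ?B * C"
        unfolding abs_mult using at_bounds(2)[OF t] bd[OF t(1)] B0 by (intro mult_mono) auto
      then have "\<bar>U_at t \<xi> * F (y_at t \<xi>, t) * q_at t \<xi>\<bar> \<le> ?B * C * ?B"
        unfolding abs_mult[of _ "q_at t \<xi>"] using at_bounds(5)[OF t] B0 C by (intro mult_mono) auto
      then show ?thesis using 1 unfolding g_def by linarith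
    qed
    have gz: "g t \<xi> = 0" if "0 \<le> t" "\<bar>\<xi>\<bar> > R + ?B \<or> t > R" for t \<xi>
      using z[OF that] by (simp add: g_def D_def)
    have Gz: "U_at t \<xi> * F (y_at t \<xi>, t) * p_at t \<xi> = 0" if "t > R" for t \<xi>
      using z[of t \<xi>] that R by simp
    have gI: "\<And>t. 0 \<le> t \<Longrightarrow> integrable lborel (g t)"
      "set_integrable lebesgue {0..} (\<lambda>t. LINT \<xi>|lborel. g t \<xi>)"
      "(LINT t:{0..}|lebesgue. (LINT \<xi>|lborel. g t \<xi>)) = - (LINT \<xi>|lborel. U_at 0 \<xi> * F (y_at 0 \<xi>, 0) * p_at 0 \<xi>)"
      using integral_half_line_of_time_derivative[OF gm, of "\<lambda>t \<xi>. U_at t \<xi> * F (y_at t \<xi>, t) * p_at t \<xi>" R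
          "(m * C + ?B * (C + ?B * C)) * ?B + ?B * C * ?B" "R + ?B"] gD gb gz Gz R by blast+

    show "has_iterated_integral (\<lambda>t. lebesgue)
          (\<lambda>t x. u' t x * dt \<phi> x t + 1/2 * (u' t x)\<^sup>2 * dx \<phi> x t
                  + 1/4 * (measure (\<mu>' t) {..<x} - measure (\<mu>' t) {x<..}) * \<phi> (x, t))
          (- (LINT x|lebesgue. u0 x * \<phi> (x, 0)))"
    proof (rule has_iterated_integralI[where I = "\<lambda>t. LINT \<xi>|lborel. g t \<xi>"])
      fix t :: real assume t: "0 \<le> t"
      interpret T: lagrangian "y_at t" "U_at t" H "p_at t" "q_at t" h s "bound_at t" m
        by (rule lagrangian_at[OF t])
      have "ac_deriv (\<lambda>x. F (x, t)) (\<lambda>x. Fx (x, t))"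
        by (rule ac_deriv_C1[OF slice[OF t] slice_c[OF cont(2)]])
      moreover have "\<bar>x\<bar> > R \<Longrightarrow> F (x, t) = 0 \<and> Fx (x, t) = 0" for x using supp[OF t] by blast
      moreover have "integrable lborel (g t)" using gI(1)[OF t] .
      ultimately show "integrable lebesgue (\<lambda>x. u' t x * dt \<phi> x t + 1/2 * (u' t x)\<^sup>2 * dx \<phi> x t
                  + 1/4 * (measure (\<mu>' t) {..<x} - measure (\<mu>' t) {x<..}) * \<phi> (x, t)) \<and>
        (LINT x|lebesgue. u' t x * dt \<phi> x t + 1/2 * (u' t x)\<^sup>2 * dx \<phi> x t
                  + 1/4 * (measure (\<mu>' t) {..<x} - measure (\<mu>' t) {x<..}) * \<phi> (x, t)) = (LINT \<xi>|lborel. g t \<xi>)"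
        using T.lagrangian_form_u[of "\<lambda>x. F (x, t)" "\<lambda>x. Fx (x, t)" "\<lambda>x. Ft (x, t)" R "g t"] T[OF t] val[OF t]
        by (simp add: g_def[abs_def] D_def)
    next
      have "(LINT x|lebesgue. u0 x * \<phi> (x, 0)) = (LINT x|lborel. u0 x * F (x, 0))"
        by (simp add: val integral_completion)
      \<comment> \<open>At time 0 the weight \<open>p d\<xi>\<close> is transported back to
        \<open>dx\<close>.\<close>
      also have "\<dots> = (LINT \<xi>|lborel. U_at 0 \<xi> * F (y_at 0 \<xi>, 0) * p_at 0 \<xi>)"
        using integral_y(2)[of "\<lambda>x. u0 x * F (x, 0)"] by (simp add: at0 u0(2))
      finally show "(LINT t:{0..}|lebesgue. (LINT \<xi>|lborel. g t \<xi>)) = - (LINT x|lebesgue. u0 x * \<phi> (x, 0))"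
        using gI(3) by simp
    qed (rule gI(2))

    show "has_iterated_integral (\<lambda>t. lebesgue)
          (\<lambda>t x. \<rho>' t x * dt \<phi> x t + \<rho>' t x * u' t x * dx \<phi> x t)
          (- (LINT x|lebesgue. \<rho>0 x * \<phi> (x, 0)))"
    proof (rule has_iterated_integralI[where I = "\<lambda>t. LINT \<xi>|lborel. s \<xi> * D t \<xi>"])
      fix t :: real assume t: "0 \<le> t"
      interpret T: lagrangian "y_at t" "U_at t" H "p_at t" "q_at t" h s "bound_at t" m
        by (rule lagrangian_at[OF t])
      show "integrable lebesgue (\<lambda>x. \<rho>' t x * dt \<phi> x t + \<rho>' t x * u' t x * dx \<phi> x t) \<and>
         (LINT x|lebesgue. \<rho>' t x * dt \<phi> x t + \<rho>' t x * u' t x * dx \<phi> x t) = (LINT \<xi>|lborel. s \<xi> * D t \<xi>)"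
        using T.lagrangian_form_\<rho>[of "\<lambda>x. Fx (x, t)" "\<lambda>x. Ft (x, t)" "\<rho>' t"] T[OF t] val[OF t]
          weighted(1)[OF s_measurable q_s_le(2) t]
        unfolding D_def by simp
    next
      have "(LINT x|lebesgue. \<rho>0 x * \<phi> (x, 0)) = (LINT x|lebesgue. \<rho>B x * F (x, 0))"
      proof (rule integral_cong_AE)
        show "(\<lambda>x. \<rho>0 x * \<phi> (x, 0)) \<in> borel_measurable lebesgue"
          using \<rho>0(3) measurable_lebesgueI[OF slice_m(1)[of 0]] by (simp add: val)
        show "(\<lambda>x. \<rho>B x * F (x, 0)) \<in> borel_measurable lebesgue"
          by (rule measurable_lebesgueI) measurable
        show "AE x in lebesgue. \<rho>0 x * \<phi> (x, 0) = \<rho>B x * F (x, 0)"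
          using \<rho>0(4) by eventually_elim (simp add: val)
      qed
      also have "\<dots> = (LINT x|lborel. \<rho>B x * F (x, 0))" by (simp add: integral_completion)
      \<comment> \<open>The factor \<open>p\<close> of the change of variables is already contained
        in \<open>s\<close>.\<close>
      also have "\<dots> = (LINT \<xi>|lborel. s \<xi> * F (y \<xi>, 0))"
        using integral_y(2)[of "\<lambda>x. \<rho>B x * F (x, 0)"] by (simp add: \<rho>0(2) mult_ac)
      finally show "(LINT t:{0..}|lebesgue. (LINT \<xi>|lborel. s \<xi> * D t \<xi>)) = - (LINT x|lebesgue. \<rho>0 x * \<phi> (x, 0))"
        using weighted(3)[OF s_measurable q_s_le(2)] by simp
    qed (rule weighted(2)[OF s_measurable q_s_le(2)])

    have hK: "\<bar>h \<xi>\<bar> \<le> K" for \<xi> using h_le[of \<xi>] h_ge[of \<xi>] by simp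
    show "has_iterated_integral \<mu>' (\<lambda>t x. dt \<phi> x t + u' t x * dx \<phi> x t) (- (LINT x|\<mu>. \<phi> (x, 0)))"
    proof (rule has_iterated_integralI[where I = "\<lambda>t. LINT \<xi>|lborel. h \<xi> * D t \<xi>"])
      fix t :: real assume t: "0 \<le> t"
      interpret T: lagrangian "y_at t" "U_at t" H "p_at t" "q_at t" h s "bound_at t" m
        by (rule lagrangian_at[OF t])
      show "integrable (\<mu>' t) (\<lambda>x. dt \<phi> x t + u' t x * dx \<phi> x t) \<and>
         (LINT x|\<mu>' t. dt \<phi> x t + u' t x * dx \<phi> x t) = (LINT \<xi>|lborel. h \<xi> * D t \<xi>)"
        using T.lagrangian_form_\<mu>[of "\<lambda>x. Fx (x, t)" "\<lambda>x. Ft (x, t)"] T[OF t] val[OF t]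
          weighted(1)[OF h_measurable hK t]
        unfolding D_def by simp
    next
      have "(LINT x|\<mu>. \<phi> (x, 0)) = (LINT \<xi>|lborel. h \<xi> * F (y \<xi>, 0))"
        using integral_\<mu>(2)[OF slice_m(1)[of 0]] by (simp add: val)
      then show "(LINT t:{0..}|lebesgue. (LINT \<xi>|lborel. h \<xi> * D t \<xi>)) = - (LINT x|\<mu>. \<phi> (x, 0))"
        using weighted(3)[OF h_measurable hK] by simp
    qed (rule weighted(2)[OF h_measurable hK])
  qed
  then show ?thesis using mass by blast
qed

end

theorem theorem3p5:
  fixes u0 \<rho>0 :: "real \<Rightarrow> real" and \<mu>0 :: "real measure"
    and u \<rho> :: "real \<Rightarrow> real \<Rightarrow> real" and \<mu> :: "real \<Rightarrow> real measure"
  assumes "(u0, \<rho>0, \<mu>0) \<in> D_set"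
    and "\<And>t. t \<ge> 0 \<Longrightarrow> (u t, \<rho> t, \<mu> t) = T_map t (u0, \<rho>0, \<mu>0)"
  shows "conservative_weak_solution u \<rho> \<mu> u0 \<rho>0 \<mu>0
    \<and> (\<forall>t\<ge>0. measure (\<mu> t) UNIV = measure \<mu>0 UNIV)"
proof -
  obtain y r p q h \<rho>B K where
    L: "L_map (u0, \<rho>0, \<mu>0) = (y, \<lambda>\<xi>. u0 (y \<xi>), \<lambda>\<xi>. \<xi> - y \<xi>, r)"
    and lag: "lagrangian y (\<lambda>\<xi>. u0 (y \<xi>)) (\<lambda>\<xi>. \<xi> - y \<xi>) p q h (\<lambda>\<xi>. \<rho>B (y \<xi>) * p \<xi>) K (measure \<mu>0 UNIV)"
    and r: "r \<in> borel_measurable lebesgue" "AE \<xi> in lebesgue. r \<xi> = \<rho>B (y \<xi>) * p \<xi>"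
    and \<rho>B: "\<rho>B \<in> borel_measurable borel" "AE x in lebesgue. \<rho>0 x = \<rho>B x"
    and push: "distr (density lborel (\<lambda>\<xi>. ennreal (h \<xi>))) borel y = \<mu>0"
    and u0: "continuous_on UNIV u0"
    by (rule L_map_lagrangian[OF assms(1)])
  interpret lagrangian y "\<lambda>\<xi>. u0 (y \<xi>)" "\<lambda>\<xi>. \<xi> - y \<xi>" p q h "\<lambda>\<xi>. \<rho>B (y \<xi>) * p \<xi>" K "measure \<mu>0 UNIV"
    by (rule lag)
  have "\<rho>0 \<in> borel_measurable lebesgue" using assms(1) by (auto simp: D_set_def L2_def)
  \<comment> \<open>\<open>push\<close> identifies the measure \<open>\<mu>\<close> of the
    interpreted locale with the given initial measure.\<close>
  then show ?thesis
    using conservative_weak_solution_flow[OF r _ borel_measurable_continuous_onI[OF u0] refl \<rho>B(1) refl _ \<rho>B(2), of u \<rho> \<mu>]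
      assms(2) push
    by (simp add: T_map_def L S_map_eq \<mu>_def)
qed

end
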